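(* For each constant $d$, RP-$d$-SP can be solved in $2^{\mathcal{O}(k\log k)}+(n+m)^{\mathcal{O}(1)}$ time, where $n=|U|$ and $m=|\mathcal{S}|$.
   Context: An instance of Rejection-Proof $d$-Set Packing (RP-$d$-SP) consists of a finite universe $U=U_1\cup\dots\cup U_p$ partitioned among $p$ agents, a collection $\mathcal{S}\subseteq 2^U$ of sets each of size at most $d$, and an integer $k$. A set $S$ is $i$-internal if $S\subseteq U_i$. For a collection $\mathcal{X}\subseteq\mathcal{S}$ of pairwise disjoint sets, agent $i$ rejects $\mathcal{X}$ if there exist $\mathcal{X}_{\mathrm{rej}}\subseteq\mathcal{X}$ and a collection $\mathcal{X}_{\mathrm{int}}\subseteq\mathcal{S}$ of $i$-internal sets such that $(\mathcal{X}\setminus\mathcal{X}_{\mathrm{rej}})\cup\mathcal{X}_{\mathrm{int}}$ consists of pairwise disjoint sets and covers more elements of $U_i$ than $\mathcal{X}$; $\mathcal{X}$ is rejection-proof if no agent rejects it. The task is to decide whether there is a rejection-proof collection of pairwise disjoint sets of $\mathcal{S}$ covering at least $k$ elements of $U$. *)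

theory Defs
  imports Complex_Main "HOL-Library.Disjoint_Sets" "HOL-Library.Landau_Symbols"
begin

section \<open>Rejection-proof set packing\<close>

record 'a rp_instance =
  universe :: "'a set"
  agents :: nat
  part :: "nat \<Rightarrow> 'a set"
  family :: "'a set set"
  target :: nat

text \<open>The agents are \<open>1, \<dots>, p\<close>; an agent may own no element.\<close>

definition rp_d_sp_instance :: "nat \<Rightarrow> 'a rp_instance \<Rightarrow> bool" where
  "rp_d_sp_instance d I \<longleftrightarrow>
     finite (universe I) \<and>
     universe I = (\<Union>i\<in>{1..agents I}. part I i) \<and>
     disjoint_family_on (part I) {1..agents I} \<and>
     family I \<subseteq> Pow (universe I) \<and>
     (\<forall>S\<in>family I. card S \<le> d)"

definition internal :: "'a rp_instance \<Rightarrow> nat \<Rightarrow> 'a set \<Rightarrow> bool" where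
  "internal I i S \<longleftrightarrow> S \<subseteq> part I i"

definition packing :: "'a rp_instance \<Rightarrow> 'a set set \<Rightarrow> bool" where
  "packing I X \<longleftrightarrow> X \<subseteq> family I \<and> disjoint X"

definition rejects :: "'a rp_instance \<Rightarrow> nat \<Rightarrow> 'a set set \<Rightarrow> bool" where
  "rejects I i X \<longleftrightarrow>
     (\<exists>X_rej X_int. X_rej \<subseteq> X \<and> X_int \<subseteq> family I \<and> (\<forall>S\<in>X_int. internal I i S) \<and>
        disjoint ((X - X_rej) \<union> X_int) \<and>
        card (\<Union>((X - X_rej) \<union> X_int) \<inter> part I i) > card (\<Union>X \<inter> part I i))"

definition rejection_proof :: "'a rp_instance \<Rightarrow> 'a set set \<Rightarrow> bool" where
  "rejection_proof I X \<longleftrightarrow> (\<forall>i\<in>{1..agents I}. \<not> rejects I i X)"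

definition yes_instance :: "'a rp_instance \<Rightarrow> bool" where
  "yes_instance I \<longleftrightarrow>
     (\<exists>X. packing I X \<and> rejection_proof I X \<and> card (\<Union>X) \<ge> target I)"


section \<open>Random access machines\<close>

text \<open>
  A load/store RAM under the uniform cost measure. Registers and memory cells hold natural
  numbers. The only arithmetic is addition and truncated subtraction; there is no
  multiplication, so a run of \<open>t\<close> steps lengthens numbers by at most \<open>t\<close> bits beyond those of
  the input and the program, and uniform cost is polynomially related to Turing machine time.
\<close>

datatype instr =
    Const nat nat     \<comment> \<open>\<open>r\<^sub>a := c\<close>\<close>
  | Move nat nat      \<comment> \<open>\<open>r\<^sub>a := r\<^sub>b\<close>\<close>
  | Add nat nat nat   \<comment> \<open>\<open>r\<^sub>a := r\<^sub>b + r\<^sub>c\<close>\<close>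
  | Sub nat nat nat   \<comment> \<open>\<open>r\<^sub>a := max 0 (r\<^sub>b - r\<^sub>c)\<close>\<close>
  | Load nat nat      \<comment> \<open>\<open>r\<^sub>a := mem[r\<^sub>b]\<close>\<close>
  | Store nat nat     \<comment> \<open>\<open>mem[r\<^sub>a] := r\<^sub>b\<close>\<close>
  | Jump nat          \<comment> \<open>\<open>goto l\<close>\<close>
  | Jump_zero nat nat \<comment> \<open>\<open>if r\<^sub>a = 0 then goto l\<close>\<close>

text \<open>A configuration consists of program counter, registers and memory.\<close>

type_synonym config = "nat \<times> (nat \<Rightarrow> nat) \<times> (nat \<Rightarrow> nat)"

fun exec :: "instr \<Rightarrow> config \<Rightarrow> config" where
  "exec (Const a c) (pc, r, mem) = (pc + 1, r(a := c), mem)"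
| "exec (Move a b) (pc, r, mem) = (pc + 1, r(a := r b), mem)"
| "exec (Add a b c) (pc, r, mem) = (pc + 1, r(a := r b + r c), mem)"
| "exec (Sub a b c) (pc, r, mem) = (pc + 1, r(a := r b - r c), mem)"
| "exec (Load a b) (pc, r, mem) = (pc + 1, r(a := mem (r b)), mem)"
| "exec (Store a b) (pc, r, mem) = (pc + 1, r, mem(r a := r b))"
| "exec (Jump l) (pc, r, mem) = (l, r, mem)"
| "exec (Jump_zero a l) (pc, r, mem) = (if r a = 0 then l else pc + 1, r, mem)"

text \<open>The machine halts when the program counter leaves the program.\<close>

fun step :: "instr list \<Rightarrow> config \<Rightarrow> config" where
  "step P (pc, r, mem) = (if pc < length P then exec (P ! pc) (pc, r, mem) else (pc, r, mem))"

definition initial :: "nat list \<Rightarrow> config" where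
  "initial w = (0, (\<lambda>_. 0), (\<lambda>a. if a < length w then w ! a else 0))"

text \<open>On input \<open>w\<close>, \<open>P\<close> halts after at most \<open>t\<close> steps with \<open>out\<close> in register \<open>0\<close>.\<close>

definition halts_within :: "instr list \<Rightarrow> nat list \<Rightarrow> nat \<Rightarrow> nat \<Rightarrow> bool" where
  "halts_within P w t out \<longleftrightarrow>
     (\<exists>pc r mem. (step P ^^ t) (initial w) = (pc, r, mem) \<and> pc \<ge> length P \<and> r 0 = out)"


section \<open>Instances as machine inputs\<close>

text \<open>
  An input consists of the header \<open>n, p, m, k\<close>, the owner of each element, and each set of the
  family as its size followed by its elements. Elements are named by their position in an
  arbitrary enumeration \<open>us\<close> of the universe; the sets of the family come in arbitrary order
  without repetition, and so do the elements of each set.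
\<close>

definition encodes :: "nat list \<Rightarrow> 'a rp_instance \<Rightarrow> bool" where
  "encodes w I \<longleftrightarrow>
     (\<exists>us owners Ss.
        distinct us \<and> set us = universe I \<and>
        length owners = length us \<and>
        (\<forall>j<length us. owners ! j \<in> {1..agents I} \<and> us ! j \<in> part I (owners ! j)) \<and>
        (\<forall>s\<in>set Ss. distinct s \<and> set s \<subseteq> {..<length us}) \<and>
        distinct (map (\<lambda>s. (!) us ` set s) Ss) \<and>
        set (map (\<lambda>s. (!) us ` set s) Ss) = family I \<and>
        w = [length us, agents I, length Ss, target I] @ owners @
            concat (map (\<lambda>s. length s # s) Ss))"

end

theory Submission
  imports Defs
begin

text \<open>
  Agent \<open>i\<close> rejects a packing \<open>X\<close> iff some packing \<open>R\<close> of sets that lie in \<open>X\<close> or are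
  \<open>i\<close>-internal covers more of agent \<open>i\<close>'s elements. A packing \<open>M\<close> of internal sets of maximum total
  coverage stays unrejected when cross sets disjoint from it are added. Hence the answer is yes as soon
  as some packing covers \<open>(d + 1) * k\<close> elements: either \<open>M\<close> covers \<open>k\<close> elements, or fewer than \<open>k\<close> sets
  of that packing meet \<open>M\<close> and the others cover \<open>k\<close> elements.

  If a greedy packing covers a set \<open>W\<close> of fewer than \<open>q = (d + 1) * k\<close> elements, every nonempty set of the
  family meets \<open>W\<close>, so every packing has fewer than \<open>q\<close> nonempty sets. The internal sets, and then
  the cross sets, are thinned out to poly(\<open>k\<close>) many, such that each set \<open>S\<close> disjoint from a
  set \<open>Y\<close> of at most \<open>d * q\<close> elements has a substitute avoiding \<open>Y\<close>. An internal substitute has the same size and owner; a cross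
  substitute has the same size, the same trace on the union \<open>T\<close> of the remaining internal sets and the
  same number of elements of each owner occurring in \<open>T\<close>. Exchanging the sets of
  a packing for substitutes one at a time changes neither coverage nor rejection. Trying all pairs of
  packings of the remaining sets takes \<open>poly(k) ^ O(k)\<close> time.

  The algorithm is written in a small first-order language of numbers, pairs and lists with bounded
  loops, compiled to the machine. Its running time is polynomial in any bound on the number of iterations
  of the individual loops.
\<close>

section \<open>Rejection as replacement of packings\<close>

text \<open>The obstacle is that a rejecting \<open>R\<close> mixes members of \<open>X\<close> with
  internal sets outside \<open>X\<close>. When a cross set \<open>S\<close> of \<open>X\<close> is
  exchanged for \<open>S'\<close>, the internal sets in such an \<open>R\<close> may avoid
  \<open>S'\<close> and yet meet \<open>S\<close>, so that exchanging back could fail. Thinning the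
  internal sets first confines those left to a set \<open>T\<close> of poly(\<open>k\<close>)
  elements; as \<open>S\<close> and \<open>S'\<close> have the same trace on \<open>T\<close>, the
  exchange back succeeds. An agent owning nothing in \<open>T\<close> has no internal set left and
  cannot gain, so the type of a cross set counts only owners that occur in \<open>T\<close>. This
  keeps the number of types independent of the number of agents. The bound \<open>d * q\<close> on
  \<open>Y\<close> is the number of elements in the rest of a packing, at most \<open>q\<close> sets
  of size at most \<open>d\<close>. A substitute exists by a counting in the style of sunflowers: a
  core \<open>A\<close> of \<open>S\<close> that misses \<open>z\<close> elements is full once
  \<open>(d * q + 1) ^ z\<close> kept sets contain it, so that enlarging the core by any of the at
  most \<open>d * q\<close> elements of \<open>Y\<close> accounts for too few of them.\<close>

definition cov :: "('a \<Rightarrow> nat) \<Rightarrow> nat \<Rightarrow> 'a set set \<Rightarrow> nat" where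
  "cov own i X = card {x \<in> \<Union>X. own x = i}"

text \<open>The collection \<open>R\<close> plays the role of \<open>(X - X_rej) \<union> X_int\<close>.\<close>

definition rejected_by :: "('a \<Rightarrow> nat) \<Rightarrow> 'a set set \<Rightarrow> 'a set set \<Rightarrow> nat \<Rightarrow> 'a set set \<Rightarrow> bool" where
  "rejected_by own F X i R \<longleftrightarrow> R \<subseteq> F \<and> disjoint R \<and> (\<forall>S\<in>R. S \<in> X \<or> own ` S \<subseteq> {i}) \<and>
     cov own i X < cov own i R"

definition unrejected :: "('a \<Rightarrow> nat) \<Rightarrow> 'a set set \<Rightarrow> 'a set set \<Rightarrow> bool" where
  "unrejected own F X \<longleftrightarrow> X \<subseteq> F \<and> disjoint X \<and> (\<forall>i R. \<not> rejected_by own F X i R)"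

definition solvable :: "('a \<Rightarrow> nat) \<Rightarrow> 'a set set \<Rightarrow> nat \<Rightarrow> bool" where
  "solvable own F k \<longleftrightarrow> (\<exists>X. unrejected own F X \<and> k \<le> card (\<Union>X))"

lemma rejects_iff_rejected_by:
  assumes "rp_d_sp_instance d I" "i \<in> {1..agents I}" "X \<subseteq> family I"
    and own: "\<And>x i. x \<in> universe I \<Longrightarrow> i \<in> {1..agents I} \<Longrightarrow> x \<in> part I i \<longleftrightarrow> own x = i"
  shows "rejects I i X \<longleftrightarrow> (\<exists>R. rejected_by own (family I) X i R)"
proof -
  have "family I \<subseteq> Pow (universe I)" using assms(1) unfolding rp_d_sp_instance_def by (elim conjE)
  then have U: "\<Union>(family I) \<subseteq> universe I" by blast
  have cov: "card (\<Union>A \<inter> part I i) = cov own i A" if "A \<subseteq> family I" for A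
    unfolding cov_def by (rule arg_cong[where f = card]) (use that U own[OF _ assms(2)] in blast)
  have int: "internal I i S \<longleftrightarrow> own ` S \<subseteq> {i}" if "S \<in> family I" for S
    unfolding internal_def using that U own[OF _ assms(2)] by blast
  show ?thesis
  proof
    assume "rejects I i X"
    then obtain Xr Xi where *: "Xr \<subseteq> X" "Xi \<subseteq> family I" "\<forall>S\<in>Xi. internal I i S"
      "disjoint ((X - Xr) \<union> Xi)" "card (\<Union>((X - Xr) \<union> Xi) \<inter> part I i) > card (\<Union>X \<inter> part I i)"
      unfolding rejects_def by blast
    have sub: "(X - Xr) \<union> Xi \<subseteq> family I" using * assms(3) by blast
    have "\<forall>S\<in>(X - Xr) \<union> Xi. S \<in> X \<or> own ` S \<subseteq> {i}" using *(2,3) int by blast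
    then have "rejected_by own (family I) X i ((X - Xr) \<union> Xi)"
      using sub *(4,5) unfolding rejected_by_def cov[OF sub] cov[OF assms(3)] by blast
    then show "\<exists>R. rejected_by own (family I) X i R" by blast
  next
    assume "\<exists>R. rejected_by own (family I) X i R"
    then obtain R where R: "R \<subseteq> family I" "disjoint R" "\<forall>S\<in>R. S \<in> X \<or> own ` S \<subseteq> {i}"
      "cov own i X < cov own i R" unfolding rejected_by_def by blast
    \<comment> \<open>The two parts are recovered from \<open>R\<close> alone: what \<open>R\<close>
      lacks was rejected and what it has in addition is new. Sets that \<open>R\<close> shares with
      \<open>X\<close> need not be internal.\<close>
    have eq: "(X - (X - R)) \<union> (R - X) = R" by blast
    have "\<forall>S\<in>R - X. internal I i S" using R(1,3) int by blast
    moreover have "card (\<Union>R \<inter> part I i) > card (\<Union>X \<inter> part I i)"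
      using R(4) unfolding cov[OF R(1)] cov[OF assms(3)] .
    moreover have "X - R \<subseteq> X" "R - X \<subseteq> family I" using R(1) by blast+
    ultimately show "rejects I i X" using R(2) unfolding rejects_def
      by (metis eq)
  qed
qed

lemma yes_instance_iff_solvable:
  assumes I: "rp_d_sp_instance d I"
    and own: "\<And>x i. x \<in> universe I \<Longrightarrow> i \<in> {1..agents I} \<Longrightarrow> x \<in> part I i \<longleftrightarrow> own x = i"
  shows "yes_instance I \<longleftrightarrow> solvable own (family I) (target I)"
proof -
  have sub: "family I \<subseteq> Pow (universe I)" using assms(1) unfolding rp_d_sp_instance_def by (elim conjE)
  \<comment> \<open>An index outside the range of agents owns no element and can never gain, so
    \<open>unrejected\<close> may quantify over all natural numbers.\<close>
  have no: "\<not> rejected_by own (family I) X i R" if "i \<notin> {1..agents I}" for X i R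
  proof
    assume "rejected_by own (family I) X i R"
    then have R: "R \<subseteq> family I" "cov own i R > 0" by (auto simp: rejected_by_def)
    have "{x \<in> \<Union>R. own x = i} = {}"
    proof (rule ccontr)
      assume "{x \<in> \<Union>R. own x = i} \<noteq> {}"
      then obtain x where x: "x \<in> universe I" "own x = i" using R(1) sub by blast
      moreover obtain j where "j \<in> {1..agents I}" "x \<in> part I j"
        using x(1) I by (auto simp: rp_d_sp_instance_def)
      ultimately show False using own[of x j] that by auto
    qed
    then show False using R(2) unfolding cov_def by (simp only: card.empty)
  qed
  have "packing I X \<and> rejection_proof I X \<longleftrightarrow> unrejected own (family I) X" for X
    unfolding packing_def rejection_proof_def unrejected_def
    using rejects_iff_rejected_by[OF I _ _ own] no by blast
  then show ?thesis unfolding yes_instance_def solvable_def by blast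
qed

section \<open>Invariance under renaming elements and removing the empty set\<close>

lemma solvable_image:
  assumes inj: "inj_on g (\<Union>F)" and own: "\<And>x. x \<in> \<Union>F \<Longrightarrow> own' (g x) = own x"
    and "solvable own F k"
  shows "solvable own' ((`) g ` F) k"
proof -
  have inj': "inj_on ((`) g) F"
    by (rule inj_on_subset[OF inj_on_image_Pow[OF inj]]) auto
  have cov: "cov own' i ((`) g ` A) = cov own i A" if "A \<subseteq> F" for A i
  proof -
    have "{x \<in> \<Union>((`) g ` A). own' x = i} = g ` {x \<in> \<Union>A. own x = i}"
    proof (intro subset_antisym subsetI)
      fix y assume "y \<in> {x \<in> \<Union>((`) g ` A). own' x = i}"
      then obtain S x where "S \<in> A" "x \<in> S" "y = g x" "own' (g x) = i" by blast
      moreover from this have "own' (g x) = own x" using own that by blast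
      ultimately show "y \<in> g ` {x \<in> \<Union>A. own x = i}" by auto
    next
      fix y assume "y \<in> g ` {x \<in> \<Union>A. own x = i}"
      then obtain S x where "S \<in> A" "x \<in> S" "y = g x" "own x = i" by blast
      moreover from this have "own' (g x) = own x" using own that by blast
      ultimately show "y \<in> {x \<in> \<Union>((`) g ` A). own' x = i}" by auto
    qed
    moreover have "inj_on g {x \<in> \<Union>A. own x = i}" by (rule inj_on_subset[OF inj]) (use that in auto)
    ultimately show ?thesis unfolding cov_def by (simp add: card_image)
  qed
  have disj: "disjoint ((`) g ` A) \<longleftrightarrow> disjoint A" if "A \<subseteq> F" for A
  proof -
    have int: "g ` S \<inter> g ` T = g ` (S \<inter> T)" if "S \<in> A" "T \<in> A" for S T
      using inj_on_image_Int[OF inj, of S T] that \<open>A \<subseteq> F\<close> by blast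
    have eq: "g ` S = g ` T \<longleftrightarrow> S = T" if "S \<in> A" "T \<in> A" for S T
      by (rule inj_on_eq_iff[OF inj']) (use that \<open>A \<subseteq> F\<close> in blast)+
    have "(g ` S \<noteq> g ` T \<longrightarrow> g ` S \<inter> g ` T = {}) \<longleftrightarrow> (S \<noteq> T \<longrightarrow> S \<inter> T = {})"
      if "S \<in> A" "T \<in> A" for S T
      using int[OF that] eq[OF that] by simp
    then show ?thesis unfolding disjoint_def ball_simps by (simp cong: ball_cong)
  qed
  from assms(3) obtain X where X: "X \<subseteq> F" "disjoint X" "\<And>i R. \<not> rejected_by own F X i R" "k \<le> card (\<Union>X)"
    unfolding solvable_def unrejected_def by blast
  have "\<not> rejected_by own' ((`) g ` F) ((`) g ` X) i R" for i R
  proof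
    assume "rejected_by own' ((`) g ` F) ((`) g ` X) i R"
    then have R: "R \<subseteq> (`) g ` F" "disjoint R" "\<forall>S\<in>R. S \<in> (`) g ` X \<or> own' ` S \<subseteq> {i}"
      "cov own' i ((`) g ` X) < cov own' i R" by (auto simp: rejected_by_def)
    from R(1) obtain A where A: "A \<subseteq> F" "R = (`) g ` A" by (meson subset_imageE)
    have "S \<in> X \<or> own ` S \<subseteq> {i}" if "S \<in> A" for S
    proof -
      have "g ` S \<in> (`) g ` X \<or> own' ` g ` S \<subseteq> {i}" using R(3) A(2) that by blast
      moreover have "S \<in> X" if "g ` S \<in> (`) g ` X"
        using inj_on_image_mem_iff[OF inj', of S X] that X(1) A(1) \<open>S \<in> A\<close> by blast
      moreover have "own ` S \<subseteq> {i}" if "own' ` g ` S \<subseteq> {i}"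
      proof
        fix y assume "y \<in> own ` S"
        then obtain x where "x \<in> S" "y = own x" by blast
        moreover from this have "own' (g x) = own x" using own A(1) \<open>S \<in> A\<close> by blast
        moreover have "own' (g x) \<in> {i}" using that \<open>x \<in> S\<close> by blast
        ultimately show "y \<in> {i}" by simp
      qed
      ultimately show ?thesis by blast
    qed
    then have "rejected_by own F X i A"
      using R A X(1) disj[OF A(1)] cov[OF A(1)] cov[OF X(1)] by (simp add: rejected_by_def)
    then show False using X(3) by blast
  qed
  moreover have "card (\<Union>((`) g ` X)) = card (\<Union>X)"
  proof -
    have "\<Union>((`) g ` X) = g ` \<Union>X" by blast
    then show ?thesis using inj_on_subset[OF inj, of "\<Union>X"] X(1) by (simp add: card_image Union_mono)
  qed
  ultimately have "unrejected own' ((`) g ` F) ((`) g ` X) \<and> k \<le> card (\<Union>((`) g ` X))"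
    using X disj[OF X(1)] by (auto simp: unrejected_def)
  then show ?thesis unfolding solvable_def by blast
qed

text \<open>Used to pass between the universe and the pairs of position and owner that the program
  handles, where the owner map is simply \<open>snd\<close>. The converse is the forward direction
  for the inverse of \<open>g\<close>.\<close>

lemma solvable_image_iff:
  assumes inj: "inj_on g (\<Union>F)" and own: "\<And>x. x \<in> \<Union>F \<Longrightarrow> own' (g x) = own x"
  shows "solvable own' ((`) g ` F) k \<longleftrightarrow> solvable own F k"
proof
  assume "solvable own' ((`) g ` F) k"
  let ?h = "inv_into (\<Union>F) g"
  have U: "\<Union>((`) g ` F) = g ` \<Union>F" by blast
  have "?h ` g ` S = S" if "S \<in> F" for S
    by (rule inv_into_image_cancel[OF inj]) (use that in blast)
  then have "(`) ?h ` ((`) g ` F) = F" by (force simp: image_image)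
  moreover have "solvable own ((`) ?h ` ((`) g ` F)) k"
  proof (rule solvable_image[OF _ _ \<open>solvable own' _ k\<close>])
    show "inj_on ?h (\<Union>((`) g ` F))" unfolding U by (rule inj_on_inv_into) simp
    show "own (?h x) = own' x" if "x \<in> \<Union>((`) g ` F)" for x
    proof -
      from that obtain y where y: "y \<in> \<Union>F" "x = g y" unfolding U by blast
      then show ?thesis using inv_into_f_f[OF inj y(1)] own[OF y(1)] by simp
    qed
  qed
  ultimately show "solvable own F k" by simp
next
  assume "solvable own F k"
  then show "solvable own' ((`) g ` F) k" by (rule solvable_image[where own = own, OF inj, rotated]) (rule own)
qed

lemma Union_Diff_empty [simp]: "\<Union>(X - {{}}) = \<Union>X"
  by blast

lemma cov_Diff_empty [simp]: "cov own i (X - {{}}) = cov own i X"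
  by (simp add: cov_def del: Union_iff)

text \<open>The empty set is compatible with every packing and covers nothing. It has to be removed
  because packings are counted below through a fixed set that each member must meet.\<close>

lemma solvable_nonempty: "solvable own F k \<longleftrightarrow> solvable own (F - {{}}) k"
proof
  assume "solvable own F k"
  then obtain X where X: "X \<subseteq> F" "disjoint X" "\<And>i R. \<not> rejected_by own F X i R" "k \<le> card (\<Union>X)"
    unfolding solvable_def unrejected_def by blast
  have "\<not> rejected_by own (F - {{}}) (X - {{}}) i R" for i R
    using X(3)[of i R] unfolding rejected_by_def by auto
  moreover have "disjoint (X - {{}})" using X(2) by (auto simp: disjoint_def)
  ultimately have "unrejected own (F - {{}}) (X - {{}})" using X(1) by (auto simp: unrejected_def)
  then show "solvable own (F - {{}}) k" unfolding solvable_def using X(4) by (intro exI[of _ "X - {{}}"]) simp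
next
  assume "solvable own (F - {{}}) k"
  then obtain X where X: "X \<subseteq> F - {{}}" "disjoint X" "\<And>i R. \<not> rejected_by own (F - {{}}) X i R" "k \<le> card (\<Union>X)"
    unfolding solvable_def unrejected_def by blast
  have "\<not> rejected_by own F X i R" for i R
  proof
    assume R: "rejected_by own F X i R"
    then have "disjoint (R - {{}})" by (auto simp: rejected_by_def disjoint_def)
    then have "rejected_by own (F - {{}}) X i (R - {{}})"
      using R by (auto simp: rejected_by_def)
    then show False using X(3) by blast
  qed
  then have "unrejected own F X" using X by (auto simp: unrejected_def)
  then show "solvable own F k" unfolding solvable_def using X(4) by blast
qed

section \<open>Large packings make an instance solvable\<close>

lemma card_Union_disjoint_le:
  assumes "finite X" "\<And>S. S \<in> X \<Longrightarrow> card S \<le> d"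
  shows "card (\<Union>X) \<le> d * card X"
proof -
  have "card (\<Union>X) \<le> (\<Sum>S\<in>X. card S)" by (rule card_Union_le_sum_card)
  also have "\<dots> \<le> (\<Sum>S\<in>X. d)" by (rule sum_mono) (rule assms(2))
  finally show ?thesis by (simp add: mult.commute)
qed

text \<open>Pairwise disjoint sets that all meet \<open>W\<close> can be mapped injectively into \<open>W\<close>.\<close>

lemma card_disjoint_hitting:
  assumes "disjoint X" "\<And>S. S \<in> X \<Longrightarrow> S \<inter> W \<noteq> {}" "finite W"
  shows "finite X \<and> card X \<le> card W"
proof -
  define f where "f S = (SOME x. x \<in> S \<inter> W)" for S
  have f: "f S \<in> S \<inter> W" if "S \<in> X" for S
    unfolding f_def using assms(2)[OF that] some_in_eq by blast
  have "inj_on f X"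
  proof (rule inj_onI)
    fix S T assume "S \<in> X" "T \<in> X" "f S = f T"
    then show "S = T" using f[of S] f[of T] assms(1) by (auto simp: disjoint_def)
  qed
  moreover have "f ` X \<subseteq> W" using f by blast
  ultimately show ?thesis using card_inj_on_le[of f X W] finite_imageD[of f X] assms(3) finite_subset by blast
qed

lemma cov_disjoint_union:
  assumes "finite (\<Union>(A \<union> B))" "\<Union>A \<inter> \<Union>B = {}"
  shows "cov own i (A \<union> B) = cov own i A + cov own i B"
proof -
  have "{x \<in> \<Union>(A \<union> B). own x = i} = {x \<in> \<Union>A. own x = i} \<union> {x \<in> \<Union>B. own x = i}" by blast
  moreover have "card \<dots> = card {x \<in> \<Union>A. own x = i} + card {x \<in> \<Union>B. own x = i}"
    by (rule card_Un_disjoint) (use assms in \<open>auto simp del: Union_iff intro: finite_subset[of _ "\<Union>(A \<union> B)"]\<close>)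
  ultimately show ?thesis by (simp add: cov_def)
qed

lemma cov_mono: "finite (\<Union>B) \<Longrightarrow> A \<subseteq> B \<Longrightarrow> cov own i A \<le> cov own i B"
  unfolding cov_def by (rule card_mono) (auto simp del: Union_iff)

lemma cov_internal: "(\<And>S. S \<in> A \<Longrightarrow> own ` S \<subseteq> {i}) \<Longrightarrow> cov own i A = card (\<Union>A)"
  unfolding cov_def by (rule arg_cong[where f = card]) blast

lemma disjoint_Union_Int:
  assumes "disjoint X" "A \<subseteq> X" "B \<subseteq> X" "A \<inter> B = {}"
  shows "\<Union>A \<inter> \<Union>B = {}"
proof (rule ccontr)
  assume "\<Union>A \<inter> \<Union>B \<noteq> {}"
  then obtain S T where "S \<in> A" "T \<in> B" "S \<inter> T \<noteq> {}" by blast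
  moreover from this have "S \<noteq> T" using assms(4) by blast
  ultimately show False using assms unfolding disjoint_def by blast
qed

text \<open>Every agent holds an optimal internal packing in \<open>M\<close>, so cross sets disjoint from \<open>M\<close> can be
  added without causing a rejection.\<close>

lemma unrejected_if_max_internal:
  assumes fin: "finite (\<Union>F)" "finite F" and ne: "{} \<notin> F"
    and M: "M \<subseteq> F" "disjoint M" "\<And>S. S \<in> M \<Longrightarrow> \<exists>j. own ` S \<subseteq> {j}"
    and max: "\<And>M'. M' \<subseteq> F \<Longrightarrow> disjoint M' \<Longrightarrow> (\<And>S. S \<in> M' \<Longrightarrow> \<exists>j. own ` S \<subseteq> {j}) \<Longrightarrow>
      card (\<Union>M') \<le> card (\<Union>M)"
    and X: "X \<subseteq> F" "disjoint X" "M \<subseteq> X"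
  shows "unrejected own F X"
proof -
  have finU: "finite (\<Union>A)" if "A \<subseteq> F" for A using fin(1) that by (meson Union_mono finite_subset)
  have "\<not> rejected_by own F X i R" for i R
  proof
    assume "rejected_by own F X i R"
    then have R: "R \<subseteq> F" "disjoint R" "\<And>S. S \<in> R \<Longrightarrow> S \<in> X \<or> own ` S \<subseteq> {i}"
      "cov own i X < cov own i R" by (auto simp: rejected_by_def)
    let ?i = "\<lambda>A. {S \<in> A. own ` S \<subseteq> {i}}"
    have split: "cov own i A = card (\<Union>(?i A)) + cov own i (A - ?i A)" if "A \<subseteq> F" "disjoint A" for A
    proof -
      have "cov own i (?i A \<union> (A - ?i A)) = cov own i (?i A) + cov own i (A - ?i A)"
      proof (rule cov_disjoint_union)
        show "finite (\<Union>(?i A \<union> (A - ?i A)))" by (rule finU) (use that(1) in blast)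
        show "\<Union>(?i A) \<inter> \<Union>(A - ?i A) = {}" by (rule disjoint_Union_Int[OF that(2)]) auto
      qed
      moreover have "?i A \<union> (A - ?i A) = A" by blast
      ultimately show ?thesis using cov_internal[of "?i A" own i] by auto
    qed
    \<comment> \<open>Exchange argument: giving agent \<open>i\<close> the internal sets of
      \<open>R\<close> in place of those of \<open>M\<close> yields another packing of internal
      sets, so by maximality the internal part of \<open>R\<close> covers no more than that of
      \<open>M\<close>.\<close>
    let ?M' = "(M - ?i M) \<union> ?i R"
    have sep: "\<Union>(M - ?i M) \<inter> \<Union>(?i B) = {}" for B
    proof (rule ccontr)
      assume "\<Union>(M - ?i M) \<inter> \<Union>(?i B) \<noteq> {}"
      then obtain S x where "S \<in> M" "\<not> own ` S \<subseteq> {i}" "x \<in> S" "own x = i" by blast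
      then show False using M(3)[of S] by blast
    qed
    have dM: "disjoint (M - ?i M)" by (rule pairwise_subset[OF M(2)]) blast
    have dR: "disjoint (?i R)" by (rule pairwise_subset[OF R(2)]) blast
    have "disjoint ?M'" by (rule disjoint_union[OF dM dR sep])
    moreover have "?M' \<subseteq> F" using M(1) R(1) by blast
    moreover have "\<exists>j. own ` S \<subseteq> {j}" if "S \<in> ?M'" for S using that M(3)[of S] by blast
    ultimately have le: "card (\<Union>?M') \<le> card (\<Union>M)" using max[of ?M'] by blast
    have fM: "finite (\<Union>(M - ?i M))" "finite (\<Union>(?i M))" "finite (\<Union>(?i R))"
      by (rule finU, use M(1) R(1) in blast)+
    have "\<Union>M = \<Union>(M - ?i M) \<union> \<Union>(?i M)" by blast
    then have "card (\<Union>M) = card (\<Union>(M - ?i M)) + card (\<Union>(?i M))"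
      using card_Un_disjoint[OF fM(1,2) sep] by simp
    moreover have "card (\<Union>?M') = card (\<Union>(M - ?i M)) + card (\<Union>(?i R))"
      using card_Un_disjoint[OF fM(1,3) sep] by (simp add: Union_Un_distrib)
    ultimately have "card (\<Union>(?i R)) \<le> card (\<Union>(?i M))" using le by simp
    also have "\<dots> \<le> card (\<Union>(?i X))" by (rule card_mono, rule finU) (use X(1,3) in blast)+
    finally have 1: "card (\<Union>(?i R)) \<le> card (\<Union>(?i X))" .
    \<comment> \<open>Members of \<open>R\<close> that are not \<open>i\<close>-internal come from
      \<open>X\<close>, so this part cannot gain either.\<close>
    have "R - ?i R \<subseteq> X - ?i X" using R(3) by blast
    then have "cov own i (R - ?i R) \<le> cov own i (X - ?i X)"
      by (rule cov_mono[rotated]) (rule finU, use X(1) in blast)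
    then have "cov own i R \<le> cov own i X" using split[OF R(1,2)] split[OF X(1,2)] 1 by simp
    then show False using R(4) by simp
  qed
  then show ?thesis using X by (auto simp: unrejected_def)
qed

lemma solvable_if_large_packing:
  assumes fin: "finite (\<Union>F)" "finite F" and ne: "{} \<notin> F" and d: "\<And>S. S \<in> F \<Longrightarrow> card S \<le> d"
    and Y: "Y \<subseteq> F" "disjoint Y" "(d + 1) * k \<le> card (\<Union>Y)"
  shows "solvable own F k"
proof -
  define Q where "Q M \<longleftrightarrow> M \<subseteq> F \<and> disjoint M \<and> (\<forall>S\<in>M. \<exists>j. own ` S \<subseteq> {j})" for M
  have finU: "finite (\<Union>A)" if "A \<subseteq> F" for A using fin(1) that by (meson Union_mono finite_subset)
  have "Q {}" by (simp add: Q_def)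
  moreover have "\<forall>M. Q M \<longrightarrow> card (\<Union>M) < card (\<Union>F) + 1"
    using fin(1) unfolding Q_def by (simp add: Union_mono card_mono less_Suc_eq_le)
  ultimately have "\<exists>M. Q M \<and> (\<forall>M'. Q M' \<longrightarrow> card (\<Union>M') \<le> card (\<Union>M))"
    by (rule ex_has_greatest_nat)
  then obtain M where QM: "Q M" and max: "\<And>M'. Q M' \<Longrightarrow> card (\<Union>M') \<le> card (\<Union>M)" by blast
  have M: "M \<subseteq> F" "disjoint M" "\<And>S. S \<in> M \<Longrightarrow> \<exists>j. own ` S \<subseteq> {j}" using QM unfolding Q_def by blast+
  define Z where "Z = {S \<in> Y. S \<inter> \<Union>M = {}}"
  have MZ: "M \<union> Z \<subseteq> F" using M(1) Y(1) by (auto simp: Z_def)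
  have "disjoint Z" by (rule pairwise_subset[OF Y(2)]) (auto simp: Z_def)
  moreover have "\<Union>M \<inter> \<Union>Z = {}" unfolding Z_def by blast
  ultimately have dMZ: "disjoint (M \<union> Z)" using disjoint_union[OF M(2)] by blast
  have st: "unrejected own F (M \<union> Z)"
  proof (rule unrejected_if_max_internal[OF fin ne M _ MZ dMZ])
    show "card (\<Union>M') \<le> card (\<Union>M)" if "M' \<subseteq> F" "disjoint M'" "\<And>S. S \<in> M' \<Longrightarrow> \<exists>j. own ` S \<subseteq> {j}" for M'
      by (rule max) (use that in \<open>simp add: Q_def\<close>)
    show "M \<subseteq> M \<union> Z" by simp
  qed
  have "k \<le> card (\<Union>(M \<union> Z))"
  proof (cases "k \<le> card (\<Union>M)")
    case True
    also have "card (\<Union>M) \<le> card (\<Union>(M \<union> Z))"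
      by (rule card_mono, rule finU[OF MZ]) blast
    finally show ?thesis .
  next
    case False
    have "disjoint (Y - Z)" by (rule pairwise_subset[OF Y(2)]) blast
    \<comment> \<open>Disjoint sets meeting \<open>\<Union>M\<close> inject into it, so fewer than
      \<open>k\<close> sets of \<open>Y\<close> are lost, each with at most \<open>d\<close>
      elements. Hence the factor \<open>d + 1\<close>: of \<open>(d + 1) * k\<close> covered
      elements at least \<open>k\<close> remain.\<close>
    then have *: "finite (Y - Z) \<and> card (Y - Z) \<le> card (\<Union>M)"
    proof (rule card_disjoint_hitting)
      show "finite (\<Union>M)" by (rule finU) (use M(1) in blast)
    qed (use Z_def in blast)
    then have "card (\<Union>(Y - Z)) \<le> d * card (Y - Z)"
      using Y(1) d by (intro card_Union_disjoint_le) blast+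
    also have "\<dots> \<le> d * k" using * False by simp
    finally have "card (\<Union>(Y - Z)) \<le> d * k" .
    moreover have "\<Union>Y = \<Union>(Y - Z) \<union> \<Union>Z" by (auto simp: Z_def)
    then have "card (\<Union>Y) \<le> card (\<Union>(Y - Z)) + card (\<Union>Z)" by (metis card_Un_le)
    ultimately have "k \<le> card (\<Union>Z)" using Y(3) by simp
    also have "\<dots> \<le> card (\<Union>(M \<union> Z))"
      by (rule card_mono, rule finU[OF MZ]) blast
    finally show ?thesis .
  qed
  with st show ?thesis unfolding solvable_def by blast
qed

section \<open>Exchanging sets of a packing\<close>

lemma rejected_by_mono: "rejected_by own G X i R \<Longrightarrow> G \<subseteq> F \<Longrightarrow> rejected_by own F X i R"
  by (auto simp: rejected_by_def)

lemma unrejected_subset: "unrejected own F X \<Longrightarrow> X \<subseteq> G \<Longrightarrow> G \<subseteq> F \<Longrightarrow> unrejected own G X"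
  unfolding unrejected_def using rejected_by_mono by metis

lemma disjoint_swap:
  assumes "disjoint X" "S' \<inter> \<Union>(X - {S}) = {}"
  shows "disjoint (insert S' (X - {S}))"
proof -
  have "disjoint (X - {S})" by (rule pairwise_subset[OF assms(1)]) blast
  moreover have "disjoint {S'}" by (simp add: disjoint_def)
  ultimately have "disjoint ({S'} \<union> (X - {S}))" using assms(2) by (intro disjoint_union) auto
  then show ?thesis by simp
qed

lemma card_Union_swap:
  assumes "disjoint X" "S \<in> X" "finite (\<Union>X)" "finite S'" "S' \<inter> \<Union>(X - {S}) = {}" "card S = card S'"
  shows "card (\<Union>(insert S' (X - {S}))) = card (\<Union>X)"
proof -
  have f: "finite S" "finite (\<Union>(X - {S}))"
    using assms(2,3) by (auto intro: finite_subset[OF _ assms(3)])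
  have "S \<inter> \<Union>(X - {S}) = {}" using disjoint_Union_Int[OF assms(1), of "{S}" "X - {S}"] assms(2) by auto
  then have "card (S \<union> \<Union>(X - {S})) = card (S' \<union> \<Union>(X - {S}))"
    using card_Un_disjoint[OF f] card_Un_disjoint[OF assms(4) f(2) assms(5)] assms(6) by simp
  moreover have "\<Union>X = S \<union> \<Union>(X - {S})" using assms(2) by blast
  ultimately show ?thesis by simp
qed

lemma cov_swap:
  assumes "disjoint X" "S \<in> X" "finite (\<Union>X)" "finite S'" "S' \<inter> \<Union>(X - {S}) = {}"
    and "card {x \<in> S. own x = i} = card {x \<in> S'. own x = i}"
  shows "cov own i (insert S' (X - {S})) = cov own i X"
proof -
  have f: "finite S" "finite (\<Union>(X - {S}))"
    using assms(2,3) by (auto intro: finite_subset[OF _ assms(3)])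
  have "S \<inter> \<Union>(X - {S}) = {}" using disjoint_Union_Int[OF assms(1), of "{S}" "X - {S}"] assms(2) by auto
  then have "cov own i ({S} \<union> (X - {S})) = cov own i {S} + cov own i (X - {S})"
    by (intro cov_disjoint_union) (use f assms(2,3) in \<open>simp_all add: insert_absorb\<close>)
  moreover have "cov own i ({S'} \<union> (X - {S})) = cov own i {S'} + cov own i (X - {S})"
    by (intro cov_disjoint_union) (use f assms(4,5) in simp_all)
  moreover have "{S} \<union> (X - {S}) = X" using assms(2) by blast
  ultimately show ?thesis using assms(6) by (simp add: cov_def[of own i "{S}"] cov_def[of own i "{S'}"])
qed

text \<open>Both directions exchange one set at a time, by induction on the number of sets outside
  the thinned family: in \<open>X\<close> for the first direction, in a rejecting \<open>R\<close>
  for the second. The set \<open>Y\<close> of \<open>rep\<close> is the union of the other members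
  of the packing at hand, which \<open>bound\<close> keeps small.\<close>

lemma solvable_replace_internal:
  assumes fin: "finite (\<Union>(F1 \<union> F2))" "finite (F1 \<union> F2)" and K1: "K1 \<subseteq> F1"
    and int: "\<And>S. S \<in> F1 \<Longrightarrow> \<exists>j. own ` S \<subseteq> {j}"
    and bound: "\<And>X. X \<subseteq> F1 \<union> F2 \<Longrightarrow> disjoint X \<Longrightarrow> card (\<Union>X) \<le> l"
    and rep: "\<And>S Y. S \<in> F1 \<Longrightarrow> finite Y \<Longrightarrow> card Y \<le> l \<Longrightarrow> S \<inter> Y = {} \<Longrightarrow>
      \<exists>S'\<in>K1. S' \<inter> Y = {} \<and> card S' = card S \<and> (\<forall>j. own ` S \<subseteq> {j} \<longrightarrow> own ` S' \<subseteq> {j})"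
  shows "solvable own (F1 \<union> F2) k \<longleftrightarrow> solvable own (K1 \<union> F2) k"
proof -
  let ?F = "F1 \<union> F2" and ?G = "K1 \<union> F2"
  have finU: "finite (\<Union>A)" if "A \<subseteq> ?F" for A using fin(1) that by (meson Union_mono finite_subset)
  have finS: "finite S" if "S \<in> ?F" for S using finU[of "{S}"] that by simp
  have finA: "finite A" if "A \<subseteq> ?F" for A using fin(2) that by (rule finite_subset[rotated])
  have ex: "\<exists>S'\<in>K1. S' \<inter> \<Union>(X - {S}) = {} \<and> card S' = card S \<and> (\<forall>j. own ` S \<subseteq> {j} \<longrightarrow> own ` S' \<subseteq> {j})"
    if "S \<in> X" "S \<in> F1" "X \<subseteq> ?F" "disjoint X" for S X
  proof (rule rep[OF that(2)])
    have sub: "X - {S} \<subseteq> ?F" using that(3) by blast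
    show "finite (\<Union>(X - {S}))" by (rule finU[OF sub])
    show "card (\<Union>(X - {S})) \<le> l" by (rule bound[OF sub]) (rule pairwise_subset[OF that(4)], blast)
    show "S \<inter> \<Union>(X - {S}) = {}" using disjoint_Union_Int[OF that(4), of "{S}" "X - {S}"] that(1) by auto
  qed
  have smaller: "card (insert S' (X - {S}) - ?G) < card (X - ?G)"
    if "S \<in> X" "S \<notin> ?G" "X \<subseteq> ?F" "S' \<in> ?G" for S S' X
  proof (rule psubset_card_mono)
    show "finite (X - ?G)" using finA[OF that(3)] by simp
    have "insert S' (X - {S}) - ?G \<subseteq> X - ?G" using that(4) by auto
    moreover have "S \<in> X - ?G" "S \<notin> insert S' (X - {S}) - ?G" using that by auto
    ultimately show "insert S' (X - {S}) - ?G \<subset> X - ?G" by (metis psubsetI)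
  qed
  show ?thesis
  proof
    assume "solvable own ?F k"
    then obtain X where "unrejected own ?F X" "k \<le> card (\<Union>X)" unfolding solvable_def by blast
    then have "\<exists>X. unrejected own ?F X \<and> k \<le> card (\<Union>X) \<and> X \<subseteq> ?G"
    proof (induction "card (X - ?G)" arbitrary: X rule: less_induct)
      case less
      show ?case
      proof (cases "X \<subseteq> ?G")
        case True
        then show ?thesis using less.prems by blast
      next
        case False
        have X: "X \<subseteq> ?F" "disjoint X" "\<And>i R. \<not> rejected_by own ?F X i R"
          using less.prems(1) by (simp_all add: unrejected_def)
        from False obtain S where S: "S \<in> X" "S \<notin> ?G" by blast
        then have SF: "S \<in> F1" using X(1) by blast
        from ex[OF S(1) SF X(1,2)] obtain S' where S': "S' \<in> K1" "S' \<inter> \<Union>(X - {S}) = {}"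
          "card S' = card S" "\<forall>j. own ` S \<subseteq> {j} \<longrightarrow> own ` S' \<subseteq> {j}" by blast
        obtain j where j: "own ` S \<subseteq> {j}" using int[OF SF] by blast
        then have j': "own ` S' \<subseteq> {j}" using S'(4) by blast
        let ?X = "insert S' (X - {S})"
        have S'F: "S' \<in> ?F" using S'(1) K1 by blast
        have c: "card {x \<in> S. own x = i} = card {x \<in> S'. own x = i}" for i
        proof (cases "i = j")
          case True
          then have "{x \<in> S. own x = i} = S" "{x \<in> S'. own x = i} = S'" using j j' by blast+
          then show ?thesis using S'(3) by simp
        next
          case False
          then have "{x \<in> S. own x = i} = {}" "{x \<in> S'. own x = i} = {}" using j j' by blast+
          then show ?thesis by (simp only:)
        qed
        have cov: "cov own i ?X = cov own i X" for i
          by (rule cov_swap[OF X(2) S(1) finU[OF X(1)] finS[OF S'F] S'(2) c])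
        have "\<not> rejected_by own ?F ?X i R" for i R
        proof
          assume "rejected_by own ?F ?X i R"
          then have R: "R \<subseteq> ?F" "disjoint R" "\<And>A. A \<in> R \<Longrightarrow> A \<in> ?X \<or> own ` A \<subseteq> {i}"
            "cov own i X < cov own i R" using cov by (simp_all add: rejected_by_def)
          show False
          proof (cases "own ` S' \<subseteq> {i}")
            case True
            \<comment> \<open>An \<open>i\<close>-internal \<open>S'\<close> is allowed in
              \<open>R\<close> whether or not it belongs to the packing, so \<open>R\<close> already
              rejects \<open>X\<close>.\<close>
            then have "\<forall>A\<in>R. A \<in> X \<or> own ` A \<subseteq> {i}" using R(3) by blast
            then have "rejected_by own ?F X i R" using R(1,2,4) by (simp add: rejected_by_def)
            then show False using X(3) by blast
          next
            case False
            then have "i \<noteq> j" using j' by blast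
            \<comment> \<open>\<open>S'\<close> belongs to a different agent and covers nothing of
              agent \<open>i\<close>, so dropping it from \<open>R\<close> costs nothing.\<close>
            then have "{x \<in> \<Union>(R - {S'}). own x = i} = {x \<in> \<Union>R. own x = i}" using j' by blast
            then have "cov own i (R - {S'}) = cov own i R" unfolding cov_def by (simp only:)
            moreover have "\<forall>A\<in>R - {S'}. A \<in> X \<or> own ` A \<subseteq> {i}" using R(3) by blast
            moreover have "disjoint (R - {S'})" by (rule pairwise_subset[OF R(2)]) blast
            moreover have "R - {S'} \<subseteq> ?F" using R(1) by blast
            ultimately have "rejected_by own ?F X i (R - {S'})"
              using R(4) unfolding rejected_by_def by simp
            then show False using X(3) by blast
          qed
        qed
        moreover have "?X \<subseteq> ?F" using X(1) S'F by blast
        ultimately have "unrejected own ?F ?X" using disjoint_swap[OF X(2) S'(2)] by (simp add: unrejected_def)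
        moreover have "k \<le> card (\<Union>?X)"
          using card_Union_swap[OF X(2) S(1) finU[OF X(1)] finS[OF S'F] S'(2) S'(3)[symmetric]] less.prems(2)
          by simp
        moreover have "S' \<in> ?G" using S'(1) by blast
        ultimately show ?thesis by (intro less.hyps[OF smaller[OF S X(1)]])
      qed
    qed
    then obtain X where X: "unrejected own ?F X" "k \<le> card (\<Union>X)" "X \<subseteq> ?G" by blast
    have "?G \<subseteq> ?F" using K1 by blast
    from unrejected_subset[OF X(1,3) this] have "unrejected own ?G X" .
    then show "solvable own ?G k" using X(2) unfolding solvable_def by blast
  next
    assume "solvable own ?G k"
    then obtain X where X: "X \<subseteq> ?G" "disjoint X" "\<And>i R. \<not> rejected_by own ?G X i R" "k \<le> card (\<Union>X)"
      unfolding solvable_def unrejected_def by blast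
    have "\<not> rejected_by own ?F X i R" for i R
    proof (induction "card (R - ?G)" arbitrary: R rule: less_induct)
      case less
      show ?case
      proof
        assume "rejected_by own ?F X i R"
        then have R: "R \<subseteq> ?F" "disjoint R" "\<And>A. A \<in> R \<Longrightarrow> A \<in> X \<or> own ` A \<subseteq> {i}"
          "cov own i X < cov own i R" by (simp_all add: rejected_by_def)
        show False
        proof (cases "R \<subseteq> ?G")
          case True
          then have "rejected_by own ?G X i R" using R by (simp add: rejected_by_def)
          then show False using X(3) by blast
        next
          case False
          then obtain S where S: "S \<in> R" "S \<notin> ?G" by blast
          then have SF: "S \<in> F1" using R(1) by blast
          \<comment> \<open>\<open>S\<close> lies outside the thinned family, which contains
            \<open>X\<close>; hence \<open>R\<close> uses \<open>S\<close> as a new set, and its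
            substitute is \<open>i\<close>-internal as well.\<close>
          have j: "own ` S \<subseteq> {i}" using R(3)[OF S(1)] S(2) X(1) by blast
          from ex[OF S(1) SF R(1,2)] obtain S' where S': "S' \<in> K1" "S' \<inter> \<Union>(R - {S}) = {}"
            "card S' = card S" and all: "\<forall>j. own ` S \<subseteq> {j} \<longrightarrow> own ` S' \<subseteq> {j}" by (elim bexE conjE)
          from all[rule_format, OF j] have int': "own ` S' \<subseteq> {i}" .
          have S'F: "S' \<in> ?F" using S'(1) K1 by blast
          have "{x \<in> S. own x = i} = S" "{x \<in> S'. own x = i} = S'" using j int' by blast+
          then have c: "card {x \<in> S. own x = i} = card {x \<in> S'. own x = i}" using S'(3) by simp
          let ?R = "insert S' (R - {S})"
          have "cov own i ?R = cov own i R"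
            by (rule cov_swap[OF R(2) S(1) finU[OF R(1)] finS[OF S'F] S'(2) c])
          moreover have "\<forall>A\<in>?R. A \<in> X \<or> own ` A \<subseteq> {i}" using R(3) int' by blast
          moreover have "?R \<subseteq> ?F" using R(1) S'F by blast
          ultimately have "rejected_by own ?F X i ?R"
            using R(4) disjoint_swap[OF R(2) S'(2)] by (simp add: rejected_by_def)
          moreover have "S' \<in> ?G" using S'(1) by blast
          ultimately show False using less[OF smaller[OF S R(1), of S']] by simp
        qed
      qed
    qed
    moreover have "X \<subseteq> ?F" using X(1) K1 by blast
    ultimately have "unrejected own ?F X" using X(2) unfolding unrejected_def by blast
    then show "solvable own ?F k" using X(4) unfolding solvable_def by blast
  qed
qed

text \<open>Only the packing itself needs exchanges here. In the converse direction a rejecting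
  collection consists of members of \<open>X\<close> and internal sets, and all internal sets are in
  \<open>K1\<close>.\<close>

lemma solvable_replace_cross:
  assumes fin: "finite (\<Union>(K1 \<union> F2))" "finite (K1 \<union> F2)" and K2: "K2 \<subseteq> F2" and ne: "{} \<notin> K1"
    and cross: "\<And>S j. S \<in> F2 \<Longrightarrow> \<not> own ` S \<subseteq> {j}"
    and bound: "\<And>X. X \<subseteq> K1 \<union> F2 \<Longrightarrow> disjoint X \<Longrightarrow> card (\<Union>X) \<le> l"
    and rep: "\<And>S Y. S \<in> F2 \<Longrightarrow> finite Y \<Longrightarrow> card Y \<le> l \<Longrightarrow> S \<inter> Y = {} \<Longrightarrow>
      \<exists>S'\<in>K2. S' \<inter> Y = {} \<and> card S' = card S \<and> S' \<inter> \<Union>K1 = S \<inter> \<Union>K1 \<and>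
        (\<forall>i\<in>own ` \<Union>K1. card {x \<in> S'. own x = i} = card {x \<in> S. own x = i})"
  shows "solvable own (K1 \<union> F2) k \<longleftrightarrow> solvable own (K1 \<union> K2) k"
proof -
  let ?F = "K1 \<union> F2" and ?G = "K1 \<union> K2"
  have finU: "finite (\<Union>A)" if "A \<subseteq> ?F" for A using fin(1) that by (meson Union_mono finite_subset)
  have finS: "finite S" if "S \<in> ?F" for S using finU[of "{S}"] that by simp
  have finA: "finite A" if "A \<subseteq> ?F" for A using fin(2) that by (rule finite_subset[rotated])
  show ?thesis
  proof
    assume "solvable own ?F k"
    then obtain X where "unrejected own ?F X" "k \<le> card (\<Union>X)" unfolding solvable_def by blast
    then have "\<exists>X. unrejected own ?F X \<and> k \<le> card (\<Union>X) \<and> X \<subseteq> ?G"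
    proof (induction "card (X - ?G)" arbitrary: X rule: less_induct)
      case less
      show ?case
      proof (cases "X \<subseteq> ?G")
        case True
        then show ?thesis using less.prems by blast
      next
        case False
        have X: "X \<subseteq> ?F" "disjoint X" "\<And>i R. \<not> rejected_by own ?F X i R"
          using less.prems(1) by (simp_all add: unrejected_def)
        from False obtain S where S: "S \<in> X" "S \<notin> ?G" by blast
        then have SF: "S \<in> F2" using X(1) by blast
        have sub: "X - {S} \<subseteq> ?F" using X(1) by blast
        have dS: "S \<inter> \<Union>(X - {S}) = {}" using disjoint_Union_Int[OF X(2), of "{S}" "X - {S}"] S(1) by auto
        have "card (\<Union>(X - {S})) \<le> l" by (rule bound[OF sub]) (rule pairwise_subset[OF X(2)], blast)
        from rep[OF SF finU[OF sub] this dS] obtain S' where S': "S' \<in> K2" "S' \<inter> \<Union>(X - {S}) = {}"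
          "card S' = card S" "S' \<inter> \<Union>K1 = S \<inter> \<Union>K1"
          and cnt: "\<forall>i\<in>own ` \<Union>K1. card {x \<in> S'. own x = i} = card {x \<in> S. own x = i}"
          by (elim bexE conjE)
        let ?X = "insert S' (X - {S})"
        have S'F: "S' \<in> ?F" using S'(1) K2 by blast
        have cov: "cov own i ?X = cov own i X" if "i \<in> own ` \<Union>K1" for i
          by (rule cov_swap[OF X(2) S(1) finU[OF X(1)] finS[OF S'F] S'(2) bspec[OF cnt that, symmetric]])
        have "\<not> rejected_by own ?F ?X i R" for i R
        proof
          assume "rejected_by own ?F ?X i R"
          then have R: "R \<subseteq> ?F" "disjoint R" "\<And>A. A \<in> R \<Longrightarrow> A \<in> ?X \<or> own ` A \<subseteq> {i}"
            "cov own i ?X < cov own i R" by (simp_all add: rejected_by_def)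
          have X'F: "?X \<subseteq> ?F" using X(1) S'F by blast
          have int: "A \<in> K1" if "A \<in> R" "own ` A \<subseteq> {i}" for A
            using that R(1) cross by blast
          \<comment> \<open>A part of \<open>?X\<close> alone cannot gain, so \<open>R\<close>
            contains an \<open>i\<close>-internal set. It is nonempty and lies in \<open>K1\<close>,
            hence agent \<open>i\<close> occurs as an owner in \<open>\<Union>K1\<close> and the
            counts of \<open>S\<close> and \<open>S'\<close> agree for \<open>i\<close>.\<close>
          have "\<exists>A\<in>R. own ` A \<subseteq> {i}"
          proof (rule ccontr)
            assume "\<not> ?thesis"
            then have "R \<subseteq> ?X" using R(3) by blast
            then show False using cov_mono[OF finU[OF X'F]] R(4) by (meson leD)
          qed
          then obtain A where A: "A \<in> R" "own ` A \<subseteq> {i}" by blast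
          then have "A \<in> K1" "A \<noteq> {}" using int ne by blast+
          then have "i \<in> own ` \<Union>K1" using A(2) by blast
          note covX = cov[OF this] and covS = bspec[OF cnt this]
          show False
          proof (cases "S' \<in> R")
            case False
            then have "\<forall>A\<in>R. A \<in> X \<or> own ` A \<subseteq> {i}" using R(3) by blast
            then have "rejected_by own ?F X i R" using R(1,2,4) covX by (simp add: rejected_by_def)
            then show False using X(3) by blast
          next
            case True
            \<comment> \<open>\<open>S'\<close> is exchanged back for \<open>S\<close> in
              \<open>R\<close>. Internal members of \<open>R\<close> stay inside
              \<open>\<Union>K1\<close>, where \<open>S\<close> and \<open>S'\<close> coincide; the
              other members avoid \<open>S\<close> because they were in \<open>X\<close> together
              with it.\<close>
            have "B \<inter> S = {}" if "B \<in> R - {S'}" for B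
            proof (cases "own ` B \<subseteq> {i}")
              case True
              then have "B \<subseteq> \<Union>K1" using int that by blast
              moreover have "B \<inter> S' = {}" by (rule disjointD[OF R(2)]) (use that \<open>S' \<in> R\<close> in auto)
              ultimately show ?thesis using S'(4) by blast
            next
              case False
              then have "B \<in> X - {S}" using R(3)[of B] that by blast
              then show ?thesis by (intro disjointD[OF X(2)]) (use S(1) in auto)
            qed
            then have SR: "S \<inter> \<Union>(R - {S'}) = {}" by blast
            let ?R = "insert S (R - {S'})"
            have SF': "S \<in> ?F" using SF by blast
            have "cov own i ?R = cov own i R"
              by (rule cov_swap[OF R(2) True finU[OF R(1)] finS[OF SF'] SR covS])
            moreover have "\<forall>A\<in>?R. A \<in> X \<or> own ` A \<subseteq> {i}" using R(3) S(1) by blast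
            moreover have "?R \<subseteq> ?F" using R(1) SF by blast
            ultimately have "rejected_by own ?F X i ?R"
              using R(4) covX disjoint_swap[OF R(2) SR] by (simp add: rejected_by_def)
            then show False using X(3) by blast
          qed
        qed
        moreover have "?X \<subseteq> ?F" using X(1) S'F by blast
        ultimately have "unrejected own ?F ?X" using disjoint_swap[OF X(2) S'(2)] by (simp add: unrejected_def)
        moreover have "k \<le> card (\<Union>?X)"
          using card_Union_swap[OF X(2) S(1) finU[OF X(1)] finS[OF S'F] S'(2) S'(3)[symmetric]] less.prems(2)
          by simp
        moreover have "card (?X - ?G) < card (X - ?G)"
        proof (rule psubset_card_mono)
          show "finite (X - ?G)" using finA[OF X(1)] by simp
          have "?X - ?G \<subseteq> X - ?G" using S'(1) by auto
          moreover have "S \<in> X - ?G" "S \<notin> ?X - ?G" using S S'(1) by auto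
          ultimately show "?X - ?G \<subset> X - ?G" by (metis psubsetI)
        qed
        ultimately show ?thesis by (intro less.hyps)
      qed
    qed
    then obtain X where X: "unrejected own ?F X" "k \<le> card (\<Union>X)" "X \<subseteq> ?G" by blast
    have "?G \<subseteq> ?F" using K2 by blast
    from unrejected_subset[OF X(1,3) this] have "unrejected own ?G X" .
    then show "solvable own ?G k" using X(2) unfolding solvable_def by blast
  next
    assume "solvable own ?G k"
    then obtain X where X: "X \<subseteq> ?G" "disjoint X" "\<And>i R. \<not> rejected_by own ?G X i R" "k \<le> card (\<Union>X)"
      unfolding solvable_def unrejected_def by blast
    have "\<not> rejected_by own ?F X i R" for i R
    proof
      assume R: "rejected_by own ?F X i R"
      have "S \<in> ?G" if "S \<in> R" for S
      proof (cases "S \<in> X")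
        case False
        then have "own ` S \<subseteq> {i}" "S \<in> ?F" using R that by (auto simp: rejected_by_def)
        then show ?thesis using cross by blast
      qed (use X(1) in blast)
      then have "R \<subseteq> ?G" by blast
      then have "rejected_by own ?G X i R" using R by (simp add: rejected_by_def)
      then show False using X(3) by blast
    qed
    moreover have "X \<subseteq> ?F" using X(1) K2 by blast
    ultimately have "unrejected own ?F X" using X(2) unfolding unrejected_def by blast
    then show "solvable own ?F k" using X(4) unfolding solvable_def by blast
  qed
qed

section \<open>Representative subfamilies\<close>

text \<open>The name of an element paired with its owner.\<close>

type_synonym elt = "nat \<times> nat"

text \<open>Only the covered elements are recorded, not the packing. The reversal is what prepending
  the elements of \<open>s\<close> one by one produces; \<open>flat\<close> has it for the same
  reason.\<close>

definition greedy :: "elt list list \<Rightarrow> elt list" where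
  "greedy F = foldl (\<lambda>acc s. if set s \<inter> set acc = {} then rev s @ acc else acc) [] F"

text \<open>\<open>Y\<close> is quantified existentially because the fold keeps only the union of
  its members. A skipped set meets the accumulator, which only grows; a chosen nonempty set is
  contained in it.\<close>

lemma greedy_aux:
  assumes "\<forall>s\<in>set F. distinct s"
  shows "\<exists>Y. Y \<subseteq> set ` set F - {{}} \<and> disjoint Y \<and> \<Union>Y \<inter> set acc = {} \<and>
    set (foldl (\<lambda>acc s. if set s \<inter> set acc = {} then rev s @ acc else acc) acc F) = set acc \<union> \<Union>Y \<and>
    (distinct acc \<longrightarrow> distinct (foldl (\<lambda>acc s. if set s \<inter> set acc = {} then rev s @ acc else acc) acc F)) \<and>
    (\<forall>s\<in>set F. s \<noteq> [] \<longrightarrow>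
      set s \<inter> set (foldl (\<lambda>acc s. if set s \<inter> set acc = {} then rev s @ acc else acc) acc F) \<noteq> {})"
  using assms
proof (induction F arbitrary: acc)
  case Nil
  show ?case by (intro exI[of _ "{}"]) simp
next
  case (Cons s F)
  let ?f = "\<lambda>acc s. if set s \<inter> set acc = {} then rev s @ acc else acc"
  let ?acc = "?f acc s"
  have "\<forall>s\<in>set F. distinct s" using Cons.prems by simp
  from Cons.IH[OF this, of ?acc] obtain Y where Y: "Y \<subseteq> set ` set F - {{}}" "disjoint Y"
    "\<Union>Y \<inter> set ?acc = {}" "set (foldl ?f ?acc F) = set ?acc \<union> \<Union>Y"
    "distinct ?acc \<longrightarrow> distinct (foldl ?f ?acc F)"
    "\<forall>s\<in>set F. s \<noteq> [] \<longrightarrow> set s \<inter> set (foldl ?f ?acc F) \<noteq> {}" by blast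
  have fold: "foldl ?f acc (s # F) = foldl ?f ?acc F" by simp
  show ?case
  proof (cases "set s \<inter> set acc = {}")
    case True
    then have acc: "?acc = rev s @ acc" by simp
    show ?thesis
    proof (cases "s = []")
      case True
      then have acc: "?acc = acc" by simp
      show ?thesis unfolding fold acc
        by (rule exI[of _ Y]) (use Y[unfolded acc] True in auto)
    next
      case False
      let ?Y = "insert (set s) Y"
      have sY: "set s \<inter> \<Union>Y = {}" using Y(3) unfolding acc by auto
      have "disjoint ({set s} \<union> Y)" by (rule disjoint_union) (use Y(2) sY in \<open>auto simp: disjoint_def\<close>)
      then have "disjoint ?Y" by simp
      moreover have "?Y \<subseteq> set ` set (s # F) - {{}}" using Y(1) False by auto
      moreover have "\<Union>?Y \<inter> set acc = {}" using Y(3) True unfolding acc by auto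
      moreover have "set (foldl ?f ?acc F) = set acc \<union> \<Union>?Y" unfolding Y(4) unfolding acc by auto
      moreover have "distinct acc \<longrightarrow> distinct (foldl ?f ?acc F)"
      proof
        assume "distinct acc"
        then have "distinct ?acc" unfolding acc using True Cons.prems by simp
        then show "distinct (foldl ?f ?acc F)" using Y(5) by blast
      qed
      moreover have "set s \<inter> set (foldl ?f ?acc F) \<noteq> {}"
      proof -
        have "set s \<subseteq> set (foldl ?f ?acc F)" unfolding Y(4) unfolding acc by auto
        then show ?thesis using False by (simp add: inf.absorb1)
      qed
      ultimately show ?thesis unfolding fold using Y(6) by (intro exI[of _ ?Y]) simp
    qed
  next
    case False
    then have acc: "?acc = acc" by simp
    have "set s \<inter> set (foldl ?f ?acc F) \<noteq> {}" using False unfolding Y(4) unfolding acc by blast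
    then show ?thesis unfolding fold acc
      by (intro exI[of _ Y]) (use Y[unfolded acc] acc in auto)
  qed
qed

lemma greedy_packing:
  assumes "\<forall>s\<in>set F. distinct s"
  obtains Y where "Y \<subseteq> set ` set F" "disjoint Y" "\<Union>Y = set (greedy F)" "distinct (greedy F)"
    "\<And>s. s \<in> set F \<Longrightarrow> s \<noteq> [] \<Longrightarrow> set s \<inter> set (greedy F) \<noteq> {}"
proof -
  from greedy_aux[OF assms, of "[]", folded greedy_def] obtain Y where
    "Y \<subseteq> set ` set F - {{}}" "disjoint Y" "set (greedy F) = \<Union>Y" "distinct (greedy F)"
    "\<forall>s\<in>set F. s \<noteq> [] \<longrightarrow> set s \<inter> set (greedy F) \<noteq> {}" by auto
  then show thesis by (intro that[of Y]) auto
qed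

lemma length_greedy_le: "length (greedy F) \<le> sum_list (map length F)"
proof -
  have "length (foldl (\<lambda>acc s. if set s \<inter> set acc = {} then rev s @ acc else acc) acc F)
    \<le> length acc + sum_list (map length F)" for acc
  proof (induction F arbitrary: acc)
    case (Cons s F)
    show ?case using Cons[of "rev s @ acc"] Cons[of acc] by simp
  qed simp
  from this[of "[]"] show ?thesis by (simp add: greedy_def)
qed

section \<open>Types of sets and thinning by full cores\<close>

definition owner_count :: "nat \<Rightarrow> elt list \<Rightarrow> nat" where
  "owner_count i s = length (filter (\<lambda>y. snd y = i) s)"

text \<open>One relation serves both thinnings. With the greedy elements for \<open>T\<close> it
  forces a substitute of an internal set to have the same owner, since every nonempty set meets
  \<open>T\<close>; with the elements of the kept internal sets it is the condition on cross
  sets.\<close>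

definition same_type :: "elt list \<Rightarrow> elt list \<Rightarrow> elt list \<Rightarrow> bool" where
  "same_type T s t \<longleftrightarrow> length s = length t \<and>
     (\<forall>x\<in>set T. (x \<in> set s \<longleftrightarrow> x \<in> set t) \<and> owner_count (snd x) s = owner_count (snd x) t)"

text \<open>Each subset \<open>A\<close> of \<open>s\<close> comes with its threshold
  \<open>b ^ (length s - card A)\<close>: every omitted element contributes a factor
  \<open>b\<close>. Building both together replaces exponentiation in the program by one
  multiplication per entry.\<close>

definition patterns :: "nat \<Rightarrow> elt list \<Rightarrow> (nat \<times> elt list) list" where
  "patterns b s = foldl (\<lambda>acc x. foldl (\<lambda>acc' p. (fst p, x # snd p) # (b * fst p, snd p) # acc') [] acc)
     [(1, [])] s"

lemma set_pattern_step:
  "set (foldl (\<lambda>acc' p. (fst p, x # snd p) # (b * fst p, snd p) # acc') acc0 acc) =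
   set acc0 \<union> (\<Union>p\<in>set acc. {(fst p, x # snd p), (b * fst p, snd p)})"
  by (induction acc arbitrary: acc0) auto

lemma length_pattern_step:
  "length (foldl (\<lambda>acc' p. (fst p, x # snd p) # (b * fst p, snd p) # acc') acc0 acc) =
   length acc0 + 2 * length acc"
  by (induction acc arbitrary: acc0) auto

lemma patterns_snoc:
  "patterns b (s @ [x]) =
   foldl (\<lambda>acc' p. (fst p, x # snd p) # (b * fst p, snd p) # acc') [] (patterns b s)"
  by (simp add: patterns_def)

lemma length_patterns: "length (patterns b s) = 2 ^ length s"
  by (induction s rule: rev_induct) (simp add: patterns_def, simp add: patterns_snoc length_pattern_step)

lemma patterns_sound:
  assumes "distinct s" "p \<in> set (patterns b s)"
  shows "set (snd p) \<subseteq> set s \<and> distinct (snd p) \<and> fst p = b ^ (length s - card (set (snd p)))"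
  using assms
proof (induction s arbitrary: p rule: rev_induct)
  case Nil
  then show ?case by (simp add: patterns_def)
next
  case (snoc x s)
  from snoc.prems(2) obtain p' where p': "p' \<in> set (patterns b s)"
    "p = (fst p', x # snd p') \<or> p = (b * fst p', snd p')"
    by (auto simp: patterns_snoc set_pattern_step)
  have IH: "set (snd p') \<subseteq> set s" "distinct (snd p')" "fst p' = b ^ (length s - card (set (snd p')))"
    using snoc.IH[OF _ p'(1)] snoc.prems(1) by simp_all
  have x: "x \<notin> set (snd p')" using IH(1) snoc.prems(1) by auto
  have "card (set (snd p')) \<le> length s"
    by (meson IH(1) List.finite_set card_length card_mono le_trans)
  then show ?case using p'(2) IH x by (auto simp: Suc_diff_le)
qed

lemma patterns_complete:
  assumes "A \<subseteq> set s"
  shows "\<exists>p\<in>set (patterns b s). set (snd p) = A"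
  using assms
proof (induction s arbitrary: A rule: rev_induct)
  case Nil
  then show ?case by (simp add: patterns_def)
next
  case (snoc x s)
  show ?case
  proof (cases "x \<in> A")
    case True
    have "A - {x} \<subseteq> set s" using snoc.prems by auto
    from snoc.IH[OF this] obtain p where p: "p \<in> set (patterns b s)" "set (snd p) = A - {x}" by blast
    then show ?thesis unfolding patterns_snoc set_pattern_step using True
      by (intro bexI[of _ "(fst p, x # snd p)"]) auto
  next
    case False
    then have "A \<subseteq> set s" using snoc.prems by auto
    from snoc.IH[OF this] obtain p where p: "p \<in> set (patterns b s)" "set (snd p) = A" by blast
    then show ?thesis unfolding patterns_snoc set_pattern_step
      by (intro bexI[of _ "(b * fst p, snd p)"]) auto
  qed
qed

definition core_count :: "elt list \<Rightarrow> elt list list \<Rightarrow> elt list \<Rightarrow> elt set \<Rightarrow> nat" where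
  "core_count T K s A = length (filter (\<lambda>t. A \<subseteq> set t \<and> same_type T s t) K)"

text \<open>A set is dropped only if one of its subsets \<open>A\<close> lies in many sets already kept of the same type.
  Since supersets of \<open>A\<close> lie in few of them, not all of these can meet a given small set \<open>Y\<close> disjoint
  from \<open>A\<close>: one of them can replace the dropped set.\<close>

definition admissible :: "elt list \<Rightarrow> nat \<Rightarrow> elt list list \<Rightarrow> elt list \<Rightarrow> bool" where
  "admissible T b K s \<longleftrightarrow> (\<forall>p\<in>set (patterns b s). core_count T K s (set (snd p)) < fst p)"

definition sp_kernel :: "elt list \<Rightarrow> nat \<Rightarrow> elt list list \<Rightarrow> elt list list" where
  "sp_kernel T b F = foldl (\<lambda>K s. if admissible T b K s then s # K else K) [] F"

lemma kernel_snoc: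
  "sp_kernel T b (F @ [s]) = (if admissible T b (sp_kernel T b F) s then s # sp_kernel T b F else sp_kernel T b F)"
  by (simp add: sp_kernel_def)

lemma admissible_iff:
  assumes "distinct s"
  shows "admissible T b K s \<longleftrightarrow> (\<forall>A\<subseteq>set s. core_count T K s A < b ^ (length s - card A))"
proof
  assume *: "admissible T b K s"
  show "\<forall>A\<subseteq>set s. core_count T K s A < b ^ (length s - card A)"
  proof (intro allI impI)
    fix A assume "A \<subseteq> set s"
    from patterns_complete[OF this, of b] obtain p where p: "p \<in> set (patterns b s)" "set (snd p) = A"
      by blast
    then show "core_count T K s A < b ^ (length s - card A)"
      using * patterns_sound[OF assms p(1)] by (auto simp: admissible_def)
  qed
next
  assume *: "\<forall>A\<subseteq>set s. core_count T K s A < b ^ (length s - card A)"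
  show "admissible T b K s" unfolding admissible_def
  proof
    fix p assume "p \<in> set (patterns b s)"
    from patterns_sound[OF assms this] * show "core_count T K s (set (snd p)) < fst p" by auto
  qed
qed

lemma set_kernel_subset: "set (sp_kernel T b F) \<subseteq> set F"
  by (induction F rule: rev_induct) (auto simp: sp_kernel_def)

lemma length_kernel_le_length: "length (sp_kernel T b F) \<le> length F"
  by (induction F rule: rev_induct) (auto simp: sp_kernel_def)

lemma same_type_sym: "same_type T s t \<Longrightarrow> same_type T t s"
  by (simp add: same_type_def)

lemma same_type_trans: "same_type T s t \<Longrightarrow> same_type T t u \<Longrightarrow> same_type T s u"
  by (simp add: same_type_def)

lemma core_count_same_type:
  assumes "same_type T s u"
  shows "core_count T K s A = core_count T K u A"
proof -
  have "same_type T s t \<longleftrightarrow> same_type T u t" for t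
    using assms same_type_sym same_type_trans by blast
  then show ?thesis by (simp add: core_count_def)
qed

text \<open>The count of \<open>A\<close> is raised only by a set of the same type that contains
  \<open>A\<close>, and admissibility requires the count to be strictly below the threshold before
  that.\<close>

lemma core_count_kernel_le:
  assumes "\<forall>s\<in>set F. distinct s" "b \<ge> 1"
  shows "core_count T (sp_kernel T b F) s A \<le> b ^ (length s - card A)"
  using assms(1)
proof (induction F rule: rev_induct)
  case Nil
  show ?case by (simp add: sp_kernel_def core_count_def)
next
  case (snoc u F)
  have IH: "core_count T (sp_kernel T b F) s A \<le> b ^ (length s - card A)" using snoc by simp
  show ?case
  proof (cases "admissible T b (sp_kernel T b F) u \<and> A \<subseteq> set u \<and> same_type T s u")
    case True
    then have "core_count T (sp_kernel T b F) s A < b ^ (length u - card A)"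
      using snoc.prems core_count_same_type[of T s u] by (auto simp: admissible_iff)
    moreover have "length u = length s" using True by (simp add: same_type_def)
    ultimately show ?thesis using True by (simp add: kernel_snoc core_count_def)
  next
    case False
    then show ?thesis using IH by (auto simp: kernel_snoc core_count_def)
  qed
qed

text \<open>Counts never decrease as further sets are kept, so a core that is full when
  \<open>s\<close> is dropped is still full at the end.\<close>

lemma kernel_mem_or_full_core:
  assumes "\<forall>s\<in>set F. distinct s" "s \<in> set F"
  shows "s \<in> set (sp_kernel T b F) \<or>
    (\<exists>A\<subseteq>set s. b ^ (length s - card A) \<le> core_count T (sp_kernel T b F) s A)"
  using assms
proof (induction F rule: rev_induct)
  case (snoc u F)
  show ?case
  proof (cases "s \<in> set F")
    case True
    then have "s \<in> set (sp_kernel T b F) \<or>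
      (\<exists>A\<subseteq>set s. b ^ (length s - card A) \<le> core_count T (sp_kernel T b F) s A)" using snoc by simp
    moreover have "core_count T (sp_kernel T b F) s A \<le> core_count T (sp_kernel T b (F @ [u])) s A" for A
      by (simp add: kernel_snoc core_count_def)
    moreover have "set (sp_kernel T b F) \<subseteq> set (sp_kernel T b (F @ [u]))" by (auto simp: kernel_snoc)
    ultimately show ?thesis by (meson le_trans subsetD)
  next
    case False
    then have u: "s = u" "distinct u" using snoc.prems by auto
    show ?thesis
      by (cases "admissible T b (sp_kernel T b F) u")
        (auto simp: kernel_snoc u admissible_iff not_less)
  qed
qed simp

lemma length_le_sum_hits:
  assumes "finite Y" "\<forall>t\<in>set K. set t \<inter> Y \<noteq> {}"
  shows "length K \<le> (\<Sum>y\<in>Y. length (filter (\<lambda>t. y \<in> set t) K))"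
  using assms(2)
proof (induction K)
  case (Cons t K)
  from Cons.prems obtain y where y: "y \<in> set t" "y \<in> Y" by auto
  have "(\<Sum>y\<in>Y. length (filter (\<lambda>t. y \<in> set t) K)) < (\<Sum>y\<in>Y. length (filter (\<lambda>t. y \<in> set t) (t # K)))"
    by (rule sum_strict_mono_ex1[OF assms(1)]) (use y in \<open>auto intro!: bexI[of _ y]\<close>)
  then show ?case using Cons by simp
qed simp

text \<open>Let \<open>A\<close> be a full core of \<open>s\<close> missing \<open>z + 1\<close>
  elements. An element \<open>y\<close> of \<open>Y\<close> is not in \<open>A\<close>, so the kept
  sets of this type containing both are bounded by the threshold \<open>b ^ z\<close> of
  \<open>insert y A\<close>. If all sets of the full core met \<open>Y\<close>, there would be at
  most \<open>l * b ^ z\<close> of them.\<close>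

lemma kernel_representative:
  assumes F: "\<forall>s\<in>set F. distinct s" "s \<in> set F"
    and Y: "finite Y" "card Y \<le> l" "set s \<inter> Y = {}"
  shows "\<exists>t\<in>set (sp_kernel T (l + 1) F). same_type T s t \<and> set t \<inter> Y = {}"
proof -
  let ?b = "l + 1"
  let ?K = "sp_kernel T ?b F"
  have KF: "set ?K \<subseteq> set F" by (rule set_kernel_subset)
  from kernel_mem_or_full_core[OF F, of T ?b] show ?thesis
  proof
    assume "s \<in> set ?K"
    then show ?thesis using Y(3) by (auto simp: same_type_def)
  next
    assume "\<exists>A\<subseteq>set s. ?b ^ (length s - card A) \<le> core_count T ?K s A"
    then obtain A where A: "A \<subseteq> set s" "?b ^ (length s - card A) \<le> core_count T ?K s A" by blast
    define Kf where "Kf = filter (\<lambda>t. A \<subseteq> set t \<and> same_type T s t) ?K"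
    have len: "?b ^ (length s - card A) \<le> length Kf" using A(2) by (simp add: core_count_def Kf_def)
    have fA: "finite A" using A(1) finite_subset by blast
    have ls: "length s = card (set s)" using F by (simp add: distinct_card)
    show ?thesis
    proof (cases "card A = length s")
      case True
      \<comment> \<open>A core consisting of all of \<open>s\<close> has threshold
        \<open>?b ^ 0 = 1\<close>, and any kept list of the same length containing it has exactly
        the elements of \<open>s\<close>.\<close>
      then have "A = set s" using A(1) ls by (simp add: card_subset_eq)
      moreover have "Kf \<noteq> []" using len by auto
      then obtain t where "t \<in> set Kf" by (cases Kf) auto
      then have t: "t \<in> set ?K" "A \<subseteq> set t" "same_type T s t" by (auto simp: Kf_def)
      have "distinct t" using F(1) KF t(1) by blast
      then have "card (set t) = card (set s)" using t(3) ls by (simp add: same_type_def distinct_card)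
      then have "set t = set s" using t(2) \<open>A = set s\<close> card_subset_eq[of "set t" "set s"] by simp
      then show ?thesis using t Y(3) by auto
    next
      case False
      then have lt: "card A < length s" using A(1) ls card_mono[of "set s" A] by simp
      then obtain z where z: "length s - card A = Suc z" by (metis Suc_diff_Suc)
      show ?thesis
      proof (rule ccontr)
        assume no: "\<not> ?thesis"
        have "\<forall>t\<in>set Kf. set t \<inter> Y \<noteq> {}" using no by (auto simp: Kf_def)
        then have "length Kf \<le> (\<Sum>y\<in>Y. length (filter (\<lambda>t. y \<in> set t) Kf))"
          by (rule length_le_sum_hits[OF Y(1)])
        also have "\<dots> \<le> (\<Sum>y\<in>Y. ?b ^ z)"
        proof (rule sum_mono)
          fix y assume y: "y \<in> Y"
          have "filter (\<lambda>t. y \<in> set t) Kf = filter (\<lambda>t. insert y A \<subseteq> set t \<and> same_type T s t) ?K"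
            unfolding Kf_def by (auto intro: filter_cong)
          then have "length (filter (\<lambda>t. y \<in> set t) Kf) = core_count T ?K s (insert y A)"
            by (simp add: core_count_def)
          also have "\<dots> \<le> ?b ^ (length s - card (insert y A))"
            by (rule core_count_kernel_le[OF F(1)]) simp
          also have "card (insert y A) = Suc (card A)"
            using fA y A(1) Y(3) by (intro card_insert_disjoint) auto
          also have "length s - Suc (card A) = z" using z by simp
          finally show "length (filter (\<lambda>t. y \<in> set t) Kf) \<le> ?b ^ z" .
        qed
        also have "\<dots> = card Y * ?b ^ z" by simp
        also have "\<dots> \<le> l * ?b ^ z" using Y(2) by (rule mult_le_mono1)
        \<comment> \<open>Strict because \<open>?b = l + 1\<close>; this is the reason for the shift
          by one.\<close>
        also have "\<dots> < ?b ^ Suc z" by simp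
        finally show False using len unfolding z by simp
      qed
    qed
  qed
qed

text \<open>There are at most \<open>2 * length T + 1\<close> labels, which bounds the number of types.\<close>

definition label :: "elt list \<Rightarrow> elt \<Rightarrow> elt + nat option" where
  "label T x = (if x \<in> set T then Inl x else if snd x \<in> snd ` set T then Inr (Some (snd x)) else Inr None)"

text \<open>A label remembers an element of \<open>T\<close> exactly, otherwise its owner if this
  occurs in \<open>T\<close>, otherwise nothing. The type can be read off these labels, so label
  sequences bound the number of types from above.\<close>

lemma same_type_if_labels_eq:
  assumes "map (label T) s = map (label T) t"
  shows "same_type T s t"
  unfolding same_type_def
proof (intro conjI ballI)
  show "length s = length t" using assms by (rule map_eq_imp_length_eq)
  fix x assume x: "x \<in> set T"
  have "x \<in> set u \<longleftrightarrow> Inl x \<in> set (map (label T) u)" for u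
    using x by (auto simp: label_def image_iff split: if_splits)
  then show "x \<in> set s \<longleftrightarrow> x \<in> set t" using assms by metis
  define \<phi> :: "elt + nat option \<Rightarrow> bool" where "\<phi> = case_sum (\<lambda>y. snd y = snd x) (\<lambda>j. j = Some (snd x))"
  have "snd y = snd x \<longleftrightarrow> \<phi> (label T y)" for y
    using x by (auto simp: label_def \<phi>_def)
  then have "owner_count (snd x) u = length (filter \<phi> (map (label T) u))" for u
    by (simp add: owner_count_def filter_map o_def)
  then show "owner_count (snd x) s = owner_count (snd x) t" using assms by metis
qed

text \<open>The left side counts words of length at most \<open>d\<close> over \<open>c\<close>
  letters; padding them to length \<open>d\<close> with one extra letter explains the right
  side.\<close>

lemma sum_powers_le: "(\<Sum>i\<le>d. c ^ i) \<le> (c + 1 :: nat) ^ d"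
proof (induction d)
  case (Suc d)
  have "(\<Sum>i\<le>Suc d. c ^ i) = 1 + c * (\<Sum>i\<le>d. c ^ i)"
    by (simp add: sum.atMost_Suc_shift sum_distrib_left del: sum.atMost_Suc)
  also have "\<dots> \<le> 1 + c * (c + 1) ^ d" using Suc by simp
  also have "\<dots> \<le> (c + 1) ^ d + c * (c + 1) ^ d" by simp
  finally show ?case by simp
qed simp

lemma length_filter_mono:
  "(\<And>x. x \<in> set xs \<Longrightarrow> P x \<Longrightarrow> Q x) \<Longrightarrow> length (filter P xs) \<le> length (filter Q xs)"
  by (induction xs) (auto intro: le_SucI)

lemma length_filter_partition:
  assumes "finite B" "\<forall>t\<in>set K. g t \<in> B"
  shows "length K = (\<Sum>y\<in>B. length (filter (\<lambda>t. g t = y) K))"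
  using assms(2)
proof (induction K)
  case (Cons t K)
  have "(\<Sum>y\<in>B. length (filter (\<lambda>t. g t = y) (t # K))) =
    (\<Sum>y\<in>B. (if g t = y then 1 else 0) + length (filter (\<lambda>t. g t = y) K))"
    by (rule sum.cong) auto
  also have "\<dots> = 1 + length K" using Cons assms(1) by (simp add: sum.distrib)
  finally show ?case by simp
qed simp

text \<open>Group the kept sets by label sequence. There are at most \<open>2 * length T + 1\<close>
  labels and one more for padding, which gives the base \<open>2 * length T + 2\<close>. Within a
  group the empty core, of threshold at most \<open>b ^ d\<close>, bounds the number of
  sets.\<close>

lemma length_kernel_le:
  assumes F: "\<forall>s\<in>set F. distinct s" "\<forall>s\<in>set F. length s \<le> d" and b: "b \<ge> 1"
  shows "length (sp_kernel T b F) \<le> (2 * length T + 2) ^ d * b ^ d"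
proof -
  let ?K = "sp_kernel T b F"
  let ?lab = "range (label T)"
  let ?B = "{xs. set xs \<subseteq> ?lab \<and> length xs \<le> d}"
  have "?lab \<subseteq> Inl ` set T \<union> Inr ` insert None (Some ` snd ` set T)" (is "_ \<subseteq> ?C")
    by (auto simp: label_def)
  moreover have "card ?C \<le> card (Inl ` set T :: (elt + nat option) set) + card (Inr ` insert None (Some ` snd ` set T) :: (elt + nat option) set)"
    by (rule card_Un_le)
  moreover have "card (Inl ` set T :: (elt + nat option) set) \<le> length T"
    by (meson List.finite_set card_image_le card_length le_trans)
  moreover have "card (Inr ` insert None (Some ` snd ` set T) :: (elt + nat option) set) \<le> length T + 1"
  proof -
    have "card (Inr ` insert None (Some ` snd ` set T) :: (elt + nat option) set)
        \<le> card (insert None (Some ` snd ` set T))" by (rule card_image_le) simp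
    also have "\<dots> \<le> Suc (card (Some ` snd ` set T))" by (rule card_insert_le_m1) auto
    also have "card (Some ` snd ` set T) \<le> card (set T)"
      by (metis List.finite_set card_image_le finite_imageI le_trans)
    also have "card (set T) \<le> length T" by (rule card_length)
    finally show ?thesis by simp
  qed
  ultimately have lab: "card ?lab \<le> 2 * length T + 1" "finite ?lab"
    using card_mono[of ?C ?lab] finite_subset[of ?lab ?C] by auto
  have fB: "finite ?B" by (rule finite_lists_length_le[OF lab(2)])
  have "card ?B = (\<Sum>i\<le>d. card ?lab ^ i)" by (rule card_lists_length_le[OF lab(2)])
  also have "\<dots> \<le> (card ?lab + 1) ^ d" by (rule sum_powers_le)
  also have "\<dots> \<le> (2 * length T + 2) ^ d" using lab(1) by (intro power_mono) auto
  finally have cB: "card ?B \<le> (2 * length T + 2) ^ d" .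
  have KF: "set ?K \<subseteq> set F" by (rule set_kernel_subset)
  have "length ?K = (\<Sum>y\<in>?B. length (filter (\<lambda>t. map (label T) t = y) ?K))"
    by (rule length_filter_partition[OF fB]) (use KF F(2) in auto)
  also have "\<dots> \<le> (\<Sum>y\<in>?B. b ^ d)"
  proof (rule sum_mono)
    fix y assume "y \<in> ?B"
    show "length (filter (\<lambda>t. map (label T) t = y) ?K) \<le> b ^ d"
    proof (cases "\<exists>t\<in>set ?K. map (label T) t = y")
      case True
      then obtain u where u: "u \<in> set ?K" "map (label T) u = y" by blast
      have "length (filter (\<lambda>t. map (label T) t = y) ?K) \<le> core_count T ?K u {}"
        unfolding core_count_def
        by (rule length_filter_mono) (use u(2) same_type_if_labels_eq[of T u] in simp)
      also have "\<dots> \<le> b ^ (length u - card ({} :: elt set))" by (rule core_count_kernel_le[OF F(1) b])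
      also have "\<dots> \<le> b ^ d" using u(1) KF F(2) b by (intro power_increasing) auto
      finally show ?thesis .
    next
      case False
      then have "filter (\<lambda>t. map (label T) t = y) ?K = []" by (auto simp: filter_empty_conv)
      then show ?thesis by simp
    qed
  qed
  also have "\<dots> = card ?B * b ^ d" by simp
  also have "\<dots> \<le> (2 * length T + 2) ^ d * b ^ d" using cB by (rule mult_le_mono1)
  finally show ?thesis .
qed

section \<open>Exhaustive search\<close>

definition internal_list :: "elt list \<Rightarrow> bool" where
  "internal_list s \<longleftrightarrow> (\<forall>x\<in>set s. \<forall>y\<in>set s. snd y = snd x)"

lemma internal_list_iff: "s \<noteq> [] \<Longrightarrow> internal_list s \<longleftrightarrow> (\<exists>j. snd ` set s \<subseteq> {j})"
proof
  assume "s \<noteq> []" and int: "internal_list s"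
  then have "hd s \<in> set s" by simp
  with int have "\<forall>y\<in>set s. snd y = snd (hd s)" unfolding internal_list_def by (rule bspec)
  then show "\<exists>j. snd ` set s \<subseteq> {j}" by (intro exI[of _ "snd (hd s)"] image_subsetI) simp
next
  assume "\<exists>j. snd ` set s \<subseteq> {j}"
  then obtain j where "snd ` set s \<subseteq> {j}" by (elim exE)
  then have "\<forall>x\<in>set s. snd x = j" by (simp add: image_subset_iff)
  then show "internal_list s" by (simp add: internal_list_def)
qed

text \<open>The accumulator starts with \<open>Xs\<close> itself, so that iterating \<open>q\<close>
  times also retains the packings of fewer than \<open>q\<close> sets.\<close>

definition extend :: "elt list list \<Rightarrow> elt list list list \<Rightarrow> elt list list list" where
  "extend K Xs = foldl (\<lambda>acc X. foldl (\<lambda>acc s. if \<forall>x\<in>set X. set s \<inter> set x = {} then (s # X) # acc else acc) acc K) Xs Xs"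

definition packs :: "elt list list \<Rightarrow> nat \<Rightarrow> elt list list list" where
  "packs K q = (extend K ^^ q) [[]]"

lemma set_foldl_insert:
  "set (foldl (\<lambda>acc s. if P s then f s # acc else acc) acc K) = set acc \<union> f ` {s \<in> set K. P s}"
  by (induction K arbitrary: acc) auto

lemma length_foldl_insert:
  "length (foldl (\<lambda>acc s. if P s then f s # acc else acc) acc K) \<le> length acc + length K"
proof (induction K arbitrary: acc)
  case (Cons s K)
  show ?case using Cons[of "f s # acc"] Cons[of acc] by auto
qed simp

lemma length_extend_aux:
  "length (foldl (\<lambda>acc X. foldl (\<lambda>acc s. if \<forall>x\<in>set X. set s \<inter> set x = {} then (s # X) # acc else acc) acc K) acc Xs)
    \<le> length acc + length Xs * length K"
proof (induction Xs arbitrary: acc)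
  case (Cons X Xs)
  show ?case
    using Cons[of "foldl (\<lambda>acc s. if \<forall>x\<in>set X. set s \<inter> set x = {} then (s # X) # acc else acc) acc K"]
      length_foldl_insert[of "\<lambda>s. \<forall>x\<in>set X. set s \<inter> set x = {}" "\<lambda>s. s # X" acc K] by simp
qed simp

lemma length_extend_le: "length (extend K Xs) \<le> length Xs * (length K + 1)"
  using length_extend_aux[of K Xs Xs] by (simp add: extend_def)

lemma length_packs_le: "length (packs K q) \<le> (length K + 1) ^ q"
proof (induction q)
  case (Suc q)
  have "length (packs K (Suc q)) \<le> length (packs K q) * (length K + 1)"
    using length_extend_le[of K "packs K q"] by (simp add: packs_def)
  also have "\<dots> \<le> (length K + 1) ^ q * (length K + 1)" using Suc by (rule mult_le_mono1)
  finally show ?case by (simp add: mult.commute)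
qed (simp add: packs_def)

lemma set_extend:
  "set (extend K Xs) = set Xs \<union> {s # X | s X. X \<in> set Xs \<and> s \<in> set K \<and> (\<forall>x\<in>set X. set s \<inter> set x = {})}"
proof -
  have "set (foldl (\<lambda>acc X. foldl (\<lambda>acc s. if \<forall>x\<in>set X. set s \<inter> set x = {} then (s # X) # acc else acc) acc K) acc Xs)
    = set acc \<union> {s # X | s X. X \<in> set Xs \<and> s \<in> set K \<and> (\<forall>x\<in>set X. set s \<inter> set x = {})}" for acc
    by (induction Xs arbitrary: acc) (auto simp: set_foldl_insert)
  then show ?thesis by (simp add: extend_def)
qed

lemma set_packs:
  assumes "\<forall>s\<in>set K. distinct s"
  shows "set (packs K q) = {X. length X \<le> q \<and> set X \<subseteq> set K \<and> distinct (concat X)}"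
proof (induction q)
  case 0
  show ?case by (auto simp: packs_def)
next
  case (Suc q)
  have step: "packs K (Suc q) = extend K (packs K q)" by (simp add: packs_def)
  show ?case
  proof (intro set_eqI iffI)
    fix X assume "X \<in> set (packs K (Suc q))"
    then consider "X \<in> set (packs K q)" | s Y where "X = s # Y" "Y \<in> set (packs K q)" "s \<in> set K"
        "\<forall>x\<in>set Y. set s \<inter> set x = {}"
      unfolding step set_extend by blast
    then show "X \<in> {X. length X \<le> Suc q \<and> set X \<subseteq> set K \<and> distinct (concat X)}"
    proof cases
      case 2
      then have "set s \<inter> set (concat Y) = {}" by (simp add: Int_UN_distrib)
      then show ?thesis using 2(1-3) assms unfolding Suc by simp
    qed (use Suc in auto)
  next
    fix X assume X: "X \<in> {X. length X \<le> Suc q \<and> set X \<subseteq> set K \<and> distinct (concat X)}"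
    show "X \<in> set (packs K (Suc q))"
    proof (cases X)
      case Nil
      then show ?thesis unfolding step set_extend Suc by simp
    next
      case (Cons s Y)
      then have "Y \<in> set (packs K q)" using X unfolding Suc by simp
      moreover have "\<forall>x\<in>set Y. set s \<inter> set x = {}" using X Cons by auto
      ultimately show ?thesis unfolding step set_extend using X Cons by auto
    qed
  qed
qed

text \<open>Different lists in \<open>K\<close> may have the same elements; one list is chosen for
  each member of the packing, so the lengths agree.\<close>

lemma packing_as_list:
  assumes "finite \<X>" "\<X> \<subseteq> set ` set K" "disjoint \<X>" "\<forall>s\<in>set K. distinct s"
  shows "\<exists>X. length X = card \<X> \<and> set X \<subseteq> set K \<and> distinct (concat X) \<and> set ` set X = \<X>"
  using assms(1-3)
proof (induction rule: finite_induct)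
  case empty
  show ?case by (intro exI[of _ "[]"]) simp
next
  case (insert S \<X>)
  have "disjoint \<X>" by (rule pairwise_subset[OF insert.prems(2)]) blast
  moreover have "\<X> \<subseteq> set ` set K" using insert.prems(1) by blast
  ultimately obtain X where X: "length X = card \<X>" "set X \<subseteq> set K" "distinct (concat X)"
    "set ` set X = \<X>" using insert.IH by blast
  from insert.prems(1) obtain s where s: "s \<in> set K" "S = set s" by blast
  have "set s \<inter> set (concat X) = {}"
  proof -
    have "set s \<inter> set x = {}" if "x \<in> set X" for x
    proof -
      have "set x \<in> \<X>" using X(4) that by blast
      then show ?thesis unfolding s(2)[symmetric]
        by (intro disjointD[OF insert.prems(2)]) (use insert.hyps(2) in auto)
    qed
    then show ?thesis by auto
  qed
  then show ?case using X s insert.hyps assms(4)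
    by (intro exI[of _ "s # X"]) simp
qed

lemma list_packing:
  assumes "distinct (concat X)" "\<forall>s\<in>set X. s \<noteq> []"
  shows "disjoint (set ` set X) \<and> card (\<Union>(set ` set X)) = length (concat X) \<and>
    cov snd i (set ` set X) = owner_count i (concat X)"
proof -
  have "disjoint (set ` set X)"
    using assms(1)
  proof (induction X)
    case (Cons s X)
    then have "disjoint (set ` set X)" by simp
    moreover have "set s \<inter> \<Union>(set ` set X) = {}" using Cons.prems by auto
    ultimately have "disjoint ({set s} \<union> set ` set X)"
      by (intro disjoint_union) (auto simp: disjoint_def)
    then show ?case by simp
  qed simp
  moreover have "\<Union>(set ` set X) = set (concat X)" by simp
  moreover have "cov snd i (set ` set X) = owner_count i (concat X)"
  proof -
    have "cov snd i (set ` set X) = card (set (filter (\<lambda>y. snd y = i) (concat X)))"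
      unfolding cov_def by (rule arg_cong[where f = card]) auto
    also have "\<dots> = length (filter (\<lambda>y. snd y = i) (concat X))"
      using assms(1) by (intro distinct_card distinct_filter)
    finally show ?thesis by (simp add: owner_count_def)
  qed
  ultimately show ?thesis using distinct_card[OF assms(1)] by simp
qed

text \<open>The agent is searched for as the owner of an element \<open>e\<close> covered by
  \<open>R\<close>, since an agent that gains must own one. Equality of sets is tested by two
  inclusions because lists may differ in order.\<close>

definition list_rejects :: "elt list list \<Rightarrow> elt list list \<Rightarrow> bool" where
  "list_rejects X R \<longleftrightarrow> (\<exists>e\<in>set (concat R).
     owner_count (snd e) (concat X) < owner_count (snd e) (concat R) \<and>
     (\<forall>s\<in>set R. (\<exists>x\<in>set X. set s \<subseteq> set x \<and> set x \<subseteq> set s) \<or> (\<forall>y\<in>set s. snd y = snd e)))"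

definition brute_force :: "elt list list \<Rightarrow> nat \<Rightarrow> nat \<Rightarrow> bool" where
  "brute_force K q k \<longleftrightarrow> (\<exists>X\<in>set (packs K q). k \<le> length (concat X) \<and>
     \<not> (\<exists>R\<in>set (packs K q). list_rejects X R))"

lemma list_rejects_iff:
  assumes X: "distinct (concat X)" "\<forall>s\<in>set X. s \<noteq> []" and R: "distinct (concat R)" "\<forall>s\<in>set R. s \<noteq> []"
    and RF: "set ` set R \<subseteq> F"
  shows "list_rejects X R \<longleftrightarrow> (\<exists>i. rejected_by snd F (set ` set X) i (set ` set R))"
proof
  assume "list_rejects X R"
  then obtain e :: elt where e: "owner_count (snd e) (concat X) < owner_count (snd e) (concat R)"
    "\<forall>s\<in>set R. (\<exists>x\<in>set X. set s \<subseteq> set x \<and> set x \<subseteq> set s) \<or> (\<forall>y\<in>set s. snd y = snd e)"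
    by (auto simp: list_rejects_def)
  have "\<forall>S\<in>set ` set R. S \<in> set ` set X \<or> snd ` S \<subseteq> {snd e}" using e(2) by fastforce
  then have "rejected_by snd F (set ` set X) (snd e) (set ` set R)"
    using RF list_packing[OF X, of "snd e"] list_packing[OF R, of "snd e"] e(1) by (simp add: rejected_by_def)
  then show "\<exists>i. rejected_by snd F (set ` set X) i (set ` set R)" by blast
next
  assume "\<exists>i. rejected_by snd F (set ` set X) i (set ` set R)"
  then obtain i where i: "\<forall>S\<in>set ` set R. S \<in> set ` set X \<or> snd ` S \<subseteq> {i}"
    "cov snd i (set ` set X) < cov snd i (set ` set R)" by (auto simp: rejected_by_def)
  then have lt: "owner_count i (concat X) < owner_count i (concat R)"
    using list_packing[OF X, of i] list_packing[OF R, of i] by simp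
  then have "filter (\<lambda>y. snd y = i) (concat R) \<noteq> []" by (auto simp: owner_count_def)
  then obtain e where e: "e \<in> set (concat R)" "snd e = i" by (auto simp: filter_empty_conv)
  have "\<forall>s\<in>set R. (\<exists>x\<in>set X. set s \<subseteq> set x \<and> set x \<subseteq> set s) \<or> (\<forall>y\<in>set s. snd y = snd e)"
  proof
    fix s assume "s \<in> set R"
    then have "set s \<in> set ` set X \<or> snd ` set s \<subseteq> {i}" using i(1) by blast
    then show "(\<exists>x\<in>set X. set s \<subseteq> set x \<and> set x \<subseteq> set s) \<or> (\<forall>y\<in>set s. snd y = snd e)"
      using e(2) by (auto simp: image_iff)
  qed
  then show "list_rejects X R" unfolding list_rejects_def using e lt by blast
qed

text \<open>As \<open>q\<close> bounds the size of every packing over \<open>K\<close>, the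
  enumeration represents both all candidates \<open>X\<close> and all collections that could reject
  them.\<close>

lemma brute_force_correct:
  assumes K: "\<forall>s\<in>set K. distinct s" "\<forall>s\<in>set K. s \<noteq> []"
    and q: "\<And>\<X>. \<X> \<subseteq> set ` set K \<Longrightarrow> disjoint \<X> \<Longrightarrow> card \<X> \<le> q"
  shows "brute_force K q k \<longleftrightarrow> solvable snd (set ` set K) k"
proof -
  have fin: "finite \<X>" if "\<X> \<subseteq> set ` set K" for \<X> using that finite_subset by blast
  have packs: "X \<in> set (packs K q) \<longleftrightarrow> length X \<le> q \<and> set X \<subseteq> set K \<and> distinct (concat X)" for X
    using set_packs[OF K(1)] by simp
  have ex: "\<exists>X\<in>set (packs K q). set ` set X = \<X>" if \<X>: "\<X> \<subseteq> set ` set K" "disjoint \<X>" for \<X>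
  proof -
    obtain X where X: "length X = card \<X>" "set X \<subseteq> set K" "distinct (concat X)" "set ` set X = \<X>"
      using packing_as_list[OF fin[OF \<X>(1)] \<X> K(1)] by blast
    then have "X \<in> set (packs K q)" using q[OF \<X>] packs by simp
    then show ?thesis using X(4) by blast
  qed
  have rej: "(\<exists>R\<in>set (packs K q). list_rejects X R) \<longleftrightarrow>
      (\<exists>i R. rejected_by snd (set ` set K) (set ` set X) i R)" if X: "X \<in> set (packs K q)" for X
  proof -
    have X': "distinct (concat X)" "\<forall>s\<in>set X. s \<noteq> []" using X K(2) by (auto simp: packs)
    have eq: "list_rejects X R \<longleftrightarrow> (\<exists>i. rejected_by snd (set ` set K) (set ` set X) i (set ` set R))"
      if "R \<in> set (packs K q)" for R
      by (rule list_rejects_iff[OF X']) (use that K(2) packs in auto)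
    show ?thesis
    proof
      assume "\<exists>R\<in>set (packs K q). list_rejects X R"
      then show "\<exists>i R. rejected_by snd (set ` set K) (set ` set X) i R" using eq by blast
    next
      assume "\<exists>i R. rejected_by snd (set ` set K) (set ` set X) i R"
      then obtain i R where R: "rejected_by snd (set ` set K) (set ` set X) i R" by blast
      then have "R \<subseteq> set ` set K" "disjoint R" by (simp_all add: rejected_by_def)
      from ex[OF this] obtain R' where "R' \<in> set (packs K q)" "set ` set R' = R" by blast
      then show "\<exists>R\<in>set (packs K q). list_rejects X R" using eq R by blast
    qed
  qed
  show ?thesis
  proof
    assume "brute_force K q k"
    then obtain X where X: "X \<in> set (packs K q)" "k \<le> length (concat X)"
      "\<not> (\<exists>R\<in>set (packs K q). list_rejects X R)" unfolding brute_force_def by blast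
    have X': "distinct (concat X)" "\<forall>s\<in>set X. s \<noteq> []" "set ` set X \<subseteq> set ` set K"
      using X(1) K(2) by (auto simp: packs)
    have "unrejected snd (set ` set K) (set ` set X)"
      using X(3) rej[OF X(1)] X'(3) list_packing[OF X'(1,2)] by (simp add: unrejected_def)
    then show "solvable snd (set ` set K) k"
      using X(2) list_packing[OF X'(1,2)] unfolding solvable_def by (intro exI[of _ "set ` set X"]) simp
  next
    assume "solvable snd (set ` set K) k"
    then obtain \<X> where \<X>: "\<X> \<subseteq> set ` set K" "disjoint \<X>"
      "\<not> (\<exists>i R. rejected_by snd (set ` set K) \<X> i R)" "k \<le> card (\<Union>\<X>)"
      unfolding solvable_def unrejected_def by blast
    from ex[OF \<X>(1,2)] obtain X where X: "X \<in> set (packs K q)" "set ` set X = \<X>" by blast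
    have X': "distinct (concat X)" "\<forall>s\<in>set X. s \<noteq> []" using X(1) K(2) by (auto simp: packs)
    have "k \<le> length (concat X)" using \<X>(4) list_packing[OF X'] X(2) by simp
    then show "brute_force K q k" unfolding brute_force_def
      using X rej[OF X(1)] \<X>(3) by blast
  qed
qed

section \<open>The decision procedure and the size of its search space\<close>

definition flat :: "elt list list \<Rightarrow> elt list" where
  "flat X = foldl (\<lambda>acc s. rev s @ acc) [] X"

lemma flat_eq: "flat X = rev (concat X)"
proof -
  have "foldl (\<lambda>acc s. rev s @ acc) ys X = rev (concat X) @ ys" for ys
    by (induction X arbitrary: ys) auto
  then show ?thesis by (simp add: flat_def)
qed

text \<open>The reversals make the lists literally equal to those that the folds of the program
  build, so that its evaluation is described by an equation.\<close>

definition decide :: "nat \<Rightarrow> nat \<Rightarrow> elt list list \<Rightarrow> bool" where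
  "decide d k fam =
    (let F = rev (filter (\<lambda>s. s \<noteq> []) fam); q = (d + 1) * k; W = greedy F
     in q \<le> length W \<or>
      (let b = d * q + 1; K1 = sp_kernel W b (rev (filter internal_list F));
         K2 = sp_kernel (flat K1) b (rev (filter (\<lambda>s. \<not> internal_list s) F))
       in brute_force (rev K1 @ K2) q k))"

lemma owner_count_eq_card: "distinct s \<Longrightarrow> owner_count i s = card {x \<in> set s. snd x = i}"
  unfolding owner_count_def using distinct_card[of "filter (\<lambda>y. snd y = i) s"] by simp

text \<open>Being internal to \<open>j\<close> becomes a statement about counts, which types
  preserve.\<close>

lemma owner_count_full: "owner_count j s = length s \<longleftrightarrow> snd ` set s \<subseteq> {j}"
proof
  assume "owner_count j s = length s"
  then have "filter (\<lambda>y. snd y = j) s = s"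
    unfolding owner_count_def by (metis length_filter_less less_irrefl filter_True)
  then have "\<forall>y\<in>set s. snd y = j" by (simp add: filter_id_conv)
  then show "snd ` set s \<subseteq> {j}" by (simp add: image_subset_iff)
next
  assume "snd ` set s \<subseteq> {j}"
  then have "\<forall>y\<in>set s. snd y = j" by (simp add: image_subset_iff)
  then show "owner_count j s = length s" by (simp add: owner_count_def filter_True)
qed

lemma decide_correct:
  assumes fam: "\<forall>s\<in>set fam. distinct s" "\<forall>s\<in>set fam. length s \<le> d"
  shows "decide d k fam \<longleftrightarrow> solvable snd (set ` set fam) k"
proof -
  define F where "F = rev (filter (\<lambda>s. s \<noteq> []) fam)"
  define q where "q = (d + 1) * k"
  define W where "W = greedy F"
  define \<F> where "\<F> = set ` set F"
  have F: "\<forall>s\<in>set F. distinct s" "\<And>s. s \<in> set F \<Longrightarrow> length s \<le> d" "\<And>s. s \<in> set F \<Longrightarrow> s \<noteq> []"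
    using fam by (auto simp: F_def)
  have "\<F> = set ` set fam - {{}}" by (auto simp: \<F>_def F_def)
  then have red: "solvable snd (set ` set fam) k \<longleftrightarrow> solvable snd \<F> k"
    using solvable_nonempty[of snd "set ` set fam" k] by simp
  have fin: "finite (\<Union>\<F>)" "finite \<F>" and ne: "{} \<notin> \<F>" and card: "\<And>S. S \<in> \<F> \<Longrightarrow> card S \<le> d"
  proof -
    show "finite (\<Union>\<F>)" "finite \<F>" by (auto simp: \<F>_def)
    show "{} \<notin> \<F>" using F(3) by (auto simp: \<F>_def)
    show "card S \<le> d" if S: "S \<in> \<F>" for S
    proof -
      from S obtain s where "s \<in> set F" "S = set s" unfolding \<F>_def by blast
      then show ?thesis using F(2)[of s] card_length[of s] by simp
    qed
  qed
  obtain Y where Y: "Y \<subseteq> \<F>" "disjoint Y" "\<Union>Y = set W" "distinct W"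
    "\<And>s. s \<in> set F \<Longrightarrow> s \<noteq> [] \<Longrightarrow> set s \<inter> set W \<noteq> {}"
    using greedy_packing[OF F(1)] unfolding W_def \<F>_def by blast
  show ?thesis
  proof (cases "q \<le> length W")
    case True
    then have "decide d k fam" unfolding decide_def F_def W_def q_def Let_def by blast
    moreover have "(d + 1) * k \<le> card (\<Union>Y)"
      using True Y(3,4) by (simp add: distinct_card q_def)
    then have "solvable snd \<F> k" using solvable_if_large_packing[OF fin ne card Y(1,2)] by blast
    ultimately show ?thesis using red by simp
  next
    case False
    define l where "l = d * q"
    define F1 where "F1 = rev (filter internal_list F)"
    define F2 where "F2 = rev (filter (\<lambda>s. \<not> internal_list s) F)"
    define K1 where "K1 = sp_kernel W (l + 1) F1"
    define K2 where "K2 = sp_kernel (flat K1) (l + 1) F2"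
    have dec: "decide d k fam \<longleftrightarrow> brute_force (rev K1 @ K2) q k"
      using False unfolding decide_def K2_def K1_def F1_def F2_def l_def F_def W_def q_def Let_def by blast
    have sub: "set K1 \<subseteq> set F1" "set K2 \<subseteq> set F2" "set F1 \<subseteq> set F" "set F2 \<subseteq> set F"
      unfolding K1_def K2_def F1_def F2_def by (auto dest: subsetD[OF set_kernel_subset])
    have F12: "set ` set F1 \<union> set ` set F2 = \<F>" by (auto simp: F1_def F2_def \<F>_def)
    have d1: "\<forall>s\<in>set F1. distinct s" and d2: "\<forall>s\<in>set F2. distinct s" using F(1) sub(3,4) by blast+
    have hit: "S \<inter> set W \<noteq> {}" if S: "S \<in> \<F>" for S
    proof -
      from S obtain s where "s \<in> set F" "S = set s" unfolding \<F>_def by blast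
      then show ?thesis using Y(5)[of s] F(3)[of s] by simp
    qed
    \<comment> \<open>By maximality of the greedy packing every member meets \<open>W\<close>, and
      disjoint sets meeting \<open>W\<close> inject into it. The bound \<open>l = d * q\<close> on
      covered elements follows.\<close>
    have cardX: "finite \<X> \<and> card \<X> \<le> q" if "\<X> \<subseteq> \<F>" "disjoint \<X>" for \<X>
    proof -
      have "finite \<X> \<and> card \<X> \<le> card (set W)"
        by (rule card_disjoint_hitting[OF that(2)]) (use that(1) hit in auto)
      moreover have "card (set W) \<le> length W" by (rule card_length)
      ultimately show ?thesis using False by simp
    qed
    have bound: "card (\<Union>\<X>) \<le> l" if "\<X> \<subseteq> \<F>" "disjoint \<X>" for \<X>
    proof -
      have "card (\<Union>\<X>) \<le> d * card \<X>"
        by (rule card_Union_disjoint_le) (use cardX[OF that] that(1) card in auto)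
      also have "\<dots> \<le> l" unfolding l_def using cardX[OF that] by simp
      finally show ?thesis .
    qed
    have int: "internal_list s \<longleftrightarrow> (\<exists>j. snd ` set s \<subseteq> {j})" if "s \<in> set F" for s
      using internal_list_iff[OF F(3)[OF that]] .
    have len: "length s = card (set s)" if "s \<in> set F" for s
      using F(1) that by (simp add: distinct_card)
    have "solvable snd (set ` set F1 \<union> set ` set F2) k \<longleftrightarrow> solvable snd (set ` set K1 \<union> set ` set F2) k"
    proof (rule solvable_replace_internal[where l = l])
      show "finite (\<Union>(set ` set F1 \<union> set ` set F2))" "finite (set ` set F1 \<union> set ` set F2)"
        unfolding F12 by (rule fin)+
      show "set ` set K1 \<subseteq> set ` set F1" using sub(1) by blast
      show "\<exists>j. snd ` S \<subseteq> {j}" if S: "S \<in> set ` set F1" for S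
      proof -
        from S obtain s where s: "s \<in> set F1" "S = set s" by blast
        then have "s \<in> set F" "internal_list s" by (auto simp: F1_def)
        then show ?thesis using int s(2) by blast
      qed
      show "card (\<Union>X) \<le> l" if "X \<subseteq> set ` set F1 \<union> set ` set F2" "disjoint X" for X
        using bound that unfolding F12 by blast
      show "\<exists>S'\<in>set ` set K1. S' \<inter> Y = {} \<and> card S' = card S \<and>
          (\<forall>j. snd ` S \<subseteq> {j} \<longrightarrow> snd ` S' \<subseteq> {j})"
        if S: "S \<in> set ` set F1" and Y': "finite Y" "card Y \<le> l" "S \<inter> Y = {}" for S Y
      proof -
        from S obtain s where s: "s \<in> set F1" "S = set s" by blast
        then obtain t where t: "t \<in> set K1" "same_type W s t" "set t \<inter> Y = {}"
          using kernel_representative[OF d1 s(1) Y'(1,2)] Y'(3) unfolding K1_def by blast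
        have tF: "t \<in> set F" and sF: "s \<in> set F" using t(1) s(1) sub by blast+
        have st: "length s = length t" using t(2) by (simp add: same_type_def)
        have "snd ` set t \<subseteq> {j}" if j: "snd ` S \<subseteq> {j}" for j
        proof -
          have "S \<in> \<F>" using sF s(2) by (simp add: \<F>_def)
          \<comment> \<open>The common element of \<open>S\<close> and \<open>W\<close> makes the
            type count the owner \<open>j\<close>; this count equals the length of \<open>s\<close>,
            hence also that of \<open>t\<close>.\<close>
          from hit[OF this] obtain x where x: "x \<in> S" "x \<in> set W" by blast
          have "snd x = j" using j x(1) by blast
          then have "owner_count j s = owner_count j t" using t(2) x(2) by (auto simp: same_type_def)
          moreover have "owner_count j s = length s" using j s(2) owner_count_full by simp
          ultimately show ?thesis using st owner_count_full[of j t] by simp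
        qed
        moreover have "card (set t) = card S" using len[OF tF] len[OF sF] st s(2) by simp
        ultimately show ?thesis using t(1,3) by blast
      qed
    qed
    moreover have "solvable snd (set ` set K1 \<union> set ` set F2) k \<longleftrightarrow> solvable snd (set ` set K1 \<union> set ` set K2) k"
    proof (rule solvable_replace_cross[where l = l])
      have G: "set ` set K1 \<union> set ` set F2 \<subseteq> \<F>" using sub unfolding \<F>_def by blast
      show "finite (\<Union>(set ` set K1 \<union> set ` set F2))" "finite (set ` set K1 \<union> set ` set F2)" by auto
      show "set ` set K2 \<subseteq> set ` set F2" using sub(2) by blast
      show "{} \<notin> set ` set K1" using ne G by blast
      show "\<not> snd ` S \<subseteq> {j}" if S: "S \<in> set ` set F2" for S j
      proof -
        from S obtain s where s: "s \<in> set F2" "S = set s" by blast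
        then have "s \<in> set F" "\<not> internal_list s" by (auto simp: F2_def)
        then show ?thesis using int s(2) by blast
      qed
      show "card (\<Union>X) \<le> l" if X: "X \<subseteq> set ` set K1 \<union> set ` set F2" "disjoint X" for X
        by (rule bound[OF _ X(2)]) (use X(1) G in blast)
      have flat: "set (flat K1) = \<Union>(set ` set K1)" by (simp add: flat_eq)
      show "\<exists>S'\<in>set ` set K2. S' \<inter> Y = {} \<and> card S' = card S \<and>
          S' \<inter> \<Union>(set ` set K1) = S \<inter> \<Union>(set ` set K1) \<and>
          (\<forall>i\<in>snd ` \<Union>(set ` set K1). card {x \<in> S'. snd x = i} = card {x \<in> S. snd x = i})"
        if S: "S \<in> set ` set F2" and Y': "finite Y" "card Y \<le> l" "S \<inter> Y = {}" for S Y
      proof -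
        from S obtain s where s: "s \<in> set F2" "S = set s" by blast
        then obtain t where t: "t \<in> set K2" "same_type (flat K1) s t" "set t \<inter> Y = {}"
          using kernel_representative[OF d2 s(1) Y'(1,2)] Y'(3) unfolding K2_def by blast
        have tF: "t \<in> set F" and sF: "s \<in> set F" using t(1) s(1) sub by blast+
        have st: "length s = length t" using t(2) by (simp add: same_type_def)
        have 1: "card (set t) = card S" using len[OF tF] len[OF sF] st s(2) by simp
        have mem: "x \<in> set s \<longleftrightarrow> x \<in> set t" if "x \<in> set (flat K1)" for x
          using t(2) that by (simp add: same_type_def)
        then have 2: "set t \<inter> \<Union>(set ` set K1) = S \<inter> \<Union>(set ` set K1)"
          unfolding flat[symmetric] s(2) by blast
        have 3: "card {x \<in> set t. snd x = i} = card {x \<in> S. snd x = i}"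
          if i: "i \<in> snd ` \<Union>(set ` set K1)" for i
        proof -
          from i obtain x where "x \<in> set (flat K1)" "snd x = i" unfolding flat[symmetric] by blast
          then have "owner_count i s = owner_count i t" using t(2) by (auto simp: same_type_def)
          then show ?thesis using owner_count_eq_card F(1) tF sF s(2) by simp
        qed
        show ?thesis using t(1,3) 1 2 3 by blast
      qed
    qed
    moreover have "brute_force (rev K1 @ K2) q k \<longleftrightarrow> solvable snd (set ` set (rev K1 @ K2)) k"
    proof (rule brute_force_correct)
      have K: "set (rev K1 @ K2) \<subseteq> set F" using sub by auto
      show "\<forall>s\<in>set (rev K1 @ K2). distinct s" "\<forall>s\<in>set (rev K1 @ K2). s \<noteq> []"
        using K F(1,3) by blast+
      show "card \<X> \<le> q" if X: "\<X> \<subseteq> set ` set (rev K1 @ K2)" "disjoint \<X>" for \<X>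
      proof -
        have "\<X> \<subseteq> \<F>" using X(1) K unfolding \<F>_def by blast
        then show ?thesis using cardX X(2) by blast
      qed
    qed
    moreover have "set ` set (rev K1 @ K2) = set ` set K1 \<union> set ` set K2" by auto
    ultimately show ?thesis using dec red F12 by simp
  qed
qed

lemma length_concat_le: "(\<And>s. s \<in> set K \<Longrightarrow> length s \<le> d) \<Longrightarrow> length (concat K) \<le> d * length K"
  by (induction K) (auto simp: add_mono)

text \<open>The factor \<open>(2 * q + 2) ^ d * (d * q + 1) ^ d\<close> bounds the kept internal
  sets, and \<open>d\<close> times it bounds the number of their elements, which enters the bound
  for the cross sets. The summand \<open>2 * q\<close> makes this second bound dominate the first,
  so doubling it covers both.\<close>

lemma length_kernels_le:
  assumes "\<forall>s\<in>set F. distinct s" "\<forall>s\<in>set F. length s \<le> d" and F12: "set F1 \<subseteq> set F" "set F2 \<subseteq> set F"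
    and "length W \<le> q"
  shows "length (rev (sp_kernel W (d * q + 1) F1) @ sp_kernel (flat (sp_kernel W (d * q + 1) F1)) (d * q + 1) F2)
    \<le> 2 * ((2 * d * ((2 * q + 2) ^ d * (d * q + 1) ^ d) + 2 * q + 2) ^ d * (d * q + 1) ^ d)"
proof -
  let ?b = "d * q + 1"
  let ?K1 = "sp_kernel W ?b F1"
  let ?n1 = "(2 * q + 2) ^ d * ?b ^ d"
  have F1: "\<forall>s\<in>set F1. distinct s" "\<forall>s\<in>set F1. length s \<le> d"
    and F2: "\<forall>s\<in>set F2. distinct s" "\<forall>s\<in>set F2. length s \<le> d" using assms(1,2) F12 by blast+
  have "length ?K1 \<le> (2 * length W + 2) ^ d * ?b ^ d" by (rule length_kernel_le[OF F1]) simp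
  also have "\<dots> \<le> ?n1" using assms(5) by (intro mult_le_mono1 power_mono) auto
  finally have K1: "length ?K1 \<le> ?n1" .
  have "length (flat ?K1) \<le> d * length ?K1"
    unfolding flat_eq length_rev by (rule length_concat_le) (use F1(2) set_kernel_subset[of W ?b F1] in blast)
  also have "\<dots> \<le> d * ?n1" using K1 by (rule mult_le_mono2)
  finally have T: "length (flat ?K1) \<le> d * ?n1" .
  have "length (sp_kernel (flat ?K1) ?b F2) \<le> (2 * length (flat ?K1) + 2) ^ d * ?b ^ d"
    by (rule length_kernel_le[OF F2]) simp
  also have "\<dots> \<le> (2 * d * ?n1 + 2 * q + 2) ^ d * ?b ^ d" using T by (intro mult_le_mono1 power_mono) auto
  finally have K2: "length (sp_kernel (flat ?K1) ?b F2) \<le> (2 * d * ?n1 + 2 * q + 2) ^ d * ?b ^ d" .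
  have "?n1 \<le> (2 * d * ?n1 + 2 * q + 2) ^ d * ?b ^ d" by (intro mult_le_mono1 power_mono) auto
  then show ?thesis using K1 K2 unfolding length_append length_rev by linarith
qed

section \<open>Structured programs for the machine\<close>

datatype com =
    Instr instr
  | Seq com com (infixr ";;" 60)
  | IfNZ nat com com
  | WhileNZ nat com

fun clen :: "com \<Rightarrow> nat" where
  "clen (Instr i) = 1"
| "clen (c1 ;; c2) = clen c1 + clen c2"
| "clen (IfNZ a c1 c2) = clen c1 + clen c2 + 2"
| "clen (WhileNZ a c) = clen c + 2"

fun ccomp :: "nat \<Rightarrow> com \<Rightarrow> instr list" where
  "ccomp pc (Instr i) = [i]"
| "ccomp pc (c1 ;; c2) = ccomp pc c1 @ ccomp (pc + clen c1) c2"
| "ccomp pc (IfNZ a c1 c2) =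
     Jump_zero a (pc + clen c1 + 2) # ccomp (pc + 1) c1 @
     Jump (pc + clen c1 + clen c2 + 2) # ccomp (pc + clen c1 + 2) c2"
| "ccomp pc (WhileNZ a c) = Jump_zero a (pc + clen c + 2) # ccomp (pc + 1) c @ [Jump pc]"

lemma length_ccomp [simp]: "length (ccomp pc c) = clen c"
  by (induction c arbitrary: pc) auto

text \<open>Jump targets are absolute, so the code is required to work at every position of every
  surrounding program. The exact number of steps \<open>t'\<close> is fixed before the surroundings,
  and \<open>t\<close> only bounds it.\<close>

definition runs ::
  "com \<Rightarrow> (nat \<Rightarrow> nat) \<times> (nat \<Rightarrow> nat) \<Rightarrow> nat \<Rightarrow> (nat \<Rightarrow> nat) \<times> (nat \<Rightarrow> nat) \<Rightarrow> bool" where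
  "runs c s t s' \<longleftrightarrow> (\<exists>t'\<le>t. \<forall>pre post.
     (step (pre @ ccomp (length pre) c @ post) ^^ t') (length pre, s) = (length pre + clen c, s'))"

lemma runs_mono: "runs c s t s' \<Longrightarrow> t \<le> u \<Longrightarrow> runs c s u s'"
  unfolding runs_def by (meson order_trans)

lemma runs_Instr:
  assumes "\<And>pc. exec i (pc, r, m) = (pc + 1, r', m')"
  shows "runs (Instr i) (r, m) 1 (r', m')"
  unfolding runs_def by (rule exI[of _ 1]) (simp add: assms)

lemma runs_Const: "runs (Instr (Const a c)) (r, m) 1 (r(a := c), m)"
  and runs_Move: "runs (Instr (Move a b)) (r, m) 1 (r(a := r b), m)"
  and runs_Add: "runs (Instr (Add a b b')) (r, m) 1 (r(a := r b + r b'), m)"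
  and runs_Sub: "runs (Instr (Sub a b b')) (r, m) 1 (r(a := r b - r b'), m)"
  and runs_Load: "runs (Instr (Load a b)) (r, m) 1 (r(a := m (r b)), m)"
  and runs_Store: "runs (Instr (Store a b)) (r, m) 1 (r, m(r a := r b))"
  by (rule runs_Instr; simp)+

lemma runs_Seq:
  assumes "runs c1 s t1 s1" "runs c2 s1 t2 s2"
  shows "runs (c1 ;; c2) s (t1 + t2) s2"
proof -
  from assms obtain u1 u2 where u: "u1 \<le> t1" "u2 \<le> t2"
    and 1: "\<And>pre post. (step (pre @ ccomp (length pre) c1 @ post) ^^ u1) (length pre, s)
        = (length pre + clen c1, s1)"
    and 2: "\<And>pre post. (step (pre @ ccomp (length pre) c2 @ post) ^^ u2) (length pre, s1)
        = (length pre + clen c2, s2)"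
    unfolding runs_def by blast
  have "(step (pre @ ccomp (length pre) (c1 ;; c2) @ post) ^^ (u2 + u1)) (length pre, s)
        = (length pre + clen (c1 ;; c2), s2)" for pre post
    using 1[of pre "ccomp (length pre + clen c1) c2 @ post"] 2[of "pre @ ccomp (length pre) c1" post]
    by (simp add: funpow_add add.assoc)
  then show ?thesis using u unfolding runs_def by (intro exI[of _ "u2 + u1"]) auto
qed

lemma step_at:
  assumes "P = pre @ i # post" "n = length pre"
  shows "step P (n, r, m) = exec i (n, r, m)"
  using assms by simp

lemma runs_If_nz:
  assumes "r a \<noteq> 0" "runs c1 (r, m) t s'"
  shows "runs (IfNZ a c1 c2) (r, m) (t + 2) s'"
proof -
  from assms obtain u where u: "u \<le> t"
    and 1: "\<And>pre post. (step (pre @ ccomp (length pre) c1 @ post) ^^ u) (length pre, r, m)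
        = (length pre + clen c1, s')"
    unfolding runs_def by blast
  have "(step (pre @ ccomp (length pre) (IfNZ a c1 c2) @ post) ^^ (1 + (u + 1))) (length pre, r, m)
        = (length pre + clen (IfNZ a c1 c2), s')" (is "(step ?P ^^ _) _ = _") for pre post
  proof -
    let ?n = "length pre"
    have s1: "step ?P (?n, r, m) = (?n + 1, r, m)"
      using assms(1) by (subst step_at[OF _ refl]) auto
    have s2: "(step ?P ^^ u) (?n + 1, r, m) = (?n + 1 + clen c1, s')"
      using 1[of "pre @ [Jump_zero a (?n + clen c1 + 2)]"
        "Jump (?n + clen c1 + clen c2 + 2) # ccomp (?n + clen c1 + 2) c2 @ post"]
      by simp
    have s3: "step ?P (?n + 1 + clen c1, s') = (?n + clen (IfNZ a c1 c2), s')"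
      by (cases s', simp only:)
        (subst step_at[where pre = "pre @ Jump_zero a (?n + clen c1 + 2) # ccomp (?n + 1) c1"], auto)
    show ?thesis using s1 s2 s3 by (simp only: funpow_add o_apply One_nat_def funpow.simps id_apply)
  qed
  then show ?thesis using u unfolding runs_def by (intro exI[of _ "1 + (u + 1)"]) auto
qed

lemma runs_If_z:
  assumes "r a = 0" "runs c2 (r, m) t s'"
  shows "runs (IfNZ a c1 c2) (r, m) (t + 2) s'"
proof -
  from assms obtain u where u: "u \<le> t"
    and 1: "\<And>pre post. (step (pre @ ccomp (length pre) c2 @ post) ^^ u) (length pre, r, m)
        = (length pre + clen c2, s')"
    unfolding runs_def by blast
  have "(step (pre @ ccomp (length pre) (IfNZ a c1 c2) @ post) ^^ (u + 1)) (length pre, r, m)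
        = (length pre + clen (IfNZ a c1 c2), s')" (is "(step ?P ^^ _) _ = _") for pre post
  proof -
    let ?n = "length pre"
    have s1: "step ?P (?n, r, m) = (?n + clen c1 + 2, r, m)"
      using assms(1) by (subst step_at[OF _ refl]) auto
    have s2: "(step ?P ^^ u) (?n + clen c1 + 2, r, m) = (?n + clen (IfNZ a c1 c2), s')"
      using 1[of "pre @ Jump_zero a (?n + clen c1 + 2) # ccomp (?n + 1) c1 @
        [Jump (?n + clen c1 + clen c2 + 2)]" post]
      by (simp add: algebra_simps)
    show ?thesis using s1 s2 by (simp only: funpow_add o_apply One_nat_def funpow.simps id_apply)
  qed
  then show ?thesis using u unfolding runs_def by (intro exI[of _ "u + 1"]) auto
qed

lemma runs_While_z:
  assumes "r a = 0"
  shows "runs (WhileNZ a c) (r, m) 1 (r, m)"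
  unfolding runs_def using assms by (intro exI[of _ 1]) simp

lemma runs_While_nz:
  assumes "r a \<noteq> 0" "runs c (r, m) t1 s1" "runs (WhileNZ a c) s1 t2 s2"
  shows "runs (WhileNZ a c) (r, m) (t1 + t2 + 2) s2"
proof -
  from assms obtain u1 u2 where u: "u1 \<le> t1" "u2 \<le> t2"
    and 1: "\<And>pre post. (step (pre @ ccomp (length pre) c @ post) ^^ u1) (length pre, r, m)
        = (length pre + clen c, s1)"
    and 2: "\<And>pre post. (step (pre @ ccomp (length pre) (WhileNZ a c) @ post) ^^ u2) (length pre, s1)
        = (length pre + clen (WhileNZ a c), s2)"
    unfolding runs_def by blast
  have "(step (pre @ ccomp (length pre) (WhileNZ a c) @ post) ^^ (u2 + (1 + (u1 + 1)))) (length pre, r, m)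
        = (length pre + clen (WhileNZ a c), s2)" (is "(step ?P ^^ _) _ = _") for pre post
  proof -
    let ?n = "length pre"
    have s1: "step ?P (?n, r, m) = (?n + 1, r, m)"
      using assms(1) by (subst step_at[OF _ refl]) auto
    have s2: "(step ?P ^^ u1) (?n + 1, r, m) = (?n + 1 + clen c, s1)"
      using 1[of "pre @ [Jump_zero a (?n + clen c + 2)]" "Jump ?n # post"] by simp
    have s3: "step ?P (?n + 1 + clen c, s1) = (?n, s1)"
      by (cases s1, simp only:)
        (subst step_at[where pre = "pre @ Jump_zero a (?n + clen c + 2) # ccomp (?n + 1) c"], auto)
    show ?thesis using s1 s2 s3 2[of pre post] by (simp only: funpow_add o_apply One_nat_def funpow.simps id_apply)
  qed
  then show ?thesis using u unfolding runs_def by (intro exI[of _ "u2 + (1 + (u1 + 1))"]) auto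
qed

section \<open>Values, expressions, types, loop bounds and code generation\<close>

datatype val = N nat | P val val | L "val list"

datatype ty = TN | TP ty ty | TL ty

fun vty :: "val \<Rightarrow> ty \<Rightarrow> bool" where
  "vty (N n) TN = True"
| "vty (P a b) (TP s t) = (vty a s \<and> vty b t)"
| "vty (L l) (TL t) = (\<forall>x\<in>set l. vty x t)"
| "vty _ _ = False"

text \<open>Projections are total; the results on values of another shape are arbitrary defaults
  that typing keeps from mattering.\<close>

primrec num :: "val \<Rightarrow> nat" where
  "num (N n) = n" | "num (P a b) = 0" | "num (L l) = 0"

primrec vfst :: "val \<Rightarrow> val" where
  "vfst (N n) = N n" | "vfst (P a b) = a" | "vfst (L l) = L l"

primrec vsnd :: "val \<Rightarrow> val" where
  "vsnd (N n) = N n" | "vsnd (P a b) = b" | "vsnd (L l) = L l"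

primrec elems :: "val \<Rightarrow> val list" where
  "elems (N n) = []" | "elems (P a b) = []" | "elems (L l) = l"

text \<open>\<open>EWeak\<close> discards index 0 of the environment. It replaces the shifting of
  indices when an expression is used below a binder.\<close>

datatype expr =
    EVar nat
  | ENum nat
  | EAdd expr expr
  | ESub expr expr
  | EPair expr expr
  | EFst expr
  | ESnd expr
  | ENil ty
  | ECons expr expr
  | EIf expr expr expr
  | ELet expr expr
  | EWeak expr
  | ECase expr expr expr
  | EFold expr expr expr
  | ERep expr expr expr

text \<open>Variables are de Bruijn indices. The body of \<open>EFold\<close> sees the accumulator at index 0 and the
  current element at index 1, the second branch of \<open>ECase\<close> the head at index 0 and the tail at index 1.\<close>

primrec eval :: "expr \<Rightarrow> val list \<Rightarrow> val" where
  "eval (EVar i) env = env ! i"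
| "eval (ENum n) env = N n"
| "eval (EAdd a b) env = N (num (eval a env) + num (eval b env))"
| "eval (ESub a b) env = N (num (eval a env) - num (eval b env))"
| "eval (EPair a b) env = P (eval a env) (eval b env)"
| "eval (EFst e) env = vfst (eval e env)"
| "eval (ESnd e) env = vsnd (eval e env)"
| "eval (ENil t) env = L []"
| "eval (ECons a b) env = L (eval a env # elems (eval b env))"
| "eval (EIf c a b) env = (if num (eval c env) \<noteq> 0 then eval a env else eval b env)"
| "eval (ELet a b) env = eval b (eval a env # env)"
| "eval (EWeak e) env = eval e (tl env)"
| "eval (ECase e a b) env =
     (case elems (eval e env) of [] \<Rightarrow> eval a env | x # xs \<Rightarrow> eval b (x # L xs # env))"
| "eval (EFold l i b) env =
     foldl (\<lambda>acc x. eval b (acc # x # env)) (eval i env) (elems (eval l env))"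
| "eval (ERep n i b) env = ((\<lambda>acc. eval b (acc # env)) ^^ num (eval n env)) (eval i env)"

text \<open>Memory cells carry no tags, so compiled code agrees with \<open>eval\<close> only if
  every operation meets a value of the expected shape; typing guarantees this.\<close>

primrec typeof :: "expr \<Rightarrow> ty list \<Rightarrow> ty option" where
  "typeof (EVar i) \<Gamma> = (if i < length \<Gamma> then Some (\<Gamma> ! i) else None)"
| "typeof (ENum n) \<Gamma> = Some TN"
| "typeof (EAdd a b) \<Gamma> = (if typeof a \<Gamma> = Some TN \<and> typeof b \<Gamma> = Some TN then Some TN else None)"
| "typeof (ESub a b) \<Gamma> = (if typeof a \<Gamma> = Some TN \<and> typeof b \<Gamma> = Some TN then Some TN else None)"
| "typeof (EPair a b) \<Gamma> =
     (case typeof a \<Gamma> of Some s \<Rightarrow> (case typeof b \<Gamma> of Some t \<Rightarrow> Some (TP s t) | _ \<Rightarrow> None) | _ \<Rightarrow> None)"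
| "typeof (EFst e) \<Gamma> = (case typeof e \<Gamma> of Some (TP s t) \<Rightarrow> Some s | _ \<Rightarrow> None)"
| "typeof (ESnd e) \<Gamma> = (case typeof e \<Gamma> of Some (TP s t) \<Rightarrow> Some t | _ \<Rightarrow> None)"
| "typeof (ENil t) \<Gamma> = Some (TL t)"
| "typeof (ECons a b) \<Gamma> =
     (case typeof a \<Gamma> of Some t \<Rightarrow> if typeof b \<Gamma> = Some (TL t) then Some (TL t) else None | _ \<Rightarrow> None)"
| "typeof (EIf c a b) \<Gamma> = (if typeof c \<Gamma> = Some TN \<and> typeof a \<Gamma> = typeof b \<Gamma> then typeof a \<Gamma> else None)"
| "typeof (ELet a b) \<Gamma> = (case typeof a \<Gamma> of Some t \<Rightarrow> typeof b (t # \<Gamma>) | _ \<Rightarrow> None)"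
| "typeof (EWeak e) \<Gamma> = (if \<Gamma> = [] then None else typeof e (tl \<Gamma>))"
| "typeof (ECase e a b) \<Gamma> =
     (case typeof e \<Gamma> of Some (TL t) \<Rightarrow> if typeof a \<Gamma> = typeof b (t # TL t # \<Gamma>) then typeof a \<Gamma> else None
      | _ \<Rightarrow> None)"
| "typeof (EFold l i b) \<Gamma> =
     (case typeof l \<Gamma> of Some (TL t) \<Rightarrow>
       (case typeof i \<Gamma> of Some a \<Rightarrow> if typeof b (a # t # \<Gamma>) = Some a then Some a else None | _ \<Rightarrow> None)
      | _ \<Rightarrow> None)"
| "typeof (ERep n i b) \<Gamma> =
     (if typeof n \<Gamma> = Some TN then
       (case typeof i \<Gamma> of Some a \<Rightarrow> if typeof b (a # \<Gamma>) = Some a then Some a else None | _ \<Rightarrow> None)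
      else None)"

lemma vty_TN: "vty v TN \<Longrightarrow> \<exists>n. v = N n"
  and vty_TP: "vty v (TP s t) \<Longrightarrow> \<exists>a b. v = P a b \<and> vty a s \<and> vty b t"
  and vty_TL: "vty v (TL t) \<Longrightarrow> \<exists>l. v = L l \<and> (\<forall>x\<in>set l. vty x t)"
  by (cases v; simp)+

lemma typeof_EFst: "typeof (EFst e) \<Gamma> = Some t \<Longrightarrow> \<exists>u. typeof e \<Gamma> = Some (TP t u)"
  and typeof_ESnd: "typeof (ESnd e) \<Gamma> = Some t \<Longrightarrow> \<exists>u. typeof e \<Gamma> = Some (TP u t)"
  and typeof_EPair: "typeof (EPair a b) \<Gamma> = Some t \<Longrightarrow>
    \<exists>u v. typeof a \<Gamma> = Some u \<and> typeof b \<Gamma> = Some v \<and> t = TP u v"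
  and typeof_ECons: "typeof (ECons a b) \<Gamma> = Some t \<Longrightarrow>
    \<exists>u. typeof a \<Gamma> = Some u \<and> typeof b \<Gamma> = Some (TL u) \<and> t = TL u"
  and typeof_ELet: "typeof (ELet a b) \<Gamma> = Some t \<Longrightarrow>
    \<exists>u. typeof a \<Gamma> = Some u \<and> typeof b (u # \<Gamma>) = Some t"
  and typeof_ECase: "typeof (ECase e a b) \<Gamma> = Some t \<Longrightarrow>
    \<exists>u. typeof e \<Gamma> = Some (TL u) \<and> typeof a \<Gamma> = Some t \<and> typeof b (u # TL u # \<Gamma>) = Some t"
  and typeof_EFold: "typeof (EFold l i b) \<Gamma> = Some t \<Longrightarrow>
    \<exists>u. typeof l \<Gamma> = Some (TL u) \<and> typeof i \<Gamma> = Some t \<and> typeof b (t # u # \<Gamma>) = Some t"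
  and typeof_ERep: "typeof (ERep l i b) \<Gamma> = Some t \<Longrightarrow>
    typeof l \<Gamma> = Some TN \<and> typeof i \<Gamma> = Some t \<and> typeof b (t # \<Gamma>) = Some t"
  by (auto split: option.splits ty.splits if_splits)

lemma foldl_vty:
  assumes "\<And>a x. vty a s \<Longrightarrow> x \<in> set xs \<Longrightarrow> vty (f a x) s" "vty a s"
  shows "vty (foldl f a xs) s"
  using assms by (induction xs arbitrary: a) auto

lemma funpow_vty:
  assumes "\<And>a. vty a s \<Longrightarrow> vty (f a) s" "vty a s"
  shows "vty ((f ^^ n) a) s"
  using assms by (induction n) auto

lemma typ_sound:
  "typeof e \<Gamma> = Some t \<Longrightarrow> list_all2 vty env \<Gamma> \<Longrightarrow> vty (eval e env) t"
proof (induction e arbitrary: \<Gamma> t env)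
  case (EVar i)
  then show ?case by (auto simp: list_all2_conv_all_nth split: if_splits)
next
  case (EPair a b)
  from typeof_EPair[OF EPair.prems(1)] obtain u v where u: "typeof a \<Gamma> = Some u" "typeof b \<Gamma> = Some v" "t = TP u v" by blast
  from EPair.IH(1)[OF u(1) EPair.prems(2)] EPair.IH(2)[OF u(2) EPair.prems(2)] u(3)
  show ?case by simp
next
  case (EFst e)
  from typeof_EFst[OF EFst.prems(1)] obtain u where u: "typeof e \<Gamma> = Some (TP t u)" by blast
  from vty_TP[OF EFst.IH[OF u EFst.prems(2)]] obtain v w where
    "eval e env = P v w" "vty v t" "vty w u" by blast
  then show ?case by simp
next
  case (ESnd e)
  from typeof_ESnd[OF ESnd.prems(1)] obtain u where u: "typeof e \<Gamma> = Some (TP u t)" by blast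
  from vty_TP[OF ESnd.IH[OF u ESnd.prems(2)]] obtain v w where
    "eval e env = P v w" "vty v u" "vty w t" by blast
  then show ?case by simp
next
  case (ECons a b)
  from typeof_ECons[OF ECons.prems(1)] obtain u where u: "typeof a \<Gamma> = Some u" "typeof b \<Gamma> = Some (TL u)" "t = TL u" by blast
  from vty_TL[OF ECons.IH(2)[OF u(2) ECons.prems(2)]] obtain l where
    "eval b env = L l" "\<forall>x\<in>set l. vty x u" by blast
  with ECons.IH(1)[OF u(1) ECons.prems(2)] u(3) show ?case by simp
next
  case (ELet a b)
  from typeof_ELet[OF ELet.prems(1)] obtain u where u: "typeof a \<Gamma> = Some u" "typeof b (u # \<Gamma>) = Some t" by blast
  show ?case unfolding eval.simps
    by (rule ELet.IH(2)[OF u(2)]) (use ELet.IH(1)[OF u(1)] ELet.prems(2) in simp)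
next
  case (EWeak e)
  from EWeak.prems(1) have "typeof e (tl \<Gamma>) = Some t" by (simp split: if_splits)
  from EWeak.IH[OF this] EWeak.prems(2) show ?case
    by (cases env; cases \<Gamma>) simp_all
next
  case (ECase e a b)
  from typeof_ECase[OF ECase.prems(1)] obtain u where u: "typeof e \<Gamma> = Some (TL u)" "typeof a \<Gamma> = Some t"
      "typeof b (u # TL u # \<Gamma>) = Some t" by blast
  from ECase.IH(1)[OF u(1) ECase.prems(2)] obtain l where l: "eval e env = L l" "\<forall>x\<in>set l. vty x u"
    by (auto dest: vty_TL)
  show ?case
  proof (cases l)
    case Nil
    then show ?thesis using l ECase.IH(2)[OF u(2) ECase.prems(2)] by simp
  next
    case (Cons x xs)
    then have "vty (eval b (x # L xs # env)) t"
      by (intro ECase.IH(3)[OF u(3)]) (use l ECase.prems(2) in simp)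
    then show ?thesis using l Cons by simp
  qed
next
  case (EFold l i b)
  from typeof_EFold[OF EFold.prems(1)] obtain u where u: "typeof l \<Gamma> = Some (TL u)" "typeof i \<Gamma> = Some t"
      "typeof b (t # u # \<Gamma>) = Some t" by blast
  from EFold.IH(1)[OF u(1) EFold.prems(2)] obtain xs where xs: "eval l env = L xs" "\<forall>x\<in>set xs. vty x u"
    by (auto dest: vty_TL)
  show ?case unfolding eval.simps
  proof (rule foldl_vty)
    show "vty (eval i env) t" by (rule EFold.IH(2)[OF u(2) EFold.prems(2)])
    show "vty (eval b (a # x # env)) t" if "vty a t" "x \<in> set (elems (eval l env))" for a x
      by (rule EFold.IH(3)[OF u(3)]) (use that xs EFold.prems(2) in simp)
  qed
next
  case (ERep n i b)
  from typeof_ERep[OF ERep.prems(1)] have u: "typeof n \<Gamma> = Some TN" "typeof i \<Gamma> = Some t"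
      "typeof b (t # \<Gamma>) = Some t" by blast+
  show ?case unfolding eval.simps
  proof (rule funpow_vty)
    show "vty (eval i env) t" by (rule ERep.IH(2)[OF u(2) ERep.prems(2)])
    show "vty (eval b (a # env)) t" if "vty a t" for a
      by (rule ERep.IH(3)[OF u(3)]) (use that ERep.prems(2) in simp)
  qed
next
  case (EIf c a b)
  from EIf.prems(1) have "typeof a \<Gamma> = Some t" "typeof b \<Gamma> = Some t"
    by (auto split: if_splits)
  from EIf.IH(2)[OF this(1) EIf.prems(2)] EIf.IH(3)[OF this(2) EIf.prems(2)]
  show ?case by simp
qed (simp_all split: if_splits, auto)

text \<open>\<open>g\<close> is asserted only at the accumulators that the fold actually passes
  through, because loop bounds inside the body depend on these intermediate values.\<close>

primrec fold_ok :: "(val \<Rightarrow> val \<Rightarrow> val) \<Rightarrow> (val \<Rightarrow> val \<Rightarrow> bool) \<Rightarrow> val list \<Rightarrow> val \<Rightarrow> bool" where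
  "fold_ok f g [] a = True"
| "fold_ok f g (x # xs) a = (g a x \<and> fold_ok f g xs (f a x))"

text \<open>Every loop entered while evaluating the expression makes at most \<open>M\<close> iterations.\<close>

primrec bnd :: "nat \<Rightarrow> expr \<Rightarrow> val list \<Rightarrow> bool" where
  "bnd M (EVar i) env = True"
| "bnd M (ENum n) env = True"
| "bnd M (EAdd a b) env = (bnd M a env \<and> bnd M b env)"
| "bnd M (ESub a b) env = (bnd M a env \<and> bnd M b env)"
| "bnd M (EPair a b) env = (bnd M a env \<and> bnd M b env)"
| "bnd M (EFst e) env = bnd M e env"
| "bnd M (ESnd e) env = bnd M e env"
| "bnd M (ENil t) env = True"
| "bnd M (ECons a b) env = (bnd M a env \<and> bnd M b env)"
| "bnd M (EIf c a b) env =
     (bnd M c env \<and> (if num (eval c env) \<noteq> 0 then bnd M a env else bnd M b env))"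
| "bnd M (ELet a b) env = (bnd M a env \<and> bnd M b (eval a env # env))"
| "bnd M (EWeak e) env = bnd M e (tl env)"
| "bnd M (ECase e a b) env =
     (bnd M e env \<and>
      (case elems (eval e env) of [] \<Rightarrow> bnd M a env | x # xs \<Rightarrow> bnd M b (x # L xs # env)))"
| "bnd M (EFold l i b) env =
     (bnd M l env \<and> bnd M i env \<and> length (elems (eval l env)) \<le> M \<and>
      fold_ok (\<lambda>acc x. eval b (acc # x # env)) (\<lambda>acc x. bnd M b (acc # x # env))
        (elems (eval l env)) (eval i env))"
| "bnd M (ERep n i b) env =
     (bnd M n env \<and> bnd M i env \<and> num (eval n env) \<le> M \<and>
      (\<forall>j<num (eval n env). bnd M b (((\<lambda>acc. eval b (acc # env)) ^^ j) (eval i env) # env)))"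

text \<open>Register 1 is the heap pointer, register 2 holds the constant 1, register 0 is reserved for the
  output. \<open>compile e rs D\<close> expects the variables in the registers \<open>rs\<close>, puts the value into
  register \<open>D\<close> and preserves all registers below \<open>D\<close> other than the heap pointer.\<close>

abbreviation alloc :: "nat \<Rightarrow> nat \<Rightarrow> com" where
  "alloc a b \<equiv> Instr (Store 1 a) ;; Instr (Move a 1) ;; Instr (Add 1 1 2) ;; Instr (Store 1 b) ;;
     Instr (Add 1 1 2)"

primrec compile :: "expr \<Rightarrow> nat list \<Rightarrow> nat \<Rightarrow> com" where
  "compile (EVar i) rs D = Instr (Move D (rs ! i))"
| "compile (ENum n) rs D = Instr (Const D n)"
| "compile (EAdd a b) rs D = compile a rs D ;; compile b rs (D + 1) ;; Instr (Add D D (D + 1))"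
| "compile (ESub a b) rs D = compile a rs D ;; compile b rs (D + 1) ;; Instr (Sub D D (D + 1))"
| "compile (EPair a b) rs D = compile a rs D ;; compile b rs (D + 1) ;; alloc D (D + 1)"
| "compile (EFst e) rs D = compile e rs D ;; Instr (Load D D)"
| "compile (ESnd e) rs D = compile e rs D ;; Instr (Add D D 2) ;; Instr (Load D D)"
| "compile (ENil t) rs D = Instr (Const D 0)"
| "compile (ECons a b) rs D = compile a rs D ;; compile b rs (D + 1) ;; alloc D (D + 1)"
| "compile (EIf c a b) rs D = compile c rs D ;; IfNZ D (compile a rs D) (compile b rs D)"
| "compile (ELet a b) rs D =
     compile a rs D ;; compile b (D # rs) (D + 1) ;; Instr (Move D (D + 1))"
| "compile (EWeak e) rs D = compile e (tl rs) D"
| "compile (ECase e a b) rs D = compile e rs D ;;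
     IfNZ D (Instr (Load (D + 1) D) ;; Instr (Add D D 2) ;; Instr (Load D D) ;;
             compile b ((D + 1) # D # rs) (D + 2) ;; Instr (Move D (D + 2)))
       (compile a rs D)"
| "compile (EFold l i b) rs D = compile l rs D ;; compile i rs (D + 1) ;;
     WhileNZ D (Instr (Load (D + 2) D) ;; compile b ((D + 1) # (D + 2) # rs) (D + 3) ;;
       Instr (Move (D + 1) (D + 3)) ;; Instr (Add D D 2) ;; Instr (Load D D)) ;;
     Instr (Move D (D + 1))"
| "compile (ERep n i b) rs D = compile n rs D ;; compile i rs (D + 1) ;;
     WhileNZ D (compile b ((D + 1) # rs) (D + 2) ;; Instr (Move (D + 1) (D + 2)) ;;
       Instr (Sub D D 2)) ;;
     Instr (Move D (D + 1))"

text \<open>The constants count instructions around the subexpressions: 5 for an allocation, and 6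
  or 4 per loop iteration including the test and the jump back. Branches are added instead of
  maximised.\<close>

primrec time_bound :: "nat \<Rightarrow> expr \<Rightarrow> nat" where
  "time_bound M (EVar i) = 1"
| "time_bound M (ENum n) = 1"
| "time_bound M (EAdd a b) = time_bound M a + time_bound M b + 1"
| "time_bound M (ESub a b) = time_bound M a + time_bound M b + 1"
| "time_bound M (EPair a b) = time_bound M a + time_bound M b + 5"
| "time_bound M (EFst e) = time_bound M e + 1"
| "time_bound M (ESnd e) = time_bound M e + 2"
| "time_bound M (ENil t) = 1"
| "time_bound M (ECons a b) = time_bound M a + time_bound M b + 5"
| "time_bound M (EIf c a b) = time_bound M c + (time_bound M a + time_bound M b) + 2"
| "time_bound M (ELet a b) = time_bound M a + time_bound M b + 1"
| "time_bound M (EWeak e) = time_bound M e"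
| "time_bound M (ECase e a b) = time_bound M e + (time_bound M a + time_bound M b) + 6"
| "time_bound M (EFold l i b) = time_bound M l + time_bound M i + M * (time_bound M b + 6) + 2"
| "time_bound M (ERep n i b) = time_bound M n + time_bound M i + M * (time_bound M b + 4) + 2"

text \<open>The nesting depth of loops in a fixed expression is fixed, and each level costs one
  factor \<open>M\<close>. With \<open>M \<ge> 1\<close> lower powers are absorbed by higher
  ones.\<close>

lemma time_bound_poly: "\<exists>C c. \<forall>M\<ge>1. time_bound M e \<le> C * M ^ c"
proof -
  have sum: "\<exists>C c. \<forall>M\<ge>1. f M + g M + k \<le> C * M ^ c"
    if f: "\<exists>C c. \<forall>M\<ge>1. f M \<le> C * M ^ c" and g: "\<exists>C c. \<forall>M\<ge>1. g M \<le> C * M ^ c"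
    for f g :: "nat \<Rightarrow> nat" and k
  proof -
    from f g obtain C c C' c' where 1: "\<forall>M\<ge>1. f M \<le> C * M ^ c" "\<forall>M\<ge>1. g M \<le> C' * M ^ c'" by blast
    have "f M + g M + k \<le> (C + C' + k) * M ^ (c + c')" if M: "M \<ge> 1" for M
    proof -
      have "f M \<le> C * M ^ (c + c')"
        using 1(1) M by (meson le_add1 le_trans mult_le_mono2 power_increasing)
      moreover have "g M \<le> C' * M ^ (c + c')"
        using 1(2) M by (meson le_add2 le_trans mult_le_mono2 power_increasing)
      moreover have "k * 1 \<le> k * M ^ (c + c')" using M by (intro mult_le_mono2) simp
      ultimately show ?thesis unfolding distrib_right by linarith
    qed
    then show ?thesis by blast
  qed
  have zero: "\<exists>C c. \<forall>M\<ge>1. (0::nat) \<le> C * M ^ c" by simp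
  have loop: "\<exists>C c. \<forall>M\<ge>1. M * (f M + k) \<le> C * M ^ c"
    if f: "\<exists>C c. \<forall>M\<ge>1. f M \<le> C * M ^ c" for f :: "nat \<Rightarrow> nat" and k
  proof -
    from sum[OF f zero, of k] obtain C c where "\<forall>M\<ge>1. f M + k \<le> C * M ^ c" by auto
    then have "\<forall>M\<ge>1. M * (f M + k) \<le> C * M ^ Suc c"
      by (simp add: mult.left_commute)
    then show ?thesis by blast
  qed
  show ?thesis
  proof (induction e)
    case (EFst e) from sum[OF this zero, of 1] show ?case by simp
  next
    case (ESnd e) from sum[OF this zero, of 2] show ?case by simp
  next
    case (EFold l i b)
    from sum[OF sum[OF EFold(1,2), of 0] loop[OF EFold(3), of 6], of 2] show ?case by (simp add: add.assoc)
  next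
    case (ERep l i b)
    from sum[OF sum[OF ERep(1,2), of 0] loop[OF ERep(3), of 4], of 2] show ?case by (simp add: add.assoc)
  next
    case (EIf c a b)
    from sum[OF EIf(1) sum[OF EIf(2,3), of 0], of 2] show ?case by simp
  next
    case (ECase c a b)
    from sum[OF ECase(1) sum[OF ECase(2,3), of 0], of 6] show ?case by simp
  next
    case (EAdd a b) from sum[OF this, of 1] show ?case by simp
  next
    case (ESub a b) from sum[OF this, of 1] show ?case by simp
  next
    case (EPair a b) from sum[OF this, of 5] show ?case by simp
  next
    case (ECons a b) from sum[OF this, of 5] show ?case by simp
  next
    case (ELet a b) from sum[OF this, of 1] show ?case by simp
  next
    case (EVar i) show ?case by (rule exI[of _ 1], rule exI[of _ 0]) simp
  next
    case (ENum i) show ?case by (rule exI[of _ 1], rule exI[of _ 0]) simp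
  next
    case (ENil i) show ?case by (rule exI[of _ 1], rule exI[of _ 0]) simp
  qed simp
qed

section \<open>A list language and its compiler\<close>

text \<open>Numbers are stored directly; pairs and list cells are two consecutive cells below the
  heap pointer \<open>h\<close>, and address 0 is reserved for the empty list. Sharing is allowed,
  as cells below \<open>h\<close> are never changed.\<close>

function rep :: "(nat \<Rightarrow> nat) \<Rightarrow> nat \<Rightarrow> nat \<Rightarrow> val \<Rightarrow> bool" where
  "rep m h x (N n) \<longleftrightarrow> x = n"
| "rep m h x (P a b) \<longleftrightarrow> x + 1 < h \<and> rep m h (m x) a \<and> rep m h (m (x + 1)) b"
| "rep m h x (L []) \<longleftrightarrow> x = 0"
| "rep m h x (L (a # l)) \<longleftrightarrow> x \<noteq> 0 \<and> x + 1 < h \<and> rep m h (m x) a \<and> rep m h (m (x + 1)) (L l)"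
  by pat_completeness auto
termination by (relation "measure (\<lambda>(m, h, x, v). size v)") auto

lemma rep_mono:
  assumes "rep m h x v" "h \<le> h'" "\<And>a. a < h \<Longrightarrow> m' a = m a"
  shows "rep m' h' x v"
  using assms by (induction m h x v rule: rep.induct) auto

text \<open>The frame condition of compiled code: values represented before it runs stay represented
  afterwards.\<close>

definition extends :: "nat \<Rightarrow> (nat \<Rightarrow> nat) \<times> (nat \<Rightarrow> nat) \<Rightarrow> (nat \<Rightarrow> nat) \<times> (nat \<Rightarrow> nat) \<Rightarrow> bool" where
  "extends D = (\<lambda>(r, m) (r', m').
     r 1 \<le> r' 1 \<and> (\<forall>a<r 1. m' a = m a) \<and> (\<forall>x<D. x \<noteq> 1 \<longrightarrow> r' x = r x))"

lemma extends_refl: "extends D s s"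
  by (auto simp: extends_def split: prod.splits)

lemma extends_trans:
  "extends D s s' \<Longrightarrow> extends D' s' s'' \<Longrightarrow> D \<le> D' \<Longrightarrow> extends D s s''"
  by (force simp: extends_def split: prod.splits)

lemma extends_upd: "D \<le> x \<Longrightarrow> 1 < x \<Longrightarrow> extends D (r, m) (r(x := v), m)"
  by (auto simp: extends_def)

lemma extends_upd': "extends D s (r, m) \<Longrightarrow> D \<le> x \<Longrightarrow> 1 < x \<Longrightarrow> extends D s (r(x := v), m)"
  by (erule extends_trans[OF _ extends_upd]) auto

lemma extends_reg: "extends D (r, m) (r', m') \<Longrightarrow> x < D \<Longrightarrow> x \<noteq> 1 \<Longrightarrow> r' x = r x"
  by (auto simp: extends_def)

lemma extends_heap: "extends D (r, m) (r', m') \<Longrightarrow> r 1 \<le> r' 1"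
  by (auto simp: extends_def)

lemma extends_rep: "extends D (r, m) (r', m') \<Longrightarrow> rep m (r 1) x v \<Longrightarrow> rep m' (r' 1) x v"
  by (erule rep_mono) (auto simp: extends_def)

definition env_rep :: "(nat \<Rightarrow> nat) \<Rightarrow> (nat \<Rightarrow> nat) \<Rightarrow> nat list \<Rightarrow> val list \<Rightarrow> bool" where
  "env_rep r m rs env \<longleftrightarrow> list_all2 (\<lambda>x v. rep m (r 1) (r x) v) rs env"

lemma env_rep_Cons [simp]:
  "env_rep r m (x # rs) (v # env) \<longleftrightarrow> rep m (r 1) (r x) v \<and> env_rep r m rs env"
  by (simp add: env_rep_def)

lemma env_rep_extends:
  assumes "extends D (r, m) (r', m')" "env_rep r m rs env" "set rs \<subseteq> {3..<D}"
  shows "env_rep r' m' rs env"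
  using assms(2,3) unfolding env_rep_def
proof (induction rule: list_all2_induct)
  case (Cons x xs v vs)
  have "r' x = r x" using extends_reg[OF assms(1), of x] Cons.prems by auto
  then show ?case using Cons extends_rep[OF assms(1)] by auto
qed simp

text \<open>Pairs and list cells have the same layout, so one allocation serves both. Only the list
  cell needs a nonzero address, which a positive heap pointer provides.\<close>

lemma runs_alloc:
  assumes "r 2 = 1" "0 < r 1" "3 \<le> D"
    and a: "rep m (r 1) (r D) a" and b: "rep m (r 1) (r (D + 1)) b"
  obtains r' m' where "runs (alloc D (D + 1)) (r, m) 5 (r', m')" "extends D (r, m) (r', m')"
    "rep m' (r' 1) (r' D) (P a b)" "\<And>l. b = L l \<Longrightarrow> rep m' (r' 1) (r' D) (L (a # l))"
proof -
  let ?h = "r 1"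
  let ?m = "m(?h := r D, ?h + 1 := r (D + 1))"
  let ?r = "r(D := ?h, 1 := ?h + 2)"
  have "runs (alloc D (D + 1)) (r, m) (1 + (1 + (1 + (1 + 1)))) (?r, ?m)"
  proof (intro runs_Seq)
    show "runs (Instr (Store 1 D)) (r, m) 1 (r, m(?h := r D))" by (rule runs_Store)
    show "runs (Instr (Move D 1)) (r, m(?h := r D)) 1 (r(D := ?h), m(?h := r D))" by (rule runs_Move)
    have "runs (Instr (Add 1 1 2)) (r(D := ?h), m(?h := r D)) 1
      ((r(D := ?h))(1 := (r(D := ?h)) 1 + (r(D := ?h)) 2), m(?h := r D))" by (rule runs_Add)
    then show "runs (Instr (Add 1 1 2)) (r(D := ?h), m(?h := r D)) 1
      (r(D := ?h, 1 := ?h + 1), m(?h := r D))" using assms(1,3) by simp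
    have "runs (Instr (Store 1 (D + 1))) (r(D := ?h, 1 := ?h + 1), m(?h := r D)) 1
      (r(D := ?h, 1 := ?h + 1), (m(?h := r D))((r(D := ?h, 1 := ?h + 1)) 1 := (r(D := ?h, 1 := ?h + 1)) (D + 1)))"
      by (rule runs_Store)
    then show "runs (Instr (Store 1 (D + 1))) (r(D := ?h, 1 := ?h + 1), m(?h := r D)) 1
      (r(D := ?h, 1 := ?h + 1), ?m)" using assms(3) by simp
    have "runs (Instr (Add 1 1 2)) (r(D := ?h, 1 := ?h + 1), ?m) 1
      ((r(D := ?h, 1 := ?h + 1))(1 := (r(D := ?h, 1 := ?h + 1)) 1 + (r(D := ?h, 1 := ?h + 1)) 2), ?m)"
      by (rule runs_Add)
    then show "runs (Instr (Add 1 1 2)) (r(D := ?h, 1 := ?h + 1), ?m) 1 (?r, ?m)"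
      using assms(1,3) by simp
  qed
  then have 1: "runs (alloc D (D + 1)) (r, m) 5 (?r, ?m)" by (rule runs_mono) simp
  have 2: "extends D (r, m) (?r, ?m)" by (auto simp: extends_def)
  have a': "rep ?m (?r 1) (r D) a" and b': "rep ?m (?r 1) (r (D + 1)) b"
    using extends_rep[OF 2] a b by blast+
  have 3: "rep ?m (?r 1) (?r D) (P a b)" using a' b' assms(3) by simp
  have 4: "rep ?m (?r 1) (?r D) (L (a # l))" if "b = L l" for l
    using a' b' assms(2,3) that by simp
  show thesis by (rule that[OF 1 2 3 4])
qed

lemma runs_Seq':
  assumes "runs c1 s t1 s1" "runs c2 s1 t2 s2" "t1 + t2 \<le> t"
  shows "runs (c1 ;; c2) s t s2"
  using runs_mono[OF runs_Seq[OF assms(1,2)] assms(3)] .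

lemma compiledI:
  assumes "runs c s t (r, m)" "extends D s (r, m)" "rep m (r 1) (r D) v"
  shows "\<exists>r' m'. runs c s t (r', m') \<and> extends D s (r', m') \<and> rep m' (r' 1) (r' D) v"
  using assms by blast

text \<open>Common to all binary operations: the second operand is computed into register
  \<open>D + 1\<close>, so the first survives in register \<open>D\<close> by the frame
  condition.\<close>

lemma runs_two:
  assumes "\<exists>r' m'. runs ca (r, m) ta (r', m') \<and> extends D (r, m) (r', m') \<and> rep m' (r' 1) (r' D) va"
    and "\<And>r m rs D. r 2 = 1 \<Longrightarrow> 0 < r 1 \<Longrightarrow> env_rep r m rs env \<Longrightarrow> set rs \<subseteq> {3..<D} \<Longrightarrow> 3 \<le> D \<Longrightarrow>
      \<exists>r' m'. runs (cb rs D) (r, m) tb (r', m') \<and> extends D (r, m) (r', m') \<and> rep m' (r' 1) (r' D) vb"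
    and "r 2 = 1" "0 < r 1" "env_rep r m rs env" "set rs \<subseteq> {3..<D}" "3 \<le> D"
  obtains r1 m1 r2 m2 where "runs ca (r, m) ta (r1, m1)" "runs (cb rs (D + 1)) (r1, m1) tb (r2, m2)"
    "extends D (r, m) (r2, m2)" "rep m2 (r2 1) (r2 D) va" "rep m2 (r2 1) (r2 (D + 1)) vb"
proof -
  from assms(1) obtain r1 m1 where
    1: "runs ca (r, m) ta (r1, m1)" "extends D (r, m) (r1, m1)" "rep m1 (r1 1) (r1 D) va" by blast
  have r1: "r1 2 = 1" "0 < r1 1"
    using extends_reg[OF 1(2), of 2] extends_heap[OF 1(2)] assms(3,4,7) by auto
  have "set rs \<subseteq> {3..<D + 1}" "3 \<le> D + 1" using assms(6,7) by auto
  from assms(2)[OF r1 env_rep_extends[OF 1(2) assms(5,6)] this] obtain r2 m2 where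
    2: "runs (cb rs (D + 1)) (r1, m1) tb (r2, m2)" "extends (D + 1) (r1, m1) (r2, m2)"
      "rep m2 (r2 1) (r2 (D + 1)) vb" by blast
  have "r2 D = r1 D" using extends_reg[OF 2(2), of D] assms(7) by simp
  then have "rep m2 (r2 1) (r2 D) va" using extends_rep[OF 2(2) 1(3)] by simp
  then show thesis by (intro that[OF 1(1) 2(1) _ _ 2(3)] extends_trans[OF 1(2) 2(2)]) simp_all
qed

text \<open>Variables live in registers from 3 up to \<open>D - 1\<close>, hence they are not
  overwritten. The time depends on the run only through the iteration bound
  \<open>M\<close>.\<close>

lemma compile_correct:
  assumes "typeof e \<Gamma> = Some \<tau>" "list_all2 vty env \<Gamma>" "bnd M e env"
    and "r 2 = 1" "0 < r 1" "env_rep r m rs env" "set rs \<subseteq> {3..<D}" "3 \<le> D"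
  shows "\<exists>r' m'. runs (compile e rs D) (r, m) (time_bound M e) (r', m') \<and>
    extends D (r, m) (r', m') \<and> rep m' (r' 1) (r' D) (eval e env)"
  using assms
proof (induction e arbitrary: \<Gamma> \<tau> env r m rs D)
  case (EVar i)
  have "i < length rs" "rep m (r 1) (r (rs ! i)) (env ! i)"
    using EVar by (auto simp: env_rep_def list_all2_conv_all_nth split: if_splits)
  then show ?case using EVar.prems(8) runs_Move[of D "rs ! i" r m]
    by - (rule compiledI[where r = "r(D := r (rs ! i))" and m = m], simp_all add: extends_upd)
next
  case (ENum n)
  then show ?case using runs_Const[of D n r m]
    by - (rule compiledI[where r = "r(D := n)" and m = m], simp_all add: extends_upd)
next
  case (ENil n)
  then show ?case using runs_Const[of D 0 r m]
    by - (rule compiledI[where r = "r(D := 0)" and m = m], simp_all add: extends_upd)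
next
  case (EWeak e)
  have "typeof e (tl \<Gamma>) = Some \<tau>" using EWeak.prems(1) by (simp split: if_splits)
  moreover have "list_all2 vty (tl env) (tl \<Gamma>)" using EWeak.prems(2) by (cases env; cases \<Gamma>) simp_all
  moreover have "env_rep r m (tl rs) (tl env)" using EWeak.prems(6)
    by (cases env; cases rs) (simp_all add: env_rep_def)
  moreover have "set (tl rs) \<subseteq> {3..<D}" using EWeak.prems(7) by (cases rs) auto
  ultimately show ?case using EWeak.IH[of "tl \<Gamma>" \<tau> "tl env" r m "tl rs" D] EWeak.prems by simp
next
  case (EFst e)
  obtain u where u: "typeof e \<Gamma> = Some (TP \<tau> u)" using typeof_EFst[OF EFst.prems(1)] by blast
  obtain a b where ab: "eval e env = P a b"
    using vty_TP[OF typ_sound[OF u EFst.prems(2)]] by blast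
  have bnd: "bnd M e env" using EFst.prems(3) by simp
  from EFst.IH[OF u EFst.prems(2) bnd EFst.prems(4-8)] obtain r1 m1 where
    1: "runs (compile e rs D) (r, m) (time_bound M e) (r1, m1)" "extends D (r, m) (r1, m1)"
      "rep m1 (r1 1) (r1 D) (P a b)" unfolding ab by blast
  have "runs (compile (EFst e) rs D) (r, m) (time_bound M (EFst e)) (r1(D := m1 (r1 D)), m1)"
    using runs_Seq[OF 1(1) runs_Load[of D D r1 m1]] by simp
  then show ?case using extends_upd'[OF 1(2), of D] 1(3) EFst.prems(8) ab
    by - (rule compiledI[where r = "r1(D := m1 (r1 D))" and m = m1], simp_all)
next
  case (ESnd e)
  obtain u where u: "typeof e \<Gamma> = Some (TP u \<tau>)" using typeof_ESnd[OF ESnd.prems(1)] by blast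
  obtain a b where ab: "eval e env = P a b"
    using vty_TP[OF typ_sound[OF u ESnd.prems(2)]] by blast
  have bnd: "bnd M e env" using ESnd.prems(3) by simp
  from ESnd.IH[OF u ESnd.prems(2) bnd ESnd.prems(4-8)] obtain r1 m1 where
    1: "runs (compile e rs D) (r, m) (time_bound M e) (r1, m1)" "extends D (r, m) (r1, m1)"
      "rep m1 (r1 1) (r1 D) (P a b)" unfolding ab by blast
  have r2: "r1 2 = 1" using extends_reg[OF 1(2), of 2] ESnd.prems(4,8) by simp
  have "runs (compile (ESnd e) rs D) (r, m) (time_bound M (ESnd e))
      (r1(D := m1 (r1 D + 1)), m1)"
    using runs_Seq[OF 1(1) runs_Seq[OF runs_Add[of D D 2 r1 m1] runs_Load[of D D _ m1]]] r2 by simp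
  then show ?case using extends_upd'[OF 1(2), of D] 1(3) ESnd.prems(8) ab
    by - (rule compiledI[where r = "r1(D := m1 (r1 D + 1))" and m = m1], simp_all)
next
  case (EIf c a b)
  have t: "typeof c \<Gamma> = Some TN" "typeof a \<Gamma> = Some \<tau>" "typeof b \<Gamma> = Some \<tau>"
    using EIf.prems(1) by (auto split: if_splits)
  obtain n where n: "eval c env = N n" using vty_TN[OF typ_sound[OF t(1) EIf.prems(2)]] by blast
  have bnd: "bnd M c env" using EIf.prems(3) by simp
  from EIf.IH(1)[OF t(1) EIf.prems(2) bnd EIf.prems(4-8)] obtain r1 m1 where
    1: "runs (compile c rs D) (r, m) (time_bound M c) (r1, m1)" "extends D (r, m) (r1, m1)"
      "r1 D = n" unfolding n by auto
  have r1: "r1 2 = 1" "0 < r1 1"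
    using extends_reg[OF 1(2), of 2] extends_heap[OF 1(2)] EIf.prems(4,5,8) by auto
  note e1 = env_rep_extends[OF 1(2) EIf.prems(6,7)]
  show ?case
  proof (cases "n = 0")
    case True
    then have bnd: "bnd M b env" using EIf.prems(3) n by simp
    from EIf.IH(3)[OF t(3) EIf.prems(2) bnd r1 e1 EIf.prems(7,8)] obtain r2 m2 where
      2: "runs (compile b rs D) (r1, m1) (time_bound M b) (r2, m2)" "extends D (r1, m1) (r2, m2)"
      "rep m2 (r2 1) (r2 D) (eval b env)" by blast
    have "runs (compile (EIf c a b) rs D) (r, m) (time_bound M (EIf c a b)) (r2, m2)"
      unfolding compile.simps
      by (rule runs_Seq'[OF 1(1) runs_If_z[OF _ 2(1)]]) (use True 1(3) in simp_all)
    then show ?thesis using extends_trans[OF 1(2) 2(2)] 2(3) n True by auto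
  next
    case False
    then have bnd: "bnd M a env" using EIf.prems(3) n by simp
    from EIf.IH(2)[OF t(2) EIf.prems(2) bnd r1 e1 EIf.prems(7,8)] obtain r2 m2 where
      2: "runs (compile a rs D) (r1, m1) (time_bound M a) (r2, m2)" "extends D (r1, m1) (r2, m2)"
      "rep m2 (r2 1) (r2 D) (eval a env)" by blast
    have "runs (compile (EIf c a b) rs D) (r, m) (time_bound M (EIf c a b)) (r2, m2)"
      unfolding compile.simps
      by (rule runs_Seq'[OF 1(1) runs_If_nz[OF _ 2(1)]]) (use False 1(3) in simp_all)
    then show ?thesis using extends_trans[OF 1(2) 2(2)] 2(3) n False by auto
  qed
next
  case (ELet a b)
  obtain u where u: "typeof a \<Gamma> = Some u" "typeof b (u # \<Gamma>) = Some \<tau>"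
    using typeof_ELet[OF ELet.prems(1)] by blast
  have bnd: "bnd M a env" "bnd M b (eval a env # env)" using ELet.prems(3) by simp_all
  from ELet.IH(1)[OF u(1) ELet.prems(2) bnd(1) ELet.prems(4-8)] obtain r1 m1 where
    1: "runs (compile a rs D) (r, m) (time_bound M a) (r1, m1)" "extends D (r, m) (r1, m1)"
      "rep m1 (r1 1) (r1 D) (eval a env)" by blast
  have r1: "r1 2 = 1" "0 < r1 1"
    using extends_reg[OF 1(2), of 2] extends_heap[OF 1(2)] ELet.prems(4,5,8) by auto
  have ty: "list_all2 vty (eval a env # env) (u # \<Gamma>)"
    using typ_sound[OF u(1) ELet.prems(2)] ELet.prems(2) by simp
  have e1: "env_rep r1 m1 (D # rs) (eval a env # env)"
    using env_rep_extends[OF 1(2) ELet.prems(6,7)] 1(3) by simp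
  have "set (D # rs) \<subseteq> {3..<D + 1}" "3 \<le> D + 1" using ELet.prems(7,8) by auto
  from ELet.IH(2)[OF u(2) ty bnd(2) r1 e1 this] obtain r2 m2 where
    2: "runs (compile b (D # rs) (D + 1)) (r1, m1) (time_bound M b) (r2, m2)"
      "extends (D + 1) (r1, m1) (r2, m2)"
      "rep m2 (r2 1) (r2 (D + 1)) (eval b (eval a env # env))" by blast
  have "runs (compile (ELet a b) rs D) (r, m) (time_bound M (ELet a b)) (r2(D := r2 (D + 1)), m2)"
    unfolding compile.simps
    by (rule runs_Seq'[OF 1(1) runs_Seq[OF 2(1) runs_Move]]) simp
  moreover have "extends D (r, m) (r2(D := r2 (D + 1)), m2)"
    by (rule extends_upd'[OF extends_trans[OF 1(2) 2(2)]]) (use ELet.prems(8) in simp_all)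
  ultimately show ?case using 2(3) ELet.prems(8)
    by - (rule compiledI[where r = "r2(D := r2 (D + 1))" and m = m2], simp_all)
next
  case (ECase e a b)
  obtain u where u: "typeof e \<Gamma> = Some (TL u)" "typeof a \<Gamma> = Some \<tau>"
      "typeof b (u # TL u # \<Gamma>) = Some \<tau>" using typeof_ECase[OF ECase.prems(1)] by blast
  have bnd: "bnd M e env" using ECase.prems(3) by simp
  obtain l where l: "eval e env = L l" "\<forall>x\<in>set l. vty x u"
    using vty_TL[OF typ_sound[OF u(1) ECase.prems(2)]] by blast
  from ECase.IH(1)[OF u(1) ECase.prems(2) bnd ECase.prems(4-8)] obtain r1 m1 where
    1: "runs (compile e rs D) (r, m) (time_bound M e) (r1, m1)" "extends D (r, m) (r1, m1)"
      "rep m1 (r1 1) (r1 D) (L l)" unfolding l by blast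
  have r1: "r1 2 = 1" "0 < r1 1"
    using extends_reg[OF 1(2), of 2] extends_heap[OF 1(2)] ECase.prems(4,5,8) by auto
  note e1 = env_rep_extends[OF 1(2) ECase.prems(6,7)]
  show ?case
  proof (cases l)
    case Nil
    then have bnd: "bnd M a env" using ECase.prems(3) l by simp
    from ECase.IH(2)[OF u(2) ECase.prems(2) bnd r1 e1 ECase.prems(7,8)] obtain r2 m2 where
      2: "runs (compile a rs D) (r1, m1) (time_bound M a) (r2, m2)" "extends D (r1, m1) (r2, m2)"
      "rep m2 (r2 1) (r2 D) (eval a env)" by blast
    have "runs (compile (ECase e a b) rs D) (r, m) (time_bound M (ECase e a b)) (r2, m2)"
      unfolding compile.simps
      by (rule runs_Seq'[OF 1(1) runs_If_z[OF _ 2(1)]]) (use Nil 1(3) in simp_all)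
    then show ?thesis using extends_trans[OF 1(2) 2(2)] 2(3) l Nil by auto
  next
    case (Cons x xs)
    let ?r = "r1(D + 1 := m1 (r1 D), D := m1 (r1 D + 1))"
    have ext: "extends D (r1, m1) (?r, m1)" using ECase.prems(8) by (simp add: extends_def)
    have bnd: "bnd M b (x # L xs # env)" using ECase.prems(3) l Cons by simp
    have ty: "list_all2 vty (x # L xs # env) (u # TL u # \<Gamma>)" using l Cons ECase.prems(2) by simp
    have r2: "?r 2 = 1" "0 < ?r 1" using r1 ECase.prems(8) by auto
    have e2: "env_rep ?r m1 ((D + 1) # D # rs) (x # L xs # env)"
      using env_rep_extends[OF ext e1 ECase.prems(7)] 1(3) Cons ECase.prems(8) by simp
    have "set ((D + 1) # D # rs) \<subseteq> {3..<D + 2}" "3 \<le> D + 2" using ECase.prems(7,8) by auto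
    from ECase.IH(3)[OF u(3) ty bnd r2 e2 this] obtain r2 m2 where
      2: "runs (compile b ((D + 1) # D # rs) (D + 2)) (?r, m1) (time_bound M b) (r2, m2)"
      "extends (D + 2) (?r, m1) (r2, m2)"
      "rep m2 (r2 1) (r2 (D + 2)) (eval b (x # L xs # env))" by blast
    have A: "runs (Instr (Add D D 2)) (r1(D + 1 := m1 (r1 D)), m1) 1
        (r1(D + 1 := m1 (r1 D), D := r1 D + 1), m1)"
      using runs_Add[of D D 2 "r1(D + 1 := m1 (r1 D))" m1] r1 ECase.prems(8) by simp
    have B: "runs (Instr (Load D D)) (r1(D + 1 := m1 (r1 D), D := r1 D + 1), m1) 1 (?r, m1)"
      using runs_Load[of D D "r1(D + 1 := m1 (r1 D), D := r1 D + 1)" m1] by simp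
    have "runs (compile (ECase e a b) rs D) (r, m) (time_bound M (ECase e a b)) (r2(D := r2 (D + 2)), m2)"
      unfolding compile.simps
      by (rule runs_Seq'[OF 1(1) runs_If_nz[OF _ runs_Seq[OF runs_Load runs_Seq[OF A
            runs_Seq[OF B runs_Seq[OF 2(1) runs_Move]]]]]])
        (use Cons 1(3) in simp_all)
    moreover have "extends D (r, m) (r2(D := r2 (D + 2)), m2)"
      by (rule extends_upd'[OF extends_trans[OF extends_trans[OF 1(2) ext] 2(2)]])
        (use ECase.prems(8) in simp_all)
    ultimately show ?thesis using 2(3) l Cons ECase.prems(8)
      by - (rule compiledI[where r = "r2(D := r2 (D + 2))" and m = m2], simp_all)
  qed
next
  case (EFold l i b)
  obtain u where u: "typeof l \<Gamma> = Some (TL u)" "typeof i \<Gamma> = Some \<tau>"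
      "typeof b (\<tau> # u # \<Gamma>) = Some \<tau>" using typeof_EFold[OF EFold.prems(1)] by blast
  obtain xs where xs: "eval l env = L xs" "\<forall>x\<in>set xs. vty x u"
    using vty_TL[OF typ_sound[OF u(1) EFold.prems(2)]] by blast
  define f where "f = (\<lambda>acc x. eval b (acc # x # env))"
  define g where "g = (\<lambda>acc x. bnd M b (acc # x # env))"
  have bnd: "bnd M l env" "bnd M i env" "length xs \<le> M" "fold_ok f g xs (eval i env)"
    using EFold.prems(3) xs by (simp_all add: f_def g_def)
  let ?body = "Instr (Load (D + 2) D) ;; compile b ((D + 1) # (D + 2) # rs) (D + 3) ;;
       Instr (Move (D + 1) (D + 3)) ;; Instr (Add D D 2) ;; Instr (Load D D)"
  \<comment> \<open>Register \<open>D\<close> walks along the remaining list cells until it holds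
    address 0, and register \<open>D + 1\<close> carries the accumulator.\<close>
  have loop: "\<exists>r' m'. runs (WhileNZ D ?body) (r, m) (length xs * (time_bound M b + 6) + 1) (r', m') \<and>
     extends D (r, m) (r', m') \<and> rep m' (r' 1) (r' (D + 1)) (foldl f a xs)"
    if "\<forall>x\<in>set xs. vty x u" "vty a \<tau>" "fold_ok f g xs a" "rep m (r 1) (r D) (L xs)"
      "rep m (r 1) (r (D + 1)) a" "r 2 = 1" "0 < r 1" "env_rep r m rs env" for a xs r m
    using that
  proof (induction xs arbitrary: a r m)
    case Nil
    then show ?case using runs_While_z[of r D ?body m] extends_refl[of D "(r, m)"] by auto
  next
    case (Cons x xs)
    let ?r = "r(D + 2 := m (r D))"
    have ext: "extends (D + 2) (r, m) (?r, m)" by (simp add: extends_def)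
    have ty: "list_all2 vty (a # x # env) (\<tau> # u # \<Gamma>)" using Cons.prems EFold.prems(2) by simp
    have bnd: "bnd M b (a # x # env)" using Cons.prems(3) by (simp add: g_def)
    have r1: "?r 2 = 1" "0 < ?r 1" using Cons.prems EFold.prems(8) by auto
    have rs: "set rs \<subseteq> {3..<D + 2}" using EFold.prems(7) by auto
    have e1: "env_rep ?r m ((D + 1) # (D + 2) # rs) (a # x # env)"
      using env_rep_extends[OF ext Cons.prems(8) rs] Cons.prems(4,5) EFold.prems(8) by simp
    have "set ((D + 1) # (D + 2) # rs) \<subseteq> {3..<D + 3}" "3 \<le> D + 3"
      using EFold.prems(7,8) by auto
    from EFold.IH(3)[OF u(3) ty bnd r1 e1 this] obtain r2 m2 where
      2: "runs (compile b ((D + 1) # (D + 2) # rs) (D + 3)) (?r, m) (time_bound M b) (r2, m2)"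
      "extends (D + 3) (?r, m) (r2, m2)" "rep m2 (r2 1) (r2 (D + 3)) (f a x)"
      unfolding f_def by blast
    have ext2: "extends (D + 2) (r, m) (r2, m2)" by (rule extends_trans[OF ext 2(2)]) simp
    have r2: "r2 2 = 1" "0 < r2 1" "r2 D = r D"
      using extends_reg[OF ext2, of 2] extends_reg[OF ext2, of D] extends_heap[OF ext2]
        Cons.prems(6,7) EFold.prems(8) by auto
    have xs': "rep m2 (r2 1) (r2 D) (L (x # xs))"
      using extends_rep[OF ext2 Cons.prems(4)] r2 by simp
    let ?r3 = "r2(D + 1 := r2 (D + 3), D := m2 (r2 D + 1))"
    have A: "runs (Instr (Add D D 2)) (r2(D + 1 := r2 (D + 3)), m2) 1
        (r2(D + 1 := r2 (D + 3), D := r2 D + 1), m2)"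
      using runs_Add[of D D 2 "r2(D + 1 := r2 (D + 3))" m2] r2 EFold.prems(8) by simp
    have B: "runs (Instr (Load D D)) (r2(D + 1 := r2 (D + 3), D := r2 D + 1), m2) 1 (?r3, m2)"
      using runs_Load[of D D "r2(D + 1 := r2 (D + 3), D := r2 D + 1)" m2] by simp
    have body: "runs ?body (r, m) (1 + (time_bound M b + (1 + (1 + 1)))) (?r3, m2)"
      by (rule runs_Seq[OF runs_Load runs_Seq[OF 2(1) runs_Seq[OF runs_Move runs_Seq[OF A B]]]])
    have "extends D (r2, m2) (?r3, m2)" using EFold.prems(8) by (simp add: extends_def)
    moreover have "extends D (r, m) (r2, m2)" using ext2 by (auto simp: extends_def)
    ultimately have ext3: "extends D (r, m) (?r3, m2)" using extends_trans by blast
    have "vty (f a x) \<tau>" unfolding f_def by (rule typ_sound[OF u(3) ty])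
    moreover have "env_rep ?r3 m2 rs env" using env_rep_extends[OF ext3 Cons.prems(8) EFold.prems(7)] .
    moreover have "rep m2 (?r3 1) (?r3 D) (L xs)" "rep m2 (?r3 1) (?r3 (D + 1)) (f a x)"
      "?r3 2 = 1" "0 < ?r3 1" using xs' 2(3) r2 EFold.prems(8) by simp_all
    moreover have "\<forall>x\<in>set xs. vty x u" "fold_ok f g xs (f a x)" using Cons.prems(1,3) by simp_all
    ultimately obtain r4 m4 where
      4: "runs (WhileNZ D ?body) (?r3, m2) (length xs * (time_bound M b + 6) + 1) (r4, m4)"
      "extends D (?r3, m2) (r4, m4)" "rep m4 (r4 1) (r4 (D + 1)) (foldl f (f a x) xs)"
      using Cons.IH[of "f a x" m2 ?r3] by blast
    have "r D \<noteq> 0" using Cons.prems(4) by simp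
    from runs_mono[OF runs_While_nz[OF this body 4(1)]]
    have "runs (WhileNZ D ?body) (r, m) (length (x # xs) * (time_bound M b + 6) + 1) (r4, m4)" by simp
    then show ?case using extends_trans[OF ext3 4(2)] 4(3) by auto
  qed
  from EFold.IH(1)[OF u(1) EFold.prems(2) bnd(1) EFold.prems(4-8)] obtain r1 m1 where
    1: "runs (compile l rs D) (r, m) (time_bound M l) (r1, m1)" "extends D (r, m) (r1, m1)"
      "rep m1 (r1 1) (r1 D) (L xs)" unfolding xs by blast
  have r1: "r1 2 = 1" "0 < r1 1"
    using extends_reg[OF 1(2), of 2] extends_heap[OF 1(2)] EFold.prems(4,5,8) by auto
  note e1 = env_rep_extends[OF 1(2) EFold.prems(6,7)]
  have rs: "set rs \<subseteq> {3..<D + 1}" "3 \<le> D + 1" using EFold.prems(7,8) by auto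
  from EFold.IH(2)[OF u(2) EFold.prems(2) bnd(2) r1 e1 rs] obtain r2 m2 where
    2: "runs (compile i rs (D + 1)) (r1, m1) (time_bound M i) (r2, m2)" "extends (D + 1) (r1, m1) (r2, m2)"
      "rep m2 (r2 1) (r2 (D + 1)) (eval i env)" by blast
  have r2: "r2 2 = 1" "0 < r2 1" "rep m2 (r2 1) (r2 D) (L xs)"
    using extends_reg[OF 2(2), of 2] extends_reg[OF 2(2), of D] extends_heap[OF 2(2)] r1
      extends_rep[OF 2(2) 1(3)] EFold.prems(8) by auto
  note e2 = env_rep_extends[OF 2(2) e1 rs(1)]
  from loop[OF xs(2) typ_sound[OF u(2) EFold.prems(2)] bnd(4) r2(3) 2(3) r2(1,2) e2] obtain r3 m3 where
    3: "runs (WhileNZ D ?body) (r2, m2) (length xs * (time_bound M b + 6) + 1) (r3, m3)"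
     "extends D (r2, m2) (r3, m3)" "rep m3 (r3 1) (r3 (D + 1)) (foldl f (eval i env) xs)" by blast
  have "length xs * (time_bound M b + 6) \<le> M * (time_bound M b + 6)" using bnd(3) by (rule mult_le_mono1)
  then have "runs (compile (EFold l i b) rs D) (r, m) (time_bound M (EFold l i b)) (r3(D := r3 (D + 1)), m3)"
    unfolding compile.simps
    by (intro runs_Seq'[OF 1(1) runs_Seq[OF 2(1) runs_Seq[OF 3(1) runs_Move]]]) simp
  moreover have "extends D (r, m) (r3(D := r3 (D + 1)), m3)"
    by (rule extends_upd'[OF extends_trans[OF extends_trans[OF 1(2) 2(2)] 3(2)]])
      (use EFold.prems(8) in simp_all)
  ultimately show ?case using 3(3) xs EFold.prems(8)
    by - (rule compiledI[where r = "r3(D := r3 (D + 1))" and m = m3], simp_all add: f_def)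
next
  case (ERep n i b)
  have u: "typeof n \<Gamma> = Some TN" "typeof i \<Gamma> = Some \<tau>"
      "typeof b (\<tau> # \<Gamma>) = Some \<tau>" using typeof_ERep[OF ERep.prems(1)] by blast+
  obtain k where k: "eval n env = N k"
    using vty_TN[OF typ_sound[OF u(1) ERep.prems(2)]] by blast
  define f where "f = (\<lambda>acc. eval b (acc # env))"
  have bnd: "bnd M n env" "bnd M i env" "k \<le> M" "\<And>j. j < k \<Longrightarrow> bnd M b ((f ^^ j) (eval i env) # env)"
    using ERep.prems(3) k by (simp_all add: f_def)
  let ?body = "compile b ((D + 1) # rs) (D + 2) ;; Instr (Move (D + 1) (D + 2)) ;; Instr (Sub D D 2)"
  \<comment> \<open>Here register \<open>D\<close> counts down the remaining iterations.\<close>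
  have loop: "\<exists>r' m'. runs (WhileNZ D ?body) (r, m) (k * (time_bound M b + 4) + 1) (r', m') \<and>
     extends D (r, m) (r', m') \<and> rep m' (r' 1) (r' (D + 1)) ((f ^^ k) a)"
    if "vty a \<tau>" "\<And>j. j < k \<Longrightarrow> bnd M b ((f ^^ j) a # env)" "r D = k"
      "rep m (r 1) (r (D + 1)) a" "r 2 = 1" "0 < r 1" "env_rep r m rs env" for a k r m
    using that
  proof (induction k arbitrary: a r m)
    case 0
    then show ?case using runs_While_z[of r D ?body m] extends_refl[of D "(r, m)"] by auto
  next
    case (Suc k)
    have ty: "list_all2 vty (a # env) (\<tau> # \<Gamma>)" using Suc.prems(1) ERep.prems(2) by simp
    have bnd: "bnd M b (a # env)" using Suc.prems(2)[of 0] by simp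
    have e1: "env_rep r m ((D + 1) # rs) (a # env)" using Suc.prems(4,7) by simp
    have "set ((D + 1) # rs) \<subseteq> {3..<D + 2}" "3 \<le> D + 2"
      using ERep.prems(7,8) by auto
    from ERep.IH(3)[OF u(3) ty bnd Suc.prems(5,6) e1 this] obtain r2 m2 where
      2: "runs (compile b ((D + 1) # rs) (D + 2)) (r, m) (time_bound M b) (r2, m2)"
      "extends (D + 2) (r, m) (r2, m2)" "rep m2 (r2 1) (r2 (D + 2)) (f a)"
      unfolding f_def by blast
    have r2: "r2 2 = 1" "0 < r2 1" "r2 D = Suc k"
      using extends_reg[OF 2(2), of 2] extends_reg[OF 2(2), of D] extends_heap[OF 2(2)]
        Suc.prems(3,5,6) ERep.prems(8) by auto
    let ?r3 = "r2(D + 1 := r2 (D + 2), D := k)"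
    have A: "runs (Instr (Sub D D 2)) (r2(D + 1 := r2 (D + 2)), m2) 1 (?r3, m2)"
      using runs_Sub[of D D 2 "r2(D + 1 := r2 (D + 2))" m2] r2 ERep.prems(8) by simp
    have body: "runs ?body (r, m) (time_bound M b + (1 + 1)) (?r3, m2)"
      by (rule runs_Seq[OF 2(1) runs_Seq[OF runs_Move A]])
    have "extends D (r2, m2) (?r3, m2)" using ERep.prems(8) by (simp add: extends_def)
    moreover have "extends D (r, m) (r2, m2)" using 2(2) by (auto simp: extends_def)
    ultimately have ext3: "extends D (r, m) (?r3, m2)" using extends_trans by blast
    have "vty (f a) \<tau>" unfolding f_def by (rule typ_sound[OF u(3) ty])
    moreover have "bnd M b ((f ^^ j) (f a) # env)" if "j < k" for j
      using Suc.prems(2)[of "Suc j"] that by (simp add: funpow_swap1)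
    moreover have "env_rep ?r3 m2 rs env" using env_rep_extends[OF ext3 Suc.prems(7) ERep.prems(7)] .
    moreover have "?r3 D = k" "rep m2 (?r3 1) (?r3 (D + 1)) (f a)"
      "?r3 2 = 1" "0 < ?r3 1" using 2(3) r2 ERep.prems(8) by simp_all
    ultimately obtain r4 m4 where
      4: "runs (WhileNZ D ?body) (?r3, m2) (k * (time_bound M b + 4) + 1) (r4, m4)"
      "extends D (?r3, m2) (r4, m4)" "rep m4 (r4 1) (r4 (D + 1)) ((f ^^ k) (f a))"
      using Suc.IH[of "f a" ?r3 m2] by blast
    have "r D \<noteq> 0" using Suc.prems(3) by simp
    from runs_mono[OF runs_While_nz[OF this body 4(1)]]
    have "runs (WhileNZ D ?body) (r, m) (Suc k * (time_bound M b + 4) + 1) (r4, m4)" by simp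
    then show ?case using extends_trans[OF ext3 4(2)] 4(3) by (auto simp: funpow_swap1)
  qed
  from ERep.IH(1)[OF u(1) ERep.prems(2) bnd(1) ERep.prems(4-8)] obtain r1 m1 where
    1: "runs (compile n rs D) (r, m) (time_bound M n) (r1, m1)" "extends D (r, m) (r1, m1)"
      "r1 D = k" unfolding k by auto
  have r1: "r1 2 = 1" "0 < r1 1"
    using extends_reg[OF 1(2), of 2] extends_heap[OF 1(2)] ERep.prems(4,5,8) by auto
  note e1 = env_rep_extends[OF 1(2) ERep.prems(6,7)]
  have rs: "set rs \<subseteq> {3..<D + 1}" "3 \<le> D + 1" using ERep.prems(7,8) by auto
  from ERep.IH(2)[OF u(2) ERep.prems(2) bnd(2) r1 e1 rs] obtain r2 m2 where
    2: "runs (compile i rs (D + 1)) (r1, m1) (time_bound M i) (r2, m2)" "extends (D + 1) (r1, m1) (r2, m2)"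
      "rep m2 (r2 1) (r2 (D + 1)) (eval i env)" by blast
  have r2: "r2 2 = 1" "0 < r2 1" "r2 D = k"
    using extends_reg[OF 2(2), of 2] extends_reg[OF 2(2), of D] extends_heap[OF 2(2)] r1
      1(3) ERep.prems(8) by auto
  note e2 = env_rep_extends[OF 2(2) e1 rs(1)]
  from loop[OF typ_sound[OF u(2) ERep.prems(2)] bnd(4) r2(3) 2(3) r2(1,2) e2] obtain r3 m3 where
    3: "runs (WhileNZ D ?body) (r2, m2) (k * (time_bound M b + 4) + 1) (r3, m3)"
     "extends D (r2, m2) (r3, m3)" "rep m3 (r3 1) (r3 (D + 1)) ((f ^^ k) (eval i env))" by blast
  have "k * (time_bound M b + 4) \<le> M * (time_bound M b + 4)" using bnd(3) by (rule mult_le_mono1)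
  then have "runs (compile (ERep n i b) rs D) (r, m) (time_bound M (ERep n i b)) (r3(D := r3 (D + 1)), m3)"
    unfolding compile.simps
    by (intro runs_Seq'[OF 1(1) runs_Seq[OF 2(1) runs_Seq[OF 3(1) runs_Move]]]) simp
  moreover have "extends D (r, m) (r3(D := r3 (D + 1)), m3)"
    by (rule extends_upd'[OF extends_trans[OF extends_trans[OF 1(2) 2(2)] 3(2)]])
      (use ERep.prems(8) in simp_all)
  ultimately show ?case using 3(3) k ERep.prems(8)
    by - (rule compiledI[where r = "r3(D := r3 (D + 1))" and m = m3], simp_all add: f_def)
next
  case (EAdd a b)
  have t: "typeof a \<Gamma> = Some TN" "typeof b \<Gamma> = Some TN" using EAdd.prems(1) by (auto split: if_splits)
  have bnd: "bnd M a env" "bnd M b env" using EAdd.prems(3) by simp_all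
  obtain x where x: "eval a env = N x" using vty_TN[OF typ_sound[OF t(1) EAdd.prems(2)]] by blast
  obtain y where y: "eval b env = N y" using vty_TN[OF typ_sound[OF t(2) EAdd.prems(2)]] by blast
  obtain r1 m1 r2 m2 where 1: "runs (compile a rs D) (r, m) (time_bound M a) (r1, m1)"
    "runs (compile b rs (D + 1)) (r1, m1) (time_bound M b) (r2, m2)" "extends D (r, m) (r2, m2)"
    "rep m2 (r2 1) (r2 D) (N x)" "rep m2 (r2 1) (r2 (D + 1)) (N y)"
    unfolding x[symmetric] y[symmetric]
    by (rule runs_two[OF EAdd.IH(1)[OF t(1) EAdd.prems(2) bnd(1) EAdd.prems(4-8)]
       EAdd.IH(2)[OF t(2) EAdd.prems(2) bnd(2)] EAdd.prems(4-8)])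
  have "runs (compile (EAdd a b) rs D) (r, m) (time_bound M (EAdd a b)) (r2(D := x + y), m2)"
    unfolding compile.simps
    by (rule runs_Seq'[OF 1(1) runs_Seq[OF 1(2) runs_Add[of D D "D + 1" r2 m2, unfolded 1(4,5)[unfolded rep.simps]]]]) simp
  then show ?case using extends_upd'[OF 1(3), of D] EAdd.prems(8) x y
    by - (rule compiledI[where r = "r2(D := x + y)" and m = m2], simp_all)
next
  case (ESub a b)
  have t: "typeof a \<Gamma> = Some TN" "typeof b \<Gamma> = Some TN" using ESub.prems(1) by (auto split: if_splits)
  have bnd: "bnd M a env" "bnd M b env" using ESub.prems(3) by simp_all
  obtain x where x: "eval a env = N x" using vty_TN[OF typ_sound[OF t(1) ESub.prems(2)]] by blast
  obtain y where y: "eval b env = N y" using vty_TN[OF typ_sound[OF t(2) ESub.prems(2)]] by blast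
  obtain r1 m1 r2 m2 where 1: "runs (compile a rs D) (r, m) (time_bound M a) (r1, m1)"
    "runs (compile b rs (D + 1)) (r1, m1) (time_bound M b) (r2, m2)" "extends D (r, m) (r2, m2)"
    "rep m2 (r2 1) (r2 D) (N x)" "rep m2 (r2 1) (r2 (D + 1)) (N y)"
    unfolding x[symmetric] y[symmetric]
    by (rule runs_two[OF ESub.IH(1)[OF t(1) ESub.prems(2) bnd(1) ESub.prems(4-8)]
       ESub.IH(2)[OF t(2) ESub.prems(2) bnd(2)] ESub.prems(4-8)])
  have "runs (compile (ESub a b) rs D) (r, m) (time_bound M (ESub a b)) (r2(D := x - y), m2)"
    unfolding compile.simps
    by (rule runs_Seq'[OF 1(1) runs_Seq[OF 1(2) runs_Sub[of D D "D + 1" r2 m2, unfolded 1(4,5)[unfolded rep.simps]]]]) simp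
  then show ?case using extends_upd'[OF 1(3), of D] ESub.prems(8) x y
    by - (rule compiledI[where r = "r2(D := x - y)" and m = m2], simp_all)
next
  case (EPair a b)
  obtain u v where t: "typeof a \<Gamma> = Some u" "typeof b \<Gamma> = Some v"
    using typeof_EPair[OF EPair.prems(1)] by blast
  have bnd: "bnd M a env" "bnd M b env" using EPair.prems(3) by simp_all
  obtain r1 m1 r2 m2 where 1: "runs (compile a rs D) (r, m) (time_bound M a) (r1, m1)"
    "runs (compile b rs (D + 1)) (r1, m1) (time_bound M b) (r2, m2)" "extends D (r, m) (r2, m2)"
    "rep m2 (r2 1) (r2 D) (eval a env)" "rep m2 (r2 1) (r2 (D + 1)) (eval b env)"
    by (rule runs_two[OF EPair.IH(1)[OF t(1) EPair.prems(2) bnd(1) EPair.prems(4-8)]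
       EPair.IH(2)[OF t(2) EPair.prems(2) bnd(2)] EPair.prems(4-8)])
  have r2: "r2 2 = 1" "0 < r2 1"
    using extends_reg[OF 1(3), of 2] extends_heap[OF 1(3)] EPair.prems(4,5,8) by auto
  obtain r3 m3 where 3: "runs (alloc D (D + 1)) (r2, m2) 5 (r3, m3)" "extends D (r2, m2) (r3, m3)"
    "rep m3 (r3 1) (r3 D) (P (eval a env) (eval b env))"
    "\<And>l. eval b env = L l \<Longrightarrow> rep m3 (r3 1) (r3 D) (L (eval a env # l))"
    using runs_alloc[OF r2 EPair.prems(8) 1(4,5)] by blast
  have "runs (compile (EPair a b) rs D) (r, m) (time_bound M (EPair a b)) (r3, m3)"
    unfolding compile.simps by (rule runs_Seq'[OF 1(1) runs_Seq[OF 1(2) 3(1)]]) simp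
  then show ?case using extends_trans[OF 1(3) 3(2)] 3(3) by auto
next
  case (ECons a b)
  obtain u v where t: "typeof a \<Gamma> = Some u" "typeof b \<Gamma> = Some (TL u)"
    using typeof_ECons[OF ECons.prems(1)] by blast
  have bnd: "bnd M a env" "bnd M b env" using ECons.prems(3) by simp_all
  obtain l where l: "eval b env = L l" using vty_TL[OF typ_sound[OF t(2) ECons.prems(2)]] by blast
  obtain r1 m1 r2 m2 where 1: "runs (compile a rs D) (r, m) (time_bound M a) (r1, m1)"
    "runs (compile b rs (D + 1)) (r1, m1) (time_bound M b) (r2, m2)" "extends D (r, m) (r2, m2)"
    "rep m2 (r2 1) (r2 D) (eval a env)" "rep m2 (r2 1) (r2 (D + 1)) (eval b env)"
    by (rule runs_two[OF ECons.IH(1)[OF t(1) ECons.prems(2) bnd(1) ECons.prems(4-8)]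
       ECons.IH(2)[OF t(2) ECons.prems(2) bnd(2)] ECons.prems(4-8)])
  have r2: "r2 2 = 1" "0 < r2 1"
    using extends_reg[OF 1(3), of 2] extends_heap[OF 1(3)] ECons.prems(4,5,8) by auto
  obtain r3 m3 where 3: "runs (alloc D (D + 1)) (r2, m2) 5 (r3, m3)" "extends D (r2, m2) (r3, m3)"
    "rep m3 (r3 1) (r3 D) (P (eval a env) (eval b env))"
    "\<And>l. eval b env = L l \<Longrightarrow> rep m3 (r3 1) (r3 D) (L (eval a env # l))"
    using runs_alloc[OF r2 ECons.prems(8) 1(4,5)] by blast
  have "runs (compile (ECons a b) rs D) (r, m) (time_bound M (ECons a b)) (r3, m3)"
    unfolding compile.simps by (rule runs_Seq'[OF 1(1) runs_Seq[OF 1(2) 3(1)]]) simp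
  then show ?case using extends_trans[OF 1(3) 3(2)] 3(4)[OF l] l by auto
qed

section \<open>Reading the input\<close>

abbreviation skip_sets :: com where
  "skip_sets \<equiv> WhileNZ 4 (Instr (Load 5 3) ;; Instr (Add 3 3 5) ;; Instr (Add 3 3 2) ;; Instr (Sub 4 4 2))"

abbreviation push_input :: com where
  "push_input \<equiv> WhileNZ 3 (Instr (Sub 3 3 2) ;; Instr (Load 4 3) ;; alloc 4 5 ;; Instr (Move 5 4))"

text \<open>The prologue finds the end of the input, where the heap starts, and copies the input into a list.\<close>

definition run_on_input :: "expr \<Rightarrow> com" where
  "run_on_input e = Instr (Const 2 1) ;; Instr (Const 4 0) ;; Instr (Load 3 4) ;; Instr (Const 5 4) ;;
     Instr (Add 3 3 5) ;; Instr (Const 4 2) ;; Instr (Load 4 4) ;; skip_sets ;;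
     Instr (Move 1 3) ;; Instr (Const 5 0) ;; push_input ;;
     compile e [5] 6 ;; Instr (Move 0 6)"

text \<open>The input does not state its total length, so its end is found by jumping from one size
  entry to the next.\<close>

lemma runs_skip_sets:
  assumes "r 2 = 1" "r 4 = length Ss"
    and "\<And>i. i < length (concat (map (\<lambda>s. length s # s) Ss)) \<Longrightarrow>
      m (r 3 + i) = concat (map (\<lambda>s. length s # s) Ss) ! i"
  shows "\<exists>r'. runs skip_sets (r, m) (6 * length Ss + 1) (r', m) \<and> r' 2 = 1 \<and>
    r' 3 = r 3 + length (concat (map (\<lambda>s. length s # s) Ss))"
  using assms
proof (induction Ss arbitrary: r)
  case Nil
  then show ?case using runs_While_z[of r 4 _ m] by auto
next
  case (Cons s Ss)
  let ?r = "r(5 := length s, 3 := r 3 + length s + 1, 4 := length Ss)"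
  have l: "m (r 3) = length s" using Cons.prems(3)[of 0] by simp
  have 1: "runs (Instr (Load 5 3)) (r, m) 1 (r(5 := length s), m)"
    using runs_Load[of 5 3 r m] l by simp
  have 2: "runs (Instr (Add 3 3 5)) (r(5 := length s), m) 1 (r(5 := length s, 3 := r 3 + length s), m)"
    using runs_Add[of 3 3 5 "r(5 := length s)" m] by simp
  have 3: "runs (Instr (Add 3 3 2)) (r(5 := length s, 3 := r 3 + length s), m) 1
      (r(5 := length s, 3 := r 3 + length s + 1), m)"
    using runs_Add[of 3 3 2 "r(5 := length s, 3 := r 3 + length s)" m] Cons.prems(1) by simp
  have 4: "runs (Instr (Sub 4 4 2)) (r(5 := length s, 3 := r 3 + length s + 1), m) 1 (?r, m)"
    using runs_Sub[of 4 4 2 "r(5 := length s, 3 := r 3 + length s + 1)" m] Cons.prems(1,2) by simp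
  have "m (?r 3 + i) = concat (map (\<lambda>s. length s # s) Ss) ! i"
    if "i < length (concat (map (\<lambda>s. length s # s) Ss))" for i
    using Cons.prems(3)[of "length s + 1 + i"] that
    by (simp add: nth_append add.assoc add.commute add.left_commute)
  moreover have "?r 2 = 1" "?r 4 = length Ss" using Cons.prems(1) by simp_all
  ultimately obtain r' where
    5: "runs skip_sets (?r, m) (6 * length Ss + 1) (r', m)" "r' 2 = 1"
      "r' 3 = ?r 3 + length (concat (map (\<lambda>s. length s # s) Ss))" using Cons.IH[of ?r] by blast
  have "r 4 \<noteq> 0" using Cons.prems(2) by simp
  from runs_mono[OF runs_While_nz[OF this runs_Seq[OF 1 runs_Seq[OF 2 runs_Seq[OF 3 4]]] 5(1)]]
  have "runs skip_sets (r, m) (6 * length (s # Ss) + 1) (r', m)" by simp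
  then show ?case using 5(2,3) by (intro exI[of _ r']) simp
qed

text \<open>Going backwards through the input makes prepending yield the original order. The heap
  starts at or above \<open>length w\<close>, so the cells still to be read are not
  overwritten.\<close>

lemma runs_push_input:
  assumes "r 2 = 1" "0 < r 1" "length w \<le> r 1" "r 3 \<le> length w"
    and "\<And>i. i < length w \<Longrightarrow> m i = w ! i"
    and "rep m (r 1) (r 5) (L (map N (drop (r 3) w)))"
  shows "\<exists>r' m'. runs push_input (r, m) (10 * r 3 + 1) (r', m') \<and> r' 2 = 1 \<and> 0 < r' 1 \<and>
    rep m' (r' 1) (r' 5) (L (map N w))"
  using assms
proof (induction "r 3" arbitrary: r m)
  case 0
  then show ?case using runs_While_z[of r 3 _ m] by auto
next
  case (Suc j)
  define rj where "rj = r(3 := j, 4 := w ! j)"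
  have j: "j < length w" using Suc.hyps(2) Suc.prems(4) by simp
  have 1: "runs (Instr (Sub 3 3 2)) (r, m) 1 (r(3 := j), m)"
    using runs_Sub[of 3 3 2 r m] Suc.hyps(2)[symmetric] Suc.prems(1) by simp
  have 2: "runs (Instr (Load 4 3)) (r(3 := j), m) 1 (rj, m)"
    using runs_Load[of 4 3 "r(3 := j)" m] Suc.prems(5)[OF j] by (simp add: rj_def)
  have pre: "rj 2 = 1" "0 < rj 1" "3 \<le> (4::nat)" "rep m (rj 1) (rj 4) (N (w ! j))"
    "rep m (rj 1) (rj (4 + 1)) (L (map N (drop (Suc j) w)))"
    using Suc.prems Suc.hyps(2) by (simp_all add: rj_def)
  obtain r1 m1 where alloc: "runs (alloc 4 (4 + 1)) (rj, m) 5 (r1, m1)" "extends 4 (rj, m) (r1, m1)"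
      "\<And>l. L (map N (drop (Suc j) w)) = L l \<Longrightarrow> rep m1 (r1 1) (r1 4) (L (N (w ! j) # l))"
    using runs_alloc[OF pre] by blast
  have 3: "runs (alloc 4 5) (rj, m) 5 (r1, m1)" "extends 4 (rj, m) (r1, m1)"
      "rep m1 (r1 1) (r1 4) (L (N (w ! j) # map N (drop (Suc j) w)))"
    using alloc(1,2) alloc(3)[OF refl] by simp_all
  let ?r1 = "r1(5 := r1 4)"
  have r1: "r1 2 = 1" "r1 3 = j" "r 1 \<le> r1 1"
    using extends_reg[OF 3(2), of 2] extends_reg[OF 3(2), of 3] extends_heap[OF 3(2)] Suc.prems(1) by (simp_all add: rj_def)
  have m1: "m1 i = w ! i" if "i < length w" for i
    using 3(2) Suc.prems(3,5) that by (simp add: extends_def rj_def)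
  have "j = ?r1 3" "?r1 2 = 1" "0 < ?r1 1" "length w \<le> ?r1 1" "?r1 3 \<le> length w"
    "rep m1 (?r1 1) (?r1 5) (L (map N (drop (?r1 3) w)))"
    using r1 3(3) j Suc.prems(2,3) by (simp_all add: Cons_nth_drop_Suc[symmetric])
  from Suc.hyps(1)[OF this(1-5) m1 this(6)] obtain r2 m2 where
    4: "runs push_input (?r1, m1) (10 * ?r1 3 + 1) (r2, m2)" "r2 2 = 1" "0 < r2 1"
      "rep m2 (r2 1) (r2 5) (L (map N w))" by blast
  have "r 3 \<noteq> 0" using Suc.hyps(2) by simp
  from runs_mono[OF runs_While_nz[OF this runs_Seq[OF 1 runs_Seq[OF 2 runs_Seq[OF 3(1) runs_Move]]] 4(1)],
      of "10 * r 3 + 1"] r1 Suc.hyps(2)[symmetric]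
  have "runs push_input (r, m) (10 * r 3 + 1) (r2, m2)" by simp
  then show ?case using 4(2-4) by blast
qed

theorem run_on_input_correct:
  assumes e: "typeof e [TL TN] = Some TN" "bnd M e [L (map N w)]"
    and w: "w = [length owners, p, length Ss, k] @ owners @ concat (map (\<lambda>s. length s # s) Ss)"
  shows "\<exists>t. halts_within (ccomp 0 (run_on_input e)) w t (num (eval e [L (map N w)])) \<and>
    t \<le> time_bound M e + 16 * length w + 20"
proof -
  let ?n = "length owners" and ?sets = "concat (map (\<lambda>s. length s # s) Ss)"
  define m where "m = (\<lambda>a. if a < length w then w ! a else 0)"
  define r0 :: "nat \<Rightarrow> nat" where "r0 = (\<lambda>_. 0)"
  let ?r1 = "r0(2 := 1, 4 := 0)"
  let ?r2 = "r0(2 := 1, 4 := 0, 3 := ?n)"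
  let ?r3 = "r0(2 := 1, 4 := 0, 3 := ?n, 5 := 4)"
  let ?r4 = "r0(2 := 1, 4 := 0, 3 := ?n + 4, 5 := 4)"
  let ?r5 = "r0(2 := 1, 4 := 2, 3 := ?n + 4, 5 := 4)"
  let ?r6 = "r0(2 := 1, 4 := length Ss, 3 := ?n + 4, 5 := 4)"
  have lw: "length w = ?n + 4 + length ?sets" by (simp add: w)
  have m0: "m 0 = ?n" and m2: "m 2 = length Ss" by (simp_all add: m_def w numeral_2_eq_2)
  have 1: "runs (Instr (Const 2 1)) (r0, m) 1 (r0(2 := 1), m)" by (rule runs_Const)
  have 2: "runs (Instr (Const 4 0)) (r0(2 := 1), m) 1 (?r1, m)" by (rule runs_Const)
  have 3: "runs (Instr (Load 3 4)) (?r1, m) 1 (?r2, m)" using runs_Load[of 3 4 ?r1 m] m0 by simp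
  have 4: "runs (Instr (Const 5 4)) (?r2, m) 1 (?r3, m)" by (rule runs_Const)
  have 5: "runs (Instr (Add 3 3 5)) (?r3, m) 1 (?r4, m)"
    using runs_Add[of 3 3 5 ?r3 m] by (simp add: fun_upd_twist)
  have 6: "runs (Instr (Const 4 2)) (?r4, m) 1 (?r5, m)"
    using runs_Const[of 4 2 ?r4 m] by (simp add: fun_upd_twist)
  have 7: "runs (Instr (Load 4 4)) (?r5, m) 1 (?r6, m)"
    using runs_Load[of 4 4 ?r5 m] m2 by (simp add: fun_upd_twist)
  have "m (?r6 3 + i) = ?sets ! i" if "i < length ?sets" for i
  proof -
    have "w ! (4 + ?n + i) = ?sets ! i"
      unfolding w by (simp add: nth_append numeral_eq_Suc)
    then show ?thesis using that lw by (simp add: m_def add.commute)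
  qed
  from runs_skip_sets[of ?r6 Ss m, OF _ _ this] obtain r7 where
    8: "runs skip_sets (?r6, m) (6 * length Ss + 1) (r7, m)" "r7 2 = 1" "r7 3 = length w"
    using lw by auto
  have m_w: "m i = w ! i" if "i < length w" for i using that by (simp add: m_def)
  define r8 where "r8 = r7(1 := length w, 5 := 0)"
  have 9: "runs (Instr (Move 1 3)) (r7, m) 1 (r7(1 := length w), m)"
    using runs_Move[of 1 3 r7 m] 8(3) by simp
  have 10: "runs (Instr (Const 5 0)) (r7(1 := length w), m) 1 (r8, m)" unfolding r8_def by (rule runs_Const)
  \<comment> \<open>The header alone has four entries, so the heap pointer is positive.\<close>
  have "r8 2 = 1" "0 < r8 1" "length w \<le> r8 1" "r8 3 \<le> length w"
    "rep m (r8 1) (r8 5) (L (map N (drop (r8 3) w)))" using 8(2,3) lw by (simp_all add: r8_def)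
  from runs_push_input[OF this(1-4) _ this(5)] obtain r9 m9 where
    11: "runs push_input (r8, m) (10 * r8 3 + 1) (r9, m9)" "r9 2 = 1" "0 < r9 1"
      "rep m9 (r9 1) (r9 5) (L (map N w))" using m_w by blast
  have "list_all2 vty [L (map N w)] [TL TN]" "env_rep r9 m9 [5] [L (map N w)]"
    "set [5] \<subseteq> {3..<(6::nat)}" "3 \<le> (6::nat)" using 11(4) by (auto simp: env_rep_def)
  from compile_correct[OF e(1) this(1) e(2) 11(2,3) this(2-4)] obtain r10 m10 where
    12: "runs (compile e [5] 6) (r9, m9) (time_bound M e) (r10, m10)"
      "rep m10 (r10 1) (r10 6) (eval e [L (map N w)])" by blast
  obtain out where out: "eval e [L (map N w)] = N out"
    using vty_TN[OF typ_sound[OF e(1)], of "[L (map N w)]"] by auto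
  \<comment> \<open>Each set contributes its size entry to the input. Thus 6 steps per skipped set
    and 10 per copied entry amount to at most \<open>16 * length w\<close>.\<close>
  have "length Ss \<le> length ?sets" by (induction Ss) auto
  then have "runs (run_on_input e) (r0, m) (time_bound M e + 16 * length w + 20) (r10(0 := r10 6), m10)"
    unfolding run_on_input_def
    by (intro runs_Seq'[OF 1 runs_Seq[OF 2 runs_Seq[OF 3 runs_Seq[OF 4 runs_Seq[OF 5 runs_Seq[OF 6
      runs_Seq[OF 7 runs_Seq[OF 8(1) runs_Seq[OF 9 runs_Seq[OF 10 runs_Seq[OF 11(1)
      runs_Seq[OF 12(1) runs_Move]]]]]]]]]]]])
      (use 8(3) lw in \<open>simp add: r8_def\<close>)
  then obtain t where t: "t \<le> time_bound M e + 16 * length w + 20"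
    "(step (ccomp 0 (run_on_input e)) ^^ t) (0, r0, m) = (clen (run_on_input e), r10(0 := r10 6), m10)"
    unfolding runs_def by (metis add_0 append_Nil append_Nil2 list.size(3))
  have "initial w = (0, r0, m)" by (simp add: initial_def r0_def m_def)
  then have "halts_within (ccomp 0 (run_on_input e)) w t out"
    using t(2) 12(2) out by (auto simp: halts_within_def)
  then show ?thesis using t(1) out by auto
qed

section \<open>Programs on encoded lists\<close>

text \<open>Encoders of list data as values; \<open>dE\<close>, \<open>dS\<close> and \<open>dF\<close> invert \<open>ve\<close>, \<open>vs\<close> and \<open>vf\<close>.\<close>

definition vb :: "bool \<Rightarrow> val" where "vb b = N (if b then 1 else 0)"

lemma num_vb [simp]: "num (vb b) = 0 \<longleftrightarrow> \<not> b" "0 < num (vb b) \<longleftrightarrow> b" "num (vb a) = num (vb b) \<longleftrightarrow> a = b"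
  by (simp_all add: vb_def)

definition ve :: "elt \<Rightarrow> val" where "ve x = P (N (fst x)) (N (snd x))"
definition vs :: "elt list \<Rightarrow> val" where "vs s = L (map ve s)"
definition vf :: "elt list list \<Rightarrow> val" where "vf F = L (map vs F)"
definition vx :: "elt list list list \<Rightarrow> val" where "vx Xs = L (map vf Xs)"
definition vp :: "nat \<times> elt list \<Rightarrow> val" where "vp p = P (N (fst p)) (vs (snd p))"

definition dE :: "val \<Rightarrow> elt" where "dE v = (num (vfst v), num (vsnd v))"
definition dS :: "val \<Rightarrow> elt list" where "dS v = map dE (elems v)"
definition dF :: "val \<Rightarrow> elt list list" where "dF v = map dS (elems v)"

lemma num_vsnd_ve [simp]: "num (vsnd (ve x)) = snd x" by (simp add: ve_def)
lemma dE_ve [simp]: "dE (ve x) = x" by (simp add: dE_def ve_def)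
lemma dS_vs [simp]: "dS (vs s) = s" by (simp add: dS_def vs_def o_def map_idI)
lemma dF_vf [simp]: "dF (vf F) = F" by (simp add: dF_def vf_def o_def map_idI)
lemma elems_vs [simp]: "elems (vs s) = map ve s" by (simp add: vs_def)
lemma elems_vf [simp]: "elems (vf F) = map vs F" by (simp add: vf_def)
lemma elems_vx [simp]: "elems (vx Xs) = map vf Xs" by (simp add: vx_def)
lemma vp_simps [simp]: "num (vfst (vp p)) = fst p" "vfst (vp p) = N (fst p)" "vsnd (vp p) = vs (snd p)"
  by (simp_all add: vp_def)
lemma set_dS: "set (dS v) = dE ` set (elems v)" by (simp add: dS_def)

lemma fold_okI: "(\<And>a x. x \<in> set xs \<Longrightarrow> g a x) \<Longrightarrow> fold_ok f g xs a"
  by (induction xs arbitrary: a) auto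

section \<open>Derived boolean and list operations\<close>

abbreviation "TE \<equiv> TP TN TN"
abbreviation "TS \<equiv> TL TE"
abbreviation "TF \<equiv> TL TS"

definition ENot :: "expr \<Rightarrow> expr" where "ENot a = EIf a (ENum 0) (ENum 1)"
definition EAnd :: "expr \<Rightarrow> expr \<Rightarrow> expr" where "EAnd a b = EIf a (EIf b (ENum 1) (ENum 0)) (ENum 0)"
definition EOr :: "expr \<Rightarrow> expr \<Rightarrow> expr" where "EOr a b = EIf a (ENum 1) (EIf b (ENum 1) (ENum 0))"
definition ELess :: "expr \<Rightarrow> expr \<Rightarrow> expr" where "ELess a b = EIf (ESub b a) (ENum 1) (ENum 0)"
definition EEqN :: "expr \<Rightarrow> expr \<Rightarrow> expr" where "EEqN a b = ENot (EOr (ELess a b) (ELess b a))"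
definition EEqE :: "expr \<Rightarrow> expr \<Rightarrow> expr" where
  "EEqE a b = EAnd (EEqN (EFst a) (EFst b)) (EEqN (ESnd a) (ESnd b))"

lemma eval_ENot [simp]: "eval (ENot a) env = vb (num (eval a env) = 0)"
  and eval_EAnd [simp]: "eval (EAnd a b) env = vb (num (eval a env) \<noteq> 0 \<and> num (eval b env) \<noteq> 0)"
  and eval_EOr [simp]: "eval (EOr a b) env = vb (num (eval a env) \<noteq> 0 \<or> num (eval b env) \<noteq> 0)"
  and eval_ELess [simp]: "eval (ELess a b) env = vb (num (eval a env) < num (eval b env))"
  by (auto simp: ENot_def EAnd_def EOr_def ELess_def vb_def)

lemma eval_EEqN [simp]: "eval (EEqN a b) env = vb (num (eval a env) = num (eval b env))"
  by (auto simp: EEqN_def intro!: arg_cong[where f = vb])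

lemma eval_EEqE [simp]: "eval (EEqE a b) env = vb (dE (eval a env) = dE (eval b env))"
  by (simp add: EEqE_def dE_def)

lemma bnd_bool [simp]:
  "bnd M (ENot a) env \<longleftrightarrow> bnd M a env"
  "bnd M a env \<Longrightarrow> (num (eval a env) \<noteq> 0 \<Longrightarrow> bnd M b env) \<Longrightarrow> bnd M (EAnd a b) env"
  "bnd M a env \<Longrightarrow> bnd M b env \<Longrightarrow> bnd M (EOr a b) env"
  "bnd M (ELess a b) env \<longleftrightarrow> bnd M a env \<and> bnd M b env"
  by (auto simp: ENot_def EAnd_def EOr_def ELess_def)

lemma bnd_EEqN [simp]: "bnd M a env \<Longrightarrow> bnd M b env \<Longrightarrow> bnd M (EEqN a b) env"
  by (simp add: EEqN_def)

lemma bnd_EEqE [simp]: "bnd M a env \<Longrightarrow> bnd M b env \<Longrightarrow> bnd M (EEqE a b) env"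
  by (simp add: EEqE_def)

text \<open>The body of a fold has the accumulator at index 0; \<open>EWeak\<close> hides it, so
  that the condition \<open>c\<close> sees the current element there. Once the answer is settled,
  \<open>c\<close> is not evaluated again.\<close>

definition EAny :: "expr \<Rightarrow> expr \<Rightarrow> expr" where
  "EAny l c = EFold l (ENum 0) (EIf (EVar 0) (ENum 1) (EIf (EWeak c) (ENum 1) (ENum 0)))"

definition EAll :: "expr \<Rightarrow> expr \<Rightarrow> expr" where
  "EAll l c = EFold l (ENum 1) (EIf (EVar 0) (EIf (EWeak c) (ENum 1) (ENum 0)) (ENum 0))"

definition ECount :: "expr \<Rightarrow> expr \<Rightarrow> expr" where
  "ECount l c = EFold l (ENum 0) (EIf (EWeak c) (EAdd (EVar 0) (ENum 1)) (EVar 0))"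

definition EFilter :: "ty \<Rightarrow> expr \<Rightarrow> expr \<Rightarrow> expr" where
  "EFilter t l c = EFold l (ENil t) (EIf (EWeak c) (ECons (EVar 1) (EVar 0)) (EVar 0))"

lemma eval_EAny [simp]:
  "eval (EAny l c) env = vb (\<exists>x\<in>set (elems (eval l env)). num (eval c (x # env)) \<noteq> 0)"
proof -
  let ?f = "\<lambda>acc x. if num acc \<noteq> 0 then N 1 else if num (eval c (x # env)) \<noteq> 0 then N 1 else N 0"
  have "foldl ?f (N (if b then 1 else 0)) xs = vb (b \<or> (\<exists>x\<in>set xs. num (eval c (x # env)) \<noteq> 0))" for xs b
  proof (induction xs arbitrary: b)
    case (Cons x xs)
    have "?f (N (if b then 1 else 0)) x = N (if b \<or> num (eval c (x # env)) \<noteq> 0 then 1 else 0)" by simp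
    then show ?case using Cons[of "b \<or> num (eval c (x # env)) \<noteq> 0"] by simp
  qed (simp add: vb_def)
  from this[of False] show ?thesis by (simp add: EAny_def cong: if_cong)
qed

lemma eval_EAll [simp]:
  "eval (EAll l c) env = vb (\<forall>x\<in>set (elems (eval l env)). num (eval c (x # env)) \<noteq> 0)"
proof -
  let ?f = "\<lambda>acc x. if num acc \<noteq> 0 then if num (eval c (x # env)) \<noteq> 0 then N 1 else N 0 else N 0"
  have "foldl ?f (N (if b then 1 else 0)) xs = vb (b \<and> (\<forall>x\<in>set xs. num (eval c (x # env)) \<noteq> 0))" for xs b
  proof (induction xs arbitrary: b)
    case (Cons x xs)
    have "?f (N (if b then 1 else 0)) x = N (if b \<and> num (eval c (x # env)) \<noteq> 0 then 1 else 0)" by simp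
    then show ?case using Cons[of "b \<and> num (eval c (x # env)) \<noteq> 0"] by simp
  qed (simp add: vb_def)
  from this[of True] show ?thesis by (simp add: EAll_def cong: if_cong)
qed

lemma eval_ECount [simp]:
  "eval (ECount l c) env = N (length (filter (\<lambda>x. num (eval c (x # env)) \<noteq> 0) (elems (eval l env))))"
proof -
  have "foldl (\<lambda>acc x. if num (eval c (x # env)) \<noteq> 0 then N (num acc + 1) else acc) (N n) xs
    = N (n + length (filter (\<lambda>x. num (eval c (x # env)) \<noteq> 0) xs))" for xs n
    by (induction xs arbitrary: n) auto
  from this[of 0] show ?thesis by (simp add: ECount_def cong: if_cong)
qed

lemma eval_EFilter [simp]:
  "eval (EFilter t l c) env = L (rev (filter (\<lambda>x. num (eval c (x # env)) \<noteq> 0) (elems (eval l env))))"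
proof -
  have "foldl (\<lambda>acc x. if num (eval c (x # env)) \<noteq> 0 then L (x # elems acc) else acc) (L ys) xs
    = L (rev (filter (\<lambda>x. num (eval c (x # env)) \<noteq> 0) xs) @ ys)" for xs ys
    by (induction xs arbitrary: ys) auto
  from this[of "[]"] show ?thesis by (simp add: EFilter_def cong: if_cong)
qed

lemma bnd_loop [simp]:
  assumes "bnd M l env" "length (elems (eval l env)) \<le> M"
    and "\<forall>x\<in>set (elems (eval l env)). bnd M c (x # env)"
  shows "bnd M (EAny l c) env" "bnd M (EAll l c) env" "bnd M (ECount l c) env" "bnd M (EFilter t l c) env"
  using assms by (auto simp: EAny_def EAll_def ECount_def EFilter_def intro!: fold_okI)

definition EMem :: "expr \<Rightarrow> expr \<Rightarrow> expr" where
  "EMem a l = EAny l (EEqE (EVar 0) (EWeak a))"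
definition EDisj :: "expr \<Rightarrow> expr \<Rightarrow> expr" where
  "EDisj s t = EAll s (ENot (EMem (EVar 0) (EWeak t)))"
definition ESubs :: "expr \<Rightarrow> expr \<Rightarrow> expr" where
  "ESubs s t = EAll s (EMem (EVar 0) (EWeak t))"
definition ELen :: "expr \<Rightarrow> expr" where
  "ELen l = ECount l (ENum 1)"
definition ECnt :: "expr \<Rightarrow> expr \<Rightarrow> expr" where
  "ECnt i l = ECount l (EEqN (ESnd (EVar 0)) (EWeak i))"
definition EAppR :: "expr \<Rightarrow> expr \<Rightarrow> expr" where
  "EAppR s t = EFold s t (ECons (EVar 1) (EVar 0))"
definition EFlat :: "expr \<Rightarrow> expr" where
  "EFlat X = EFold X (ENil TE) (EAppR (EVar 1) (EVar 0))"
text \<open>Multiplication by repeated addition, since the machine has none. The first factor is the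
  number of iterations, so it is the one that has to be bounded.\<close>

definition EMul :: "expr \<Rightarrow> expr \<Rightarrow> expr" where
  "EMul a b = ERep a (ENum 0) (EAdd (EVar 0) (EWeak b))"

text \<open>Reading arguments through the decoders makes the rule unconditional: it rewrites without
  a hypothesis on the form of the values.\<close>

lemma eval_EMem [simp]: "eval (EMem a l) env = vb (dE (eval a env) \<in> set (dS (eval l env)))"
proof -
  have "(\<exists>x\<in>A. dE x = e) \<longleftrightarrow> e \<in> dE ` A" for A e by (auto simp: image_iff)
  then show ?thesis by (simp add: EMem_def set_dS)
qed

lemma eval_EDisj [simp]: "eval (EDisj s t) env = vb (set (dS (eval s env)) \<inter> set (dS (eval t env)) = {})"
proof -
  have "(\<forall>x\<in>A. dE x \<notin> B) \<longleftrightarrow> dE ` A \<inter> B = {}" for A B by blast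
  then show ?thesis by (simp add: EDisj_def set_dS[of "eval s env"])
qed

lemma eval_ESubs [simp]: "eval (ESubs s t) env = vb (set (dS (eval s env)) \<subseteq> set (dS (eval t env)))"
proof -
  have "(\<forall>x\<in>A. dE x \<in> B) \<longleftrightarrow> dE ` A \<subseteq> B" for A B by blast
  then show ?thesis by (simp add: ESubs_def set_dS[of "eval s env"])
qed

lemma eval_ELen [simp]: "eval (ELen l) env = N (length (elems (eval l env)))"
  by (simp add: ELen_def)

lemma eval_ECnt [simp]: "eval (ECnt i l) env = N (owner_count (num (eval i env)) (dS (eval l env)))"
  by (simp add: ECnt_def owner_count_def dS_def filter_map o_def dE_def)

lemma foldl_cons: "foldl (\<lambda>acc x. L (x # elems acc)) (L ys) xs = L (rev xs @ ys)"
  by (induction xs arbitrary: ys) auto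

lemma eval_EAppR [simp]:
  "L (elems (eval t env)) = eval t env \<Longrightarrow>
   eval (EAppR s t) env = L (rev (elems (eval s env)) @ elems (eval t env))"
  using foldl_cons[of "elems (eval t env)" "elems (eval s env)"] by (simp add: EAppR_def)

lemma L_elems [simp]: "L (elems (vs s)) = vs s" "L (elems (vf F)) = vf F" "L (elems (vx X)) = vx X"
  by (simp_all add: vs_def vf_def vx_def)

lemma eval_EFlat [simp]: "eval X env = vf F \<Longrightarrow> eval (EFlat X) env = vs (flat F)"
proof -
  have "foldl (\<lambda>acc x. eval (EAppR (EVar 1) (EVar 0)) (acc # x # env)) (vs ys) (map vs F)
    = vs (foldl (\<lambda>acc s. rev s @ acc) ys F)" for ys
  proof (induction F arbitrary: ys)
    case (Cons s F)
    have "eval (EAppR (EVar 1) (EVar 0)) (vs ys # vs s # env) = vs (rev s @ ys)"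
      by (simp add: vs_def rev_map)
    then show ?case using Cons by simp
  qed simp
  from this[of "[]"] show "eval X env = vf F \<Longrightarrow> eval (EFlat X) env = vs (flat F)"
    by (simp add: EFlat_def flat_def vs_def[of "[]"])
qed

lemma eval_EMul [simp]: "eval (EMul a b) env = N (num (eval a env) * num (eval b env))"
proof -
  have "((\<lambda>acc. N (num acc + num (eval b env))) ^^ n) (N 0) = N (n * num (eval b env))" for n
    by (induction n) auto
  then show ?thesis by (simp add: EMul_def)
qed

lemma bnd_EMem [simp]:
  "bnd M a env \<Longrightarrow> bnd M l env \<Longrightarrow> length (elems (eval l env)) \<le> M \<Longrightarrow> bnd M (EMem a l) env"
  by (simp add: EMem_def)

lemma bnd_EDisj [simp]:
  "bnd M s env \<Longrightarrow> bnd M t env \<Longrightarrow> length (elems (eval s env)) \<le> M \<Longrightarrow> length (elems (eval t env)) \<le> M \<Longrightarrow>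
   bnd M (EDisj s t) env"
  "bnd M s env \<Longrightarrow> bnd M t env \<Longrightarrow> length (elems (eval s env)) \<le> M \<Longrightarrow> length (elems (eval t env)) \<le> M \<Longrightarrow>
   bnd M (ESubs s t) env"
  by (simp_all add: EDisj_def ESubs_def)

lemma bnd_ELen [simp]:
  "bnd M l env \<Longrightarrow> length (elems (eval l env)) \<le> M \<Longrightarrow> bnd M (ELen l) env"
  by (simp add: ELen_def)

lemma bnd_ECnt [simp]:
  "bnd M i env \<Longrightarrow> bnd M l env \<Longrightarrow> length (elems (eval l env)) \<le> M \<Longrightarrow> bnd M (ECnt i l) env"
  by (simp add: ECnt_def)

lemma bnd_EAppR [simp]:
  "bnd M s env \<Longrightarrow> bnd M t env \<Longrightarrow> length (elems (eval s env)) \<le> M \<Longrightarrow> bnd M (EAppR s t) env"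
  by (auto simp: EAppR_def intro!: fold_okI)

lemma bnd_EFlat [simp]:
  "bnd M X env \<Longrightarrow> length (elems (eval X env)) \<le> M \<Longrightarrow>
   \<forall>s\<in>set (elems (eval X env)). length (elems s) \<le> M \<Longrightarrow> bnd M (EFlat X) env"
  by (auto simp: EFlat_def intro!: fold_okI)

lemma bnd_EMul [simp]:
  "bnd M a env \<Longrightarrow> bnd M b env \<Longrightarrow> num (eval a env) \<le> M \<Longrightarrow> bnd M (EMul a b) env"
  by (simp add: EMul_def)

text \<open>When an iteration is checked, the accumulator is the fold over the prefix already
  processed, for which an explicit description is available.\<close>

lemma fold_ok_map:
  "(\<And>ys x zs. xs = ys @ x # zs \<Longrightarrow> g (foldl f a (map h ys)) (h x)) \<Longrightarrow> fold_ok f g (map h xs) a"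
proof (induction xs arbitrary: a)
  case (Cons x xs)
  have "g a (h x)" using Cons.prems[of "[]" x xs] by simp
  moreover have "fold_ok f g (map h xs) (f a (h x))"
    by (rule Cons.IH) (use Cons.prems[of "x # _"] in simp)
  ultimately show ?case by simp
qed simp

section \<open>Thinning as a program\<close>

abbreviation "TPat \<equiv> TP TN TS"

text \<open>In the inner body index 1 is the pattern being extended and index 3 the element of
  \<open>s\<close> from the outer loop; four weakenings lead back to the environment of
  \<open>b\<close>.\<close>

definition EPats :: "expr \<Rightarrow> expr \<Rightarrow> expr" where
  "EPats b s = EFold s (ECons (EPair (ENum 1) (ENil TE)) (ENil TPat))
     (EFold (EVar 0) (ENil TPat)
       (ECons (EPair (EFst (EVar 1)) (ECons (EVar 3) (ESnd (EVar 1))))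
         (ECons (EPair (EMul (EWeak (EWeak (EWeak (EWeak b)))) (EFst (EVar 1))) (ESnd (EVar 1))) (EVar 0))))"

lemma foldl_pattern_step:
  "foldl (\<lambda>acc' p. L (P (vfst p) (L (ve x # elems (vsnd p))) # P (N (n * num (vfst p))) (vsnd p) # elems acc'))
     (L (map vp ys)) (map vp acc)
   = L (map vp (foldl (\<lambda>acc' p. (fst p, x # snd p) # (n * fst p, snd p) # acc') ys acc))"
proof (induction acc arbitrary: ys)
  case (Cons p acc)
  have "map vp ((fst p, x # snd p) # (n * fst p, snd p) # ys) =
    P (N (fst p)) (L (ve x # map ve (snd p))) # P (N (n * fst p)) (vs (snd p)) # map vp ys"
    by (simp add: vp_def vs_def)
  then show ?case using Cons[of "(fst p, x # snd p) # (n * fst p, snd p) # ys"] by simp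
qed simp

lemma foldl_patterns:
  "foldl (\<lambda>acc x. eval (EFold (EVar 0) (ENil TPat)
       (ECons (EPair (EFst (EVar 1)) (ECons (EVar 3) (ESnd (EVar 1))))
         (ECons (EPair (EMul (EWeak (EWeak (EWeak (EWeak b)))) (EFst (EVar 1))) (ESnd (EVar 1))) (EVar 0))))
       (acc # x # env)) (L [P (N 1) (L [])]) (map ve s)
   = L (map vp (patterns (num (eval b env)) s))"
proof (induction s rule: rev_induct)
  case Nil
  show ?case by (simp add: patterns_def vp_def vs_def)
next
  case (snoc x s)
  show ?case unfolding map_append foldl_append snoc patterns_snoc
    using foldl_pattern_step[of x "num (eval b env)" "[]"] by (simp add: numeral_3_eq_3)
qed

lemma eval_EPats:
  "eval s env = vs s' \<Longrightarrow> eval (EPats b s) env = L (map vp (patterns (num (eval b env)) s'))"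
  using foldl_patterns[of b env s'] by (simp add: EPats_def)

lemma bnd_EPats:
  assumes "eval s env = vs s'" "bnd M s env" "bnd M b env" "num (eval b env) \<le> M"
    and "length s' \<le> M" "2 ^ length s' \<le> M"
  shows "bnd M (EPats b s) env"
proof -
  let ?e = "EFold (EVar 0) (ENil TPat)
       (ECons (EPair (EFst (EVar 1)) (ECons (EVar 3) (ESnd (EVar 1))))
         (ECons (EPair (EMul (EWeak (EWeak (EWeak (EWeak b)))) (EFst (EVar 1))) (ESnd (EVar 1))) (EVar 0)))"
  have "fold_ok (\<lambda>acc x. eval ?e (acc # x # env)) (\<lambda>acc x. bnd M ?e (acc # x # env)) (map ve s') (L [P (N 1) (L [])])"
  proof (rule fold_ok_map)
    fix ys x zs assume s': "s' = ys @ x # zs"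
    \<comment> \<open>The inner loop runs over the patterns of the prefix \<open>ys\<close>, whose
      number doubles with every element.\<close>
    have "(2::nat) ^ length ys \<le> 2 ^ length s'" unfolding s' by (intro power_increasing) auto
    then have "length (patterns (num (eval b env)) ys) \<le> M" unfolding length_patterns using assms(6) by (rule le_trans)
    then show "bnd M ?e (foldl (\<lambda>acc x. eval ?e (acc # x # env)) (L [P (N 1) (L [])]) (map ve ys) # ve x # env)"
      unfolding foldl_patterns using assms(3,4) by (auto intro!: fold_okI)
  qed
  then show ?thesis using assms by (simp add: EPats_def)
qed

lemma length_pattern_le: "p \<in> set (patterns b s) \<Longrightarrow> length (snd p) \<le> length s"
proof (induction s arbitrary: p rule: rev_induct)
  case Nil
  then show ?case by (simp add: patterns_def)
next
  case (snoc x s)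
  from snoc.prems obtain p' where "p' \<in> set (patterns b s)"
    "p = (fst p', x # snd p') \<or> p = (b * fst p', snd p')"
    by (auto simp: patterns_snoc set_pattern_step)
  then show ?case using snoc.IH[of p'] by auto
qed

definition ESame :: "expr \<Rightarrow> expr \<Rightarrow> expr \<Rightarrow> expr" where
  "ESame T s t = EAnd (EEqN (ELen s) (ELen t))
     (EAll T (EAnd (EEqN (EMem (EVar 0) (EWeak s)) (EMem (EVar 0) (EWeak t)))
       (EEqN (ECnt (ESnd (EVar 0)) (EWeak s)) (ECnt (ESnd (EVar 0)) (EWeak t)))))"

lemma eval_ESame [simp]:
  "eval (ESame T s t) env = vb (same_type (dS (eval T env)) (dS (eval s env)) (dS (eval t env)))"
proof -
  have "length (elems v) = length (dS v)" for v by (simp add: dS_def)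
  moreover have "num (vsnd v) = snd (dE v)" for v by (simp add: dE_def)
  ultimately show ?thesis by (simp add: ESame_def same_type_def set_dS[of "eval T env"])
qed

lemma bnd_ESame [simp]:
  assumes "bnd M T env" "bnd M s env" "bnd M t env" "length (elems (eval T env)) \<le> M"
    "length (elems (eval s env)) \<le> M" "length (elems (eval t env)) \<le> M"
  shows "bnd M (ESame T s t) env"
  using assms by (simp add: ESame_def)

definition EAdm :: "expr \<Rightarrow> expr \<Rightarrow> expr \<Rightarrow> expr \<Rightarrow> expr" where
  "EAdm T b K s = EAll (EPats b s)
     (ELess (ECount (EWeak K) (EAnd (ESubs (ESnd (EVar 1)) (EVar 0)) (ESame (EWeak (EWeak T)) (EWeak (EWeak s)) (EVar 0))))
       (EFst (EVar 0)))"

lemma eval_EAdm: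
  assumes "eval s env = vs s'" "eval K env = vf K'"
  shows "eval (EAdm T b K s) env = vb (admissible (dS (eval T env)) (num (eval b env)) K' s')"
  using assms by (simp add: EAdm_def eval_EPats admissible_def core_count_def filter_map o_def)

lemma bnd_EAdm:
  assumes "eval s env = vs s'" "eval K env = vf K'"
    and "bnd M T env" "bnd M b env" "bnd M K env" "bnd M s env"
    and "length (elems (eval T env)) \<le> M" "num (eval b env) \<le> M" "length K' \<le> M"
    and "length s' \<le> M" "2 ^ length s' \<le> M" "\<And>t. t \<in> set K' \<Longrightarrow> length t \<le> M"
  shows "bnd M (EAdm T b K s) env"
proof -
  let ?P = "patterns (num (eval b env)) s'"
  have P: "length (snd p) \<le> M" if "p \<in> set ?P" for p using length_pattern_le[OF that] assms(10) by simp
  have inner: "bnd M (ECount (EWeak K) (EAnd (ESubs (ESnd (EVar 1)) (EVar 0))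
      (ESame (EWeak (EWeak T)) (EWeak (EWeak s)) (EVar 0)))) (vp p # env)" if "p \<in> set ?P" for p
    by (rule bnd_loop(3)) (use assms P[OF that] in auto)
  show ?thesis unfolding EAdm_def
  proof (rule bnd_loop(2))
    show "bnd M (EPats b s) env" by (rule bnd_EPats[OF assms(1,6,4,8,10,11)])
  qed (use assms(11) inner in \<open>auto simp: eval_EPats[OF assms(1)] length_patterns simp del: One_nat_def\<close>)
qed

definition EKern :: "expr \<Rightarrow> expr \<Rightarrow> expr \<Rightarrow> expr" where
  "EKern T b F = EFold F (ENil TS)
     (EIf (EAdm (EWeak (EWeak T)) (EWeak (EWeak b)) (EVar 0) (EVar 1)) (ECons (EVar 1) (EVar 0)) (EVar 0))"

lemma foldl_kernel:
  "foldl (\<lambda>acc x. eval (EIf (EAdm (EWeak (EWeak T)) (EWeak (EWeak b)) (EVar 0) (EVar 1)) (ECons (EVar 1) (EVar 0)) (EVar 0))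
      (acc # x # env)) (L []) (map vs F)
   = vf (sp_kernel (dS (eval T env)) (num (eval b env)) F)"
proof (induction F rule: rev_induct)
  case Nil
  show ?case by (simp add: sp_kernel_def vf_def)
next
  case (snoc s F)
  let ?K = "sp_kernel (dS (eval T env)) (num (eval b env)) F"
  have "eval (EAdm (EWeak (EWeak T)) (EWeak (EWeak b)) (EVar 0) (EVar 1)) (vf ?K # vs s # env)
    = vb (admissible (dS (eval T env)) (num (eval b env)) ?K s)"
    using eval_EAdm[of "EVar 1" "vf ?K # vs s # env" s "EVar 0" ?K] by simp
  then show ?case unfolding map_append foldl_append snoc kernel_snoc by (simp add: vf_def)
qed

lemma eval_EKern:
  "eval F env = vf F' \<Longrightarrow> eval (EKern T b F) env = vf (sp_kernel (dS (eval T env)) (num (eval b env)) F')"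
  using foldl_kernel[of T b env F'] by (simp add: EKern_def)

lemma bnd_EKern:
  assumes "eval F env = vf F'" "bnd M F env" "bnd M T env" "bnd M b env"
    and "length (elems (eval T env)) \<le> M" "num (eval b env) \<le> M" "length F' \<le> M"
    and "\<And>s. s \<in> set F' \<Longrightarrow> length s \<le> M \<and> 2 ^ length s \<le> M"
  shows "bnd M (EKern T b F) env"
proof -
  let ?e = "EIf (EAdm (EWeak (EWeak T)) (EWeak (EWeak b)) (EVar 0) (EVar 1)) (ECons (EVar 1) (EVar 0)) (EVar 0)"
  have "fold_ok (\<lambda>acc x. eval ?e (acc # x # env)) (\<lambda>acc x. bnd M ?e (acc # x # env)) (map vs F') (L [])"
  proof (rule fold_ok_map)
    fix ys s zs assume F': "F' = ys @ s # zs"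
    let ?K = "sp_kernel (dS (eval T env)) (num (eval b env)) ys"
    have "length ?K \<le> M" using length_kernel_le_length[of "dS (eval T env)" "num (eval b env)" ys] assms(7) F' by simp
    moreover have "set ?K \<subseteq> set F'" using set_kernel_subset[of _ _ ys] F' by auto
    moreover have "s \<in> set F'" using F' by simp
    ultimately have "bnd M (EAdm (EWeak (EWeak T)) (EWeak (EWeak b)) (EVar 0) (EVar 1)) (vf ?K # vs s # env)"
      by (intro bnd_EAdm[of _ _ s _ ?K]) (use assms in auto)
    then show "bnd M ?e (foldl (\<lambda>acc x. eval ?e (acc # x # env)) (L []) (map vs ys) # vs s # env)"
      unfolding foldl_kernel by simp
  qed
  then show ?thesis using assms by (simp add: EKern_def)
qed

section \<open>Greedy packing and exhaustive search as programs\<close>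

definition EInt :: "expr \<Rightarrow> expr" where
  "EInt s = EAll s (EAll (EWeak s) (EEqN (ESnd (EVar 0)) (ESnd (EVar 1))))"

lemma eval_EInt [simp]: "eval s env = vs s' \<Longrightarrow> eval (EInt s) env = vb (internal_list s')"
  by (simp add: EInt_def internal_list_def)

lemma bnd_EInt [simp]: "bnd M s env \<Longrightarrow> length (elems (eval s env)) \<le> M \<Longrightarrow> bnd M (EInt s) env"
  by (simp add: EInt_def)

definition EGreedy :: "expr \<Rightarrow> expr" where
  "EGreedy F = EFold F (ENil TE) (EIf (EDisj (EVar 1) (EVar 0)) (EAppR (EVar 1) (EVar 0)) (EVar 0))"

lemma greedy_snoc:
  "greedy (F @ [s]) = (if set s \<inter> set (greedy F) = {} then rev s @ greedy F else greedy F)"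
  by (simp add: greedy_def)

lemma foldl_greedy:
  "foldl (\<lambda>acc x. eval (EIf (EDisj (EVar 1) (EVar 0)) (EAppR (EVar 1) (EVar 0)) (EVar 0)) (acc # x # env))
     (L []) (map vs F) = vs (greedy F)"
proof (induction F rule: rev_induct)
  case Nil
  show ?case by (simp add: greedy_def vs_def)
next
  case (snoc s F)
  have "eval (EAppR (EVar 1) (EVar 0)) (vs (greedy F) # vs s # env) = vs (rev s @ greedy F)"
    by (simp add: vs_def rev_map)
  then show ?case unfolding map_append foldl_append snoc greedy_snoc by simp
qed

lemma eval_EGreedy: "eval F env = vf F' \<Longrightarrow> eval (EGreedy F) env = vs (greedy F')"
  using foldl_greedy[of env F'] by (simp add: EGreedy_def)

lemma bnd_EGreedy:
  assumes "eval F env = vf F'" "bnd M F env" "length F' \<le> M" "sum_list (map length F') \<le> M"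
    and "\<And>s. s \<in> set F' \<Longrightarrow> length s \<le> M"
  shows "bnd M (EGreedy F) env"
proof -
  let ?e = "EIf (EDisj (EVar 1) (EVar 0)) (EAppR (EVar 1) (EVar 0)) (EVar 0)"
  have "fold_ok (\<lambda>acc x. eval ?e (acc # x # env)) (\<lambda>acc x. bnd M ?e (acc # x # env)) (map vs F') (L [])"
  proof (rule fold_ok_map)
    fix ys s zs assume F': "F' = ys @ s # zs"
    have "length (greedy ys) \<le> M" using length_greedy_le[of ys] assms(4) F' by simp
    then show "bnd M ?e (foldl (\<lambda>acc x. eval ?e (acc # x # env)) (L []) (map vs ys) # vs s # env)"
      unfolding foldl_greedy using assms(5)[of s] F' by simp
  qed
  then show ?thesis using assms by (simp add: EGreedy_def)
qed

text \<open>The candidate set has index 1 in the inner body, but index 2 inside the test, where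
  index 0 is a member of the packing being extended.\<close>

definition EExt :: "expr \<Rightarrow> expr \<Rightarrow> expr" where
  "EExt K Xs = EFold Xs Xs (EFold (EWeak (EWeak K)) (EVar 0)
     (EIf (EAll (EVar 3) (EDisj (EVar 2) (EVar 0))) (ECons (ECons (EVar 1) (EVar 3)) (EVar 0)) (EVar 0)))"

lemma foldl_extend_inner:
  "foldl (\<lambda>acc' s. eval (EIf (EAll (EVar 3) (EDisj (EVar 2) (EVar 0))) (ECons (ECons (EVar 1) (EVar 3)) (EVar 0)) (EVar 0))
      (acc' # s # acc # vf X # env)) (vx Xs) (map vs K)
   = vx (foldl (\<lambda>acc s. if \<forall>x\<in>set X. set s \<inter> set x = {} then (s # X) # acc else acc) Xs K)"
proof (induction K arbitrary: Xs)
  case (Cons s K)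
  have "eval (EIf (EAll (EVar 3) (EDisj (EVar 2) (EVar 0))) (ECons (ECons (EVar 1) (EVar 3)) (EVar 0)) (EVar 0))
      (vx Xs # vs s # acc # vf X # env) = vx (if \<forall>x\<in>set X. set s \<inter> set x = {} then (s # X) # Xs else Xs)"
    by (simp add: numeral_3_eq_3 numeral_2_eq_2) (simp add: vx_def vf_def)
  then show ?case using Cons by simp
qed simp

lemma eval_EExt:
  assumes "eval K env = vf K'" "eval Xs env = vx Xs'"
  shows "eval (EExt K Xs) env = vx (extend K' Xs')"
proof -
  have "foldl (\<lambda>acc X. foldl (\<lambda>acc' s. eval (EIf (EAll (EVar 3) (EDisj (EVar 2) (EVar 0)))
        (ECons (ECons (EVar 1) (EVar 3)) (EVar 0)) (EVar 0)) (acc' # s # acc # X # env)) acc (map vs K')) (vx Ys) (map vf Zs)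
    = vx (foldl (\<lambda>acc X. foldl (\<lambda>acc s. if \<forall>x\<in>set X. set s \<inter> set x = {} then (s # X) # acc else acc) acc K') Ys Zs)"
    for Ys Zs
  proof (induction Zs arbitrary: Ys)
    case (Cons Z Zs)
    show ?case by (simp only: list.map foldl_Cons foldl_extend_inner Cons)
  qed simp
  then show ?thesis using assms by (simp add: EExt_def extend_def del: eval.simps(10))
qed

lemma bnd_EExt:
  assumes "eval K env = vf K'" "eval Xs env = vx Xs'" "bnd M K env" "bnd M Xs env"
    and "length K' \<le> M" "length Xs' \<le> M" "\<And>s. s \<in> set K' \<Longrightarrow> length s \<le> M"
    and "\<And>X. X \<in> set Xs' \<Longrightarrow> length X \<le> M" "\<And>X s. X \<in> set Xs' \<Longrightarrow> s \<in> set X \<Longrightarrow> length s \<le> M"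
  shows "bnd M (EExt K Xs) env"
proof -
  have inner: "bnd M (EAll (EVar 3) (EDisj (EVar 2) (EVar 0))) (a' # vs s # a # vf X # env)"
    if "s \<in> set K'" "X \<in> set Xs'" for s X a a'
    by (rule bnd_loop(2))
      (use assms(7)[OF that(1)] assms(8)[OF that(2)] assms(9)[OF that(2)] in
        \<open>auto simp: numeral_3_eq_3 numeral_2_eq_2\<close>)
  show ?thesis unfolding EExt_def using assms(1-6) inner by (auto intro!: fold_okI)
qed

definition EPacks :: "expr \<Rightarrow> expr \<Rightarrow> expr" where
  "EPacks K q = ERep q (ECons (ENil TS) (ENil TF)) (EExt (EWeak K) (EVar 0))"

lemma funpow_packs:
  "eval K env = vf K' \<Longrightarrow>
   ((\<lambda>acc. eval (EExt (EWeak K) (EVar 0)) (acc # env)) ^^ q) (L [L []]) = vx (packs K' q)"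
proof (induction q)
  case 0
  show ?case by (simp add: packs_def vx_def vf_def)
next
  case (Suc q)
  then show ?case using eval_EExt[of "EWeak K" "vx (packs K' q) # env" K' "EVar 0" "packs K' q"]
    by (simp add: packs_def)
qed

lemma eval_EPacks:
  "eval K env = vf K' \<Longrightarrow> eval (EPacks K q) env = vx (packs K' (num (eval q env)))"
  using funpow_packs[of K env K' "num (eval q env)"] by (simp add: EPacks_def)

lemma bnd_EPacks:
  assumes "eval K env = vf K'" "bnd M K env" "bnd M q env" "eval q env = N q'"
    and "q' \<le> M" "length K' \<le> M" "(length K' + 1) ^ q' \<le> M"
    and K': "\<And>s. s \<in> set K' \<Longrightarrow> length s \<le> M" "\<forall>s\<in>set K'. distinct s"
  shows "bnd M (EPacks K q) env"
proof -
  have "bnd M (EExt (EWeak K) (EVar 0)) (((\<lambda>acc. eval (EExt (EWeak K) (EVar 0)) (acc # env)) ^^ j) (L [L []]) # env)"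
    if j: "j < q'" for j
    unfolding funpow_packs[OF assms(1)]
  proof (rule bnd_EExt[of _ _ K' _ "packs K' j"])
    have "length (packs K' j) \<le> (length K' + 1) ^ j" by (rule length_packs_le)
    also have "\<dots> \<le> (length K' + 1) ^ q'" using j by (intro power_increasing) auto
    finally show "length (packs K' j) \<le> M" using assms(7) by simp
    show "length X \<le> M" if "X \<in> set (packs K' j)" for X
      using that j assms(5) set_packs[OF K'(2)] by simp
    show "length s \<le> M" if "X \<in> set (packs K' j)" "s \<in> set X" for X s
      using that K'(1) set_packs[OF K'(2)] by auto
  qed (use assms in auto)
  then show ?thesis using assms by (simp add: EPacks_def)
qed

lemma owner_count_flat [simp]: "owner_count i (flat X) = owner_count i (concat X)"
  by (simp add: owner_count_def flat_eq rev_filter[symmetric])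

lemma length_flat [simp]: "length (flat X) = length (concat X)"
  by (simp add: flat_eq)

lemma set_flat [simp]: "set (flat X) = set (concat X)"
  by (simp add: flat_eq)

definition ERej :: "expr \<Rightarrow> expr \<Rightarrow> expr" where
  "ERej X R = EAny (EFlat R)
     (EAnd (ELess (ECnt (ESnd (EVar 0)) (EFlat (EWeak X))) (ECnt (ESnd (EVar 0)) (EFlat (EWeak R))))
       (EAll (EWeak R) (EOr (EAny (EWeak (EWeak X)) (EAnd (ESubs (EVar 1) (EVar 0)) (ESubs (EVar 0) (EVar 1))))
         (EAll (EVar 0) (EEqN (ESnd (EVar 0)) (ESnd (EVar 2)))))))"

lemma eval_EFlat_weak: "eval X env = vf F \<Longrightarrow> eval (EFlat (EWeak X)) (v # env) = vs (flat F)"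
  by (rule eval_EFlat) simp

lemma eval_ERej:
  assumes "eval X env = vf X'" "eval R env = vf R'"
  shows "eval (ERej X R) env = vb (list_rejects X' R')"
proof -
  have "A \<subseteq> B \<and> B = A \<longleftrightarrow> A \<subseteq> B \<and> B \<subseteq> A" for A B :: "elt set" by blast
  then show ?thesis using assms
    by (simp add: ERej_def list_rejects_def eval_EFlat[OF assms(2)] eval_EFlat_weak[OF assms(1)]
      eval_EFlat_weak[OF assms(2)] numeral_2_eq_2 del: set_concat)
qed

lemma bnd_ERej:
  assumes "eval X env = vf X'" "eval R env = vf R'" "bnd M X env" "bnd M R env"
    and "length X' \<le> M" "length R' \<le> M" "length (concat X') \<le> M" "length (concat R') \<le> M"
    and "\<And>s. s \<in> set X' \<Longrightarrow> length s \<le> M" "\<And>s. s \<in> set R' \<Longrightarrow> length s \<le> M"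
  shows "bnd M (ERej X R) env"
proof -
  have f: "bnd M (EFlat R) env" "\<And>v. bnd M (EFlat (EWeak R)) (v # env)" "\<And>v. bnd M (EFlat (EWeak X)) (v # env)"
    by (rule bnd_EFlat; use assms in auto)+
  note ev = eval_EFlat[OF assms(2)] eval_EFlat_weak[OF assms(1)] eval_EFlat_weak[OF assms(2)]
  have sub: "bnd M (EAll (EWeak R) (EOr (EAny (EWeak (EWeak X)) (EAnd (ESubs (EVar 1) (EVar 0)) (ESubs (EVar 0) (EVar 1))))
         (EAll (EVar 0) (EEqN (ESnd (EVar 0)) (ESnd (EVar 2)))))) (ve e # env)" for e
    by (rule bnd_loop(2)) (use assms in \<open>auto intro!: bnd_bool bnd_loop\<close>)
  show ?thesis unfolding ERej_def
    by (rule bnd_loop(1)) (use f sub assms(7,8) in \<open>auto simp: ev simp del: length_concat intro!: bnd_bool\<close>)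
qed

definition EBrute :: "expr \<Rightarrow> expr \<Rightarrow> expr" where
  "EBrute Ps k = EAny Ps (EAnd (ENot (ELess (ELen (EFlat (EVar 0))) (EWeak k)))
     (ENot (EAny (EWeak Ps) (ERej (EVar 1) (EVar 0)))))"

lemma eval_EBrute:
  assumes "eval Ps env = vx Ps'"
  shows "eval (EBrute Ps k) env = vb (\<exists>X\<in>set Ps'. num (eval k env) \<le> length (concat X) \<and>
    \<not> (\<exists>R\<in>set Ps'. list_rejects X R))"
proof -
  have "eval (EFlat (EVar 0)) (vf X # env) = vs (flat X)" for X by (rule eval_EFlat) simp
  moreover have "eval (ERej (EVar 1) (EVar 0)) (vf R # vf X # env) = vb (list_rejects X R)" for X R
    by (rule eval_ERej) simp_all
  ultimately show ?thesis using assms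
    by (simp add: EBrute_def not_less del: length_concat)
qed

lemma bnd_EBrute:
  assumes "eval Ps env = vx Ps'" "bnd M Ps env" "bnd M k env" "length Ps' \<le> M"
    and "\<And>X. X \<in> set Ps' \<Longrightarrow> length X \<le> M \<and> length (concat X) \<le> M"
    and "\<And>X s. X \<in> set Ps' \<Longrightarrow> s \<in> set X \<Longrightarrow> length s \<le> M"
  shows "bnd M (EBrute Ps k) env"
proof -
  have ev: "eval (EFlat (EVar 0)) (vf X # env) = vs (flat X)" for X by (rule eval_EFlat) simp
  have "bnd M (EFlat (EVar 0)) (vf X # env)" if "X \<in> set Ps'" for X
    by (rule bnd_EFlat) (use that assms in auto)
  moreover have "bnd M (ERej (EVar 1) (EVar 0)) (vf R # vf X # env)" if "X \<in> set Ps'" "R \<in> set Ps'" for X R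
    by (rule bnd_ERej) (use that assms in auto)
  ultimately show ?thesis unfolding EBrute_def
    using assms by (auto simp: ev simp del: length_concat One_nat_def intro!: bnd_loop bnd_bool)
qed

section \<open>Assembling the decision procedure\<close>

lemma eval_EFilter_sets:
  assumes "eval l env = vf F" "\<And>s. num (eval c (vs s # env)) \<noteq> 0 \<longleftrightarrow> Q s"
  shows "eval (EFilter t l c) env = vf (rev (filter Q F))"
  using assms by (simp add: filter_map o_def) (simp add: vf_def rev_map)

abbreviation "ENonempty \<equiv> ECase (EVar 0) (ENum 0) (ENum 1)"

text \<open>In the innermost body the environment is, from index 0: packings, all kept sets, kept
  cross sets, cross sets, elements of the kept internal sets, kept internal sets, internal sets,
  \<open>b\<close>, \<open>W\<close>, \<open>q\<close>, \<open>F\<close>, the input family and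
  \<open>k\<close>.\<close>

definition EKernelSearch :: "nat \<Rightarrow> expr" where
  "EKernelSearch d =
    ELet (EAdd (EMul (ENum d) (EVar 1)) (ENum 1))
    (ELet (EFilter TS (EVar 3) (EInt (EVar 0)))
    (ELet (EKern (EVar 2) (EVar 1) (EVar 0))
    (ELet (EFlat (EVar 0))
    (ELet (EFilter TS (EVar 6) (ENot (EInt (EVar 0))))
    (ELet (EKern (EVar 1) (EVar 4) (EVar 0))
    (ELet (EAppR (EVar 3) (EVar 0))
    (ELet (EPacks (EVar 0) (EVar 8))
    (EBrute (EVar 0) (EVar 12)))))))))"

definition EDecide :: "nat \<Rightarrow> expr" where
  "EDecide d =
    ELet (EFilter TS (EVar 0) ENonempty)
    (ELet (EMul (ENum (d + 1)) (EVar 2))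
    (ELet (EGreedy (EVar 1))
    (EIf (ENot (ELess (ELen (EVar 0)) (EVar 1))) (ENum 1) (EKernelSearch d))))"

text \<open>The bound of \<open>length_kernels_le\<close>, which for fixed \<open>d\<close> is
  polynomial in \<open>q\<close>.\<close>

definition kernel_bound :: "nat \<Rightarrow> nat \<Rightarrow> nat" where
  "kernel_bound d q = 2 * ((2 * d * ((2 * q + 2) ^ d * (d * q + 1) ^ d) + 2 * q + 2) ^ d * (d * q + 1) ^ d)"

lemma sum_list_kernel_le: "sum_list (map length (sp_kernel T b F)) \<le> sum_list (map length F)"
  by (induction F rule: rev_induct) (auto simp: kernel_snoc sp_kernel_def[of _ _ "[]"])

lemma sum_list_filter_le: "sum_list (map length (rev (filter Q F))) \<le> sum_list (map length F)"
  by (induction F) auto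

lemma EKernelSearch_correct:
  fixes fam :: "elt list list"
  assumes F: "\<forall>s\<in>set F. distinct s" "\<forall>s\<in>set F. length s \<le> d"
    and W: "length W \<le> q" "length W \<le> M" "1 \<le> q"
    and M: "length F \<le> M" "sum_list (map length F) \<le> M" "2 ^ d + d \<le> M" "q + d * q + 1 \<le> M"
      "(kernel_bound d q + 1) ^ q \<le> M"
  defines "b \<equiv> d * q + 1"
  defines "K1 \<equiv> sp_kernel W b (rev (filter internal_list F))"
  defines "K2 \<equiv> sp_kernel (flat K1) b (rev (filter (\<lambda>s. \<not> internal_list s) F))"
  shows "eval (EKernelSearch d) (vs W # N q # vf F # vf fam # N k # env) = vb (brute_force (rev K1 @ K2) q k)"
    and "bnd M (EKernelSearch d) (vs W # N q # vf F # vf fam # N k # env)"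
proof -
  let ?e3 = "vs W # N q # vf F # vf fam # N k # env"
  let ?F1 = "rev (filter internal_list F)" and ?F2 = "rev (filter (\<lambda>s. \<not> internal_list s) F)"
  let ?e4 = "N b # ?e3"
  let ?e5 = "vf ?F1 # ?e4"
  let ?e6 = "vf K1 # ?e5"
  let ?e7 = "vs (flat K1) # ?e6"
  let ?e8 = "vf ?F2 # ?e7"
  let ?e9 = "vf K2 # ?e8"
  let ?K = "rev K1 @ K2"
  let ?e10 = "vf ?K # ?e9"
  let ?e11 = "vx (packs ?K q) # ?e10"
  have 4: "eval (EAdd (EMul (ENum d) (EVar 1)) (ENum 1)) ?e3 = N b" by (simp add: b_def)
  have 5: "eval (EFilter TS (EVar 3) (EInt (EVar 0))) ?e4 = vf ?F1"
    by (rule eval_EFilter_sets) (simp_all add: eval_EInt[of _ _ "_ :: elt list"])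
  have 6: "eval (EKern (EVar 2) (EVar 1) (EVar 0)) ?e5 = vf K1"
    using eval_EKern[of "EVar 0" ?e5 ?F1 "EVar 2" "EVar 1"] by (simp add: K1_def)
  have 7: "eval (EFlat (EVar 0)) ?e6 = vs (flat K1)" by (rule eval_EFlat) simp
  have 8: "eval (EFilter TS (EVar 6) (ENot (EInt (EVar 0)))) ?e7 = vf ?F2"
    by (rule eval_EFilter_sets) simp_all
  have 9: "eval (EKern (EVar 1) (EVar 4) (EVar 0)) ?e8 = vf K2"
    using eval_EKern[of "EVar 0" ?e8 ?F2 "EVar 1" "EVar 4"] by (simp add: K2_def)
  have 10: "eval (EAppR (EVar 3) (EVar 0)) ?e9 = vf ?K"
    using eval_EAppR[of "EVar 0" ?e9 "EVar 3"] by (simp add: vf_def rev_map)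
  have 11: "eval (EPacks (EVar 0) (EVar 8)) ?e10 = vx (packs ?K q)"
    using eval_EPacks[of "EVar 0" ?e10 ?K "EVar 8"] by simp
  have 12: "eval (EBrute (EVar 0) (EVar 12)) ?e11 = vb (brute_force ?K q k)"
    using eval_EBrute[of "EVar 0" ?e11 "packs ?K q" "EVar 12"] by (simp add: brute_force_def)
  show "eval (EKernelSearch d) ?e3 = vb (brute_force ?K q k)"
    unfolding EKernelSearch_def eval.simps(11) 4 5 6 7 8 9 10 11 12 ..
  have sub: "set K1 \<subseteq> set F" "set K2 \<subseteq> set F"
    using set_kernel_subset[of W b ?F1] set_kernel_subset[of "flat K1" b ?F2] by (auto simp: K1_def K2_def)
  have dM: "length s \<le> M \<and> 2 ^ length s \<le> M" if "s \<in> set F" for s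
  proof -
    have "length s \<le> d" using F(2) that by blast
    moreover from this have "(2::nat) ^ length s \<le> 2 ^ d" by (intro power_increasing) auto
    ultimately show ?thesis using M(3) by linarith
  qed
  have lF: "length ?F1 \<le> M" "length ?F2 \<le> M"
    using le_trans[OF length_filter_le M(1)] by simp_all
  have lK1: "length K1 \<le> M" using length_kernel_le_length[of W b ?F1] lF(1) unfolding K1_def by (rule le_trans)
  have "length ?K \<le> kernel_bound d q"
    unfolding kernel_bound_def K2_def K1_def b_def by (rule length_kernels_le[OF F _ _ W(1)]) auto
  then have Kq: "(length ?K + 1) ^ q \<le> M" using M(5) power_mono[of "length ?K + 1" "kernel_bound d q + 1" q] by simp
  \<comment> \<open>With \<open>1 \<le> q\<close> the bound on the number of packings also bounds
    the number of kept sets.\<close>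
  have "length ?K + 1 \<le> (length ?K + 1) ^ q" using W(3) by (intro self_le_power) auto
  then have KM: "length ?K \<le> M" using Kq by simp
  have bM: "b \<le> M" "q \<le> M" "d * q \<le> M" using M(4) by (simp_all add: b_def)
  have K: "\<forall>s\<in>set ?K. distinct s" "\<And>s. s \<in> set ?K \<Longrightarrow> length s \<le> d" "\<And>s. s \<in> set ?K \<Longrightarrow> length s \<le> M"
    using sub F dM by auto
  have flatM: "length (flat K1) \<le> M"
  proof -
    have "length (concat K1) \<le> sum_list (map length F)"
      unfolding length_concat K1_def using sum_list_kernel_le sum_list_filter_le by (rule le_trans)
    then show ?thesis using M(2) by simp
  qed
  have b4: "bnd M (EAdd (EMul (ENum d) (EVar 1)) (ENum 1)) ?e3" using M(3) by simp
  have b5: "bnd M (EFilter TS (EVar 3) (EInt (EVar 0))) ?e4" by (rule bnd_loop(4)) (use M(1) dM in auto)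
  have b6: "bnd M (EKern (EVar 2) (EVar 1) (EVar 0)) ?e5"
    by (rule bnd_EKern[of _ _ ?F1]) (use W(2) bM lF(1) dM in auto)
  have b7: "bnd M (EFlat (EVar 0)) ?e6" by (rule bnd_EFlat) (use lK1 sub(1) dM in auto)
  have b8: "bnd M (EFilter TS (EVar 6) (ENot (EInt (EVar 0)))) ?e7" by (rule bnd_loop(4)) (use M(1) dM in auto)
  have b9: "bnd M (EKern (EVar 1) (EVar 4) (EVar 0)) ?e8"
    by (rule bnd_EKern[of _ _ ?F2]) (use flatM bM lF(2) dM in auto)
  have b10: "bnd M (EAppR (EVar 3) (EVar 0)) ?e9" by (rule bnd_EAppR) (use lK1 in simp_all)
  have b11: "bnd M (EPacks (EVar 0) (EVar 8)) ?e10"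
    by (rule bnd_EPacks[of _ _ ?K _ _ q]) (use K KM Kq bM in simp_all)
  have b12: "bnd M (EBrute (EVar 0) (EVar 12)) ?e11"
  proof (rule bnd_EBrute[of _ _ "packs ?K q"])
    show "length (packs ?K q) \<le> M" using length_packs_le[of ?K q] Kq by (rule le_trans)
    have p: "length X \<le> q" "set X \<subseteq> set ?K" if "X \<in> set (packs ?K q)" for X
      using that set_packs[OF K(1)] by auto
    show "length X \<le> M \<and> length (concat X) \<le> M" if X: "X \<in> set (packs ?K q)" for X
    proof -
      have "length (concat X) \<le> d * length X" by (rule length_concat_le) (use p(2)[OF X] K(2) in blast)
      also have "\<dots> \<le> d * q" using p(1)[OF X] by (rule mult_le_mono2)
      finally show ?thesis using p(1)[OF X] bM by linarith
    qed
    show "length s \<le> M" if "X \<in> set (packs ?K q)" "s \<in> set X" for X s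
      using p(2)[OF that(1)] that(2) K(3) by blast
  qed simp_all
  show "bnd M (EKernelSearch d) ?e3"
    unfolding EKernelSearch_def bnd.simps(11) 4 5 6 7 8 9 10 11
    by (intro conjI b4 b5 b6 b7 b8 b9 b10 b11 b12)
qed

text \<open>Collects the loop bounds that depend only on \<open>d\<close> and \<open>k\<close>:
  subsets of one set, numeric parameters, and packings of kept sets. Loops over input data are
  bounded separately by the input length.\<close>

definition search_bound :: "nat \<Rightarrow> nat \<Rightarrow> nat" where
  "search_bound d k = 2 ^ d + d + 1 + ((d + 1) * k + d * ((d + 1) * k) + 1) +
     (kernel_bound d ((d + 1) * k) + 1) ^ ((d + 1) * k)"

lemma EDecide_correct:
  assumes fam: "\<forall>s\<in>set fam. distinct s" "\<forall>s\<in>set fam. length s \<le> d"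
    and M: "length fam \<le> M" "sum_list (map length fam) \<le> M" "search_bound d k \<le> M"
  shows "eval (EDecide d) (vf fam # N k # env) = vb (decide d k fam)"
    and "bnd M (EDecide d) (vf fam # N k # env)"
proof -
  let ?e0 = "vf fam # N k # env"
  define F where "F = rev (filter (\<lambda>s. s \<noteq> []) fam)"
  define q where "q = (d + 1) * k"
  define W where "W = greedy F"
  let ?e1 = "vf F # ?e0"
  let ?e2 = "N q # ?e1"
  let ?e3 = "vs W # ?e2"
  have 1: "eval (EFilter TS (EVar 0) ENonempty) ?e0 = vf F"
    unfolding F_def
  proof (rule eval_EFilter_sets)
    show "num (eval ENonempty (vs s # ?e0)) \<noteq> 0 \<longleftrightarrow> s \<noteq> []" for s by (cases s) simp_all
  qed simp
  have 2: "eval (EMul (ENum (d + 1)) (EVar 2)) ?e1 = N q" by (simp add: q_def numeral_2_eq_2)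
  have 3: "eval (EGreedy (EVar 1)) ?e2 = vs W" unfolding W_def by (rule eval_EGreedy) simp
  have c: "eval (ENot (ELess (ELen (EVar 0)) (EVar 1))) ?e3 = vb (q \<le> length W)" by (simp add: not_less)
  have F: "\<forall>s\<in>set F. distinct s" "\<forall>s\<in>set F. length s \<le> d" using fam by (auto simp: F_def)
  have "length F \<le> length fam" by (simp add: F_def)
  then have lF: "length F \<le> M" using M(1) by simp
  have sF: "sum_list (map length F) \<le> M"
    using sum_list_filter_le M(2) unfolding F_def by (rule le_trans)
  have lW: "length W \<le> M" using length_greedy_le sF unfolding W_def by (rule le_trans)
  have MM: "2 ^ d + d + 1 \<le> M" "q + d * q + 1 \<le> M" "(kernel_bound d q + 1) ^ q \<le> M"
    using M(3) by (simp_all add: search_bound_def q_def)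
  have dM: "length s \<le> M" if "s \<in> set F" for s using F(2) that MM(1) by (meson add_leE le_trans)
  have b1: "bnd M (EFilter TS (EVar 0) ENonempty) ?e0"
    by (rule bnd_loop(4)) (use M(1) in \<open>simp_all split: list.split\<close>)
  have b2: "bnd M (EMul (ENum (d + 1)) (EVar 2)) ?e1" using MM(1) by simp
  have b3: "bnd M (EGreedy (EVar 1)) ?e2" by (rule bnd_EGreedy[of _ _ F]) (use lF sF dM in simp_all)
  have bc: "bnd M (ENot (ELess (ELen (EVar 0)) (EVar 1))) ?e3" using lW by simp
  have dec: "decide d k fam \<longleftrightarrow> q \<le> length W \<or>
      (let b = d * q + 1; K1 = sp_kernel W b (rev (filter internal_list F));
         K2 = sp_kernel (flat K1) b (rev (filter (\<lambda>s. \<not> internal_list s) F))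
       in brute_force (rev K1 @ K2) q k)"
    unfolding decide_def F_def W_def q_def Let_def ..
  have step: "eval (EDecide d) ?e0 = (if q \<le> length W then N 1 else eval (EKernelSearch d) ?e3)"
    unfolding EDecide_def eval.simps(11) 1 2 3 eval.simps(10) c by simp
  have bstep: "bnd M (EDecide d) ?e0 \<longleftrightarrow> (q \<le> length W \<or> bnd M (EKernelSearch d) ?e3)"
    unfolding EDecide_def bnd.simps(11) 1 2 3 bnd.simps(10) c using b1 b2 b3 bc by simp
  have "eval (EDecide d) ?e0 = vb (decide d k fam) \<and> bnd M (EDecide d) ?e0"
  proof (cases "q \<le> length W")
    case True
    then show ?thesis unfolding step bstep dec by (simp add: vb_def)
  next
    case False
    \<comment> \<open>For \<open>q = 0\<close> the greedy test has already answered yes, so the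
      search is entered only with a positive \<open>q\<close>.\<close>
    then have "length W \<le> q" "1 \<le> q" by simp_all
    moreover have "2 ^ d + d \<le> M" using MM(1) by simp
    ultimately have "eval (EKernelSearch d) ?e3 = vb (brute_force (rev (sp_kernel W (d * q + 1) (rev (filter internal_list F))) @
        sp_kernel (flat (sp_kernel W (d * q + 1) (rev (filter internal_list F)))) (d * q + 1)
          (rev (filter (\<lambda>s. \<not> internal_list s) F))) q k)"
      "bnd M (EKernelSearch d) ?e3"
      using EKernelSearch_correct[OF F _ lW _ lF sF _ MM(2,3), where fam = fam and k = k and env = env] by blast+
    then show ?thesis using False unfolding step bstep dec Let_def by simp
  qed
  then show "eval (EDecide d) ?e0 = vb (decide d k fam)" "bnd M (EDecide d) ?e0" by blast+
qed

section \<open>Parsing the input\<close>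

definition ETake :: "expr \<Rightarrow> expr \<Rightarrow> expr" where
  "ETake n l = ERep n (EPair (ENil TN) l)
     (ECase (ESnd (EVar 0)) (EVar 0) (EPair (ECons (EVar 0) (EFst (EVar 2))) (EVar 1)))"

lemma funpow_take:
  "((\<lambda>acc. eval (ECase (ESnd (EVar 0)) (EVar 0) (EPair (ECons (EVar 0) (EFst (EVar 2))) (EVar 1))) (acc # env)) ^^ n)
     (P (L []) (L (map N xs))) = P (L (map N (rev (take n xs)))) (L (map N (drop n xs)))"
proof (induction n)
  case (Suc n)
  show ?case
  proof (cases "n < length xs")
    case True
    then have "drop n xs = xs ! n # drop (Suc n) xs" "take (Suc n) xs = take n xs @ [xs ! n]"
      by (simp_all add: Cons_nth_drop_Suc take_Suc_conv_app_nth)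
    then show ?thesis using Suc by (simp add: numeral_2_eq_2)
  next
    case False
    then show ?thesis using Suc by simp
  qed
qed simp

lemma eval_ETake:
  assumes "eval n env = N n'" "eval l env = L (map N xs)"
  shows "eval (ETake n l) env = P (L (map N (rev (take n' xs)))) (L (map N (drop n' xs)))"
  using funpow_take[where env = env and n = n' and xs = xs] assms by (simp add: ETake_def del: eval.simps(13))

lemma bnd_ETake:
  "bnd M n env \<Longrightarrow> bnd M l env \<Longrightarrow> num (eval n env) \<le> M \<Longrightarrow> bnd M (ETake n l) env"
  by (simp add: ETake_def split: list.split)

definition ENth :: "expr \<Rightarrow> expr \<Rightarrow> expr" where
  "ENth j l = ECase (ERep j l (ECase (EVar 0) (EVar 0) (EVar 1))) (ENum 0) (EVar 0)"

lemma eval_ENth: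
  assumes "eval j env = N j'" "eval l env = L (map N xs)" "j' < length xs"
  shows "eval (ENth j l) env = N (xs ! j')"
proof -
  have "((\<lambda>acc. eval (ECase (EVar 0) (EVar 0) (EVar 1)) (acc # env)) ^^ n) (L (map N xs)) = L (map N (drop n xs))" for n
  proof (induction n)
    case (Suc n)
    then show ?case by (cases "drop n xs") (auto simp: drop_Suc drop_tl tl_drop[symmetric])
  qed simp
  moreover have "drop j' xs = xs ! j' # drop (Suc j') xs" using assms(3) by (simp add: Cons_nth_drop_Suc)
  ultimately show ?thesis using assms(1,2) by (simp add: ENth_def del: eval.simps(13)) (simp add: eval.simps(13))
qed

lemma bnd_ENth:
  "bnd M j env \<Longrightarrow> bnd M l env \<Longrightarrow> num (eval j env) \<le> M \<Longrightarrow> bnd M (ENth j l) env"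
  by (simp add: ENth_def split: list.split)

text \<open>The prefix delivered by \<open>ETake\<close> is reversed; prepending while folding
  restores its order and attaches the owners at the same time.\<close>

definition EElts :: "expr \<Rightarrow> expr \<Rightarrow> expr" where
  "EElts s l = EFold s (ENil TE) (ECons (EPair (EVar 1) (ENth (EVar 1) (EWeak (EWeak l)))) (EVar 0))"

lemma eval_EElts:
  assumes "eval s env = L (map N (rev js))" "eval l env = L (map N os)" "\<forall>j\<in>set js. j < length os"
  shows "eval (EElts s l) env = vs (map (\<lambda>j. (j, os ! j)) js)"
proof -
  have "foldl (\<lambda>acc x. eval (ECons (EPair (EVar 1) (ENth (EVar 1) (EWeak (EWeak l)))) (EVar 0)) (acc # x # env))
      (vs ys) (map N is) = vs (rev (map (\<lambda>j. (j, os ! j)) is) @ ys)" if "\<forall>j\<in>set is. j < length os" for ys "is"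
    using that
  proof (induction "is" arbitrary: ys)
    case (Cons i "is")
    have "eval (ENth (EVar 1) (EWeak (EWeak l))) (vs ys # N i # env) = N (os ! i)"
      by (rule eval_ENth) (use assms(2) Cons.prems in simp_all)
    then have "eval (ECons (EPair (EVar 1) (ENth (EVar 1) (EWeak (EWeak l)))) (EVar 0)) (vs ys # N i # env)
      = vs ((i, os ! i) # ys)" by (simp add: vs_def ve_def)
    then show ?case using Cons by simp
  qed simp
  from this[of "rev js" "[]"] show ?thesis using assms by (simp add: EElts_def rev_map vs_def[of "[]"])
qed

lemma bnd_EElts:
  assumes "eval s env = L (map N js)" "bnd M s env" "bnd M l env" "length js \<le> M" "\<forall>j\<in>set js. j \<le> M"
  shows "bnd M (EElts s l) env"
proof -
  have "bnd M (ENth (EVar 1) (EWeak (EWeak l))) (a # N j # env)" if "j \<in> set js" for a j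
    by (rule bnd_ENth) (use assms that in simp_all)
  then show ?thesis using assms by (auto simp: EElts_def simp del: One_nat_def intro!: fold_okI)
qed

text \<open>Index 0 holds the sets read so far together with the unread input, index 1 the list of owners.\<close>

definition EParseStep :: expr where
  "EParseStep = ECase (ESnd (EVar 0)) (EVar 0)
     (ELet (ETake (EVar 0) (EVar 1))
       (EPair (ECons (EElts (EFst (EVar 0)) (EVar 4)) (EFst (EVar 3))) (ESnd (EVar 0))))"

abbreviation blocks :: "nat list list \<Rightarrow> nat list" where
  "blocks Ss \<equiv> concat (map (\<lambda>s. length s # s) Ss)"

abbreviation annotate :: "nat list \<Rightarrow> nat list \<Rightarrow> elt list" where
  "annotate os s \<equiv> map (\<lambda>j. (j, os ! j)) s"

lemma EParseStep_correct:
  assumes "\<forall>j\<in>set s. j < length os"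
  shows "eval EParseStep (P (vf F) (L (map N (length s # s @ xs))) # L (map N os) # env)
      = P (vf (annotate os s # F)) (L (map N xs))"
    and "length s \<le> M \<Longrightarrow> length os \<le> M \<Longrightarrow>
      bnd M EParseStep (P (vf F) (L (map N (length s # s @ xs))) # L (map N os) # env)"
proof -
  let ?acc = "P (vf F) (L (map N (length s # s @ xs)))"
  let ?env = "N (length s) # L (map N (s @ xs)) # ?acc # L (map N os) # env"
  let ?t = "P (L (map N (rev s))) (L (map N xs))"
  have t: "eval (ETake (EVar 0) (EVar 1)) ?env = ?t"
    using eval_ETake[of "EVar 0" ?env "length s" "EVar 1" "s @ xs"] by simp
  have e: "eval (EElts (EFst (EVar 0)) (EVar 4)) (?t # ?env) = vs (annotate os s)"
    by (rule eval_EElts) (use assms in simp_all)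
  show "eval EParseStep (?acc # L (map N os) # env) = P (vf (annotate os s # F)) (L (map N xs))"
    unfolding EParseStep_def using t e by (simp add: numeral_3_eq_3) (simp add: vf_def)
  assume M: "length s \<le> M" "length os \<le> M"
  have "bnd M (ETake (EVar 0) (EVar 1)) ?env" by (rule bnd_ETake) (use M in simp_all)
  moreover have "bnd M (EElts (EFst (EVar 0)) (EVar 4)) (?t # ?env)"
    by (rule bnd_EElts[of _ _ "rev s"]) (use assms M in \<open>auto dest: bspec less_imp_le intro: le_trans\<close>)
  ultimately show "bnd M EParseStep (?acc # L (map N os) # env)"
    unfolding EParseStep_def using t by simp
qed

lemma funpow_parse:
  assumes "\<forall>s\<in>set Ss. \<forall>j\<in>set s. j < length os" "n \<le> length Ss"
  shows "((\<lambda>acc. eval EParseStep (acc # L (map N os) # env)) ^^ n) (P (vf []) (L (map N (blocks Ss))))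
    = P (vf (rev (map (annotate os) (take n Ss)))) (L (map N (blocks (drop n Ss))))"
  using assms(2)
proof (induction n)
  case (Suc n)
  then have d: "drop n Ss = Ss ! n # drop (Suc n) Ss" "take (Suc n) Ss = take n Ss @ [Ss ! n]"
    by (simp_all add: Cons_nth_drop_Suc take_Suc_conv_app_nth)
  have "Ss ! n \<in> set Ss" using Suc.prems by simp
  then have "\<forall>j\<in>set (Ss ! n). j < length os" using assms(1) by (rule bspec[rotated])
  from EParseStep_correct(1)[OF this] show ?case using Suc d by simp
qed simp

text \<open>Four nested case distinctions peel off the header, leaving \<open>k\<close> at index 0
  and the number of elements at index 6. Their empty branches are not reached on encoded inputs. The
  last two bindings put the family and \<open>k\<close> where \<open>EDecide\<close> expects
  them.\<close>

definition EMain :: "nat \<Rightarrow> expr" where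
  "EMain d = ECase (EVar 0) (ENum 0) (ECase (EVar 1) (ENum 0) (ECase (EVar 1) (ENum 0) (ECase (EVar 1) (ENum 0)
     (ELet (ETake (EVar 6) (EVar 1))
     (ELet (EAppR (EFst (EVar 0)) (ENil TN))
     (ELet (EFst (ERep (EVar 4) (EPair (ENil TS) (ESnd (EVar 1))) EParseStep))
     (ELet (EVar 3)
     (ELet (EVar 1) (EDecide d)))))))))"

lemma EMain_correct:
  assumes w: "w = [length os, p, length Ss, k] @ os @ blocks Ss"
    and Ss: "\<forall>s\<in>set Ss. distinct s \<and> length s \<le> d \<and> (\<forall>j\<in>set s. j < length os)"
    and M: "length w + search_bound d k \<le> M"
  shows "eval (EMain d) [L (map N w)] = vb (decide d k (rev (map (annotate os) Ss)))"
    and "bnd M (EMain d) [L (map N w)]"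
proof -
  let ?fam = "rev (map (annotate os) Ss)"
  let ?n = "length os" and ?m = "length Ss"
  let ?r4 = "L (map N (os @ blocks Ss))"
  let ?r3 = "L (map N (k # os @ blocks Ss))"
  let ?r2 = "L (map N (?m # k # os @ blocks Ss))"
  let ?r1 = "L (map N (p # ?m # k # os @ blocks Ss))"
  let ?env = "[N k, ?r4, N ?m, ?r3, N p, ?r2, N ?n, ?r1, L (map N w)]"
  let ?t = "P (L (map N (rev os))) (L (map N (blocks Ss)))"
  let ?o = "L (map N os)"
  let ?e2 = "?o # ?t # ?env"
  let ?e5 = "vf ?fam # N k # vf ?fam # ?e2"
  have js: "\<forall>s\<in>set Ss. \<forall>j\<in>set s. j < length os" using Ss by blast
  have t: "eval (ETake (EVar 6) (EVar 1)) ?env = ?t"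
    using eval_ETake[of "EVar 6" ?env ?n "EVar 1" "os @ blocks Ss"] by simp
  have o: "eval (EAppR (EFst (EVar 0)) (ENil TN)) (?t # ?env) = ?o"
    using eval_EAppR[of "ENil TN" "?t # ?env" "EFst (EVar 0)"] by (simp add: rev_map)
  have init: "eval (EPair (ENil TS) (ESnd (EVar 1))) ?e2 = P (vf []) (L (map N (blocks Ss)))"
    by (simp add: vf_def)
  have parse: "eval (EFst (ERep (EVar 4) (EPair (ENil TS) (ESnd (EVar 1))) EParseStep)) ?e2 = vf ?fam"
    using funpow_parse[OF js, of ?m "?t # ?env"] by (simp add: vf_def[of "[]"])
  have lSs: "length Ss \<le> length (blocks Ss)" by (induction Ss) auto
  have lb: "length s \<le> length (blocks Ss)" if "s \<in> set Ss" for s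
    using that by (induction Ss) auto
  have sum: "sum_list (map length ?fam) \<le> length (blocks Ss)"
    by (induction Ss) auto
  have lw: "length w = 4 + length os + length (blocks Ss)" by (simp add: w)
  have dec: "eval (EDecide d) ?e5 = vb (decide d k ?fam)" "bnd M (EDecide d) ?e5"
  proof -
    have f: "\<forall>s\<in>set ?fam. distinct s" "\<forall>s\<in>set ?fam. length s \<le> d"
      using Ss by (auto simp: distinct_map inj_on_def)
    have l: "length ?fam \<le> M" using lSs M lw unfolding length_rev length_map by linarith
    have m: "sum_list (map length ?fam) \<le> M" "search_bound d k \<le> M" using sum M lw by linarith+
    show "eval (EDecide d) ?e5 = vb (decide d k ?fam)" by (rule EDecide_correct(1)[OF f l m])
    show "bnd M (EDecide d) ?e5" by (rule EDecide_correct(2)[OF f l m])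
  qed
  show "eval (EMain d) [L (map N w)] = vb (decide d k ?fam)"
    unfolding EMain_def w using t o parse dec(1) by (simp add: w del: length_concat map_append)
  have bt: "bnd M (ETake (EVar 6) (EVar 1)) ?env" by (rule bnd_ETake) (use M lw in simp_all)
  have bo: "bnd M (EAppR (EFst (EVar 0)) (ENil TN)) (?t # ?env)" by (rule bnd_EAppR) (use M lw in simp_all)
  have bp: "bnd M (EFst (ERep (EVar 4) (EPair (ENil TS) (ESnd (EVar 1))) EParseStep)) ?e2"
  proof -
    have "bnd M EParseStep (((\<lambda>acc. eval EParseStep (acc # ?e2)) ^^ j) (P (vf []) (L (map N (blocks Ss)))) # ?e2)"
      if j: "j < ?m" for j
    proof -
      have d: "drop j Ss = Ss ! j # drop (Suc j) Ss" using j by (simp add: Cons_nth_drop_Suc)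
      have mem: "Ss ! j \<in> set Ss" using j by simp
      have "\<forall>i\<in>set (Ss ! j). i < length os" using js mem by (rule bspec)
      moreover have "length (Ss ! j) \<le> M" "length os \<le> M" using lb[OF mem] M lw by linarith+
      ultimately show ?thesis using funpow_parse[OF js, of j "?t # ?env"] j d
          EParseStep_correct(2)[of "Ss ! j" os M "rev (map (annotate os) (take j Ss))" "blocks (drop (Suc j) Ss)"]
        by simp
    qed
    then show ?thesis using init M lw lSs by (simp del: length_concat)
  qed
  show "bnd M (EMain d) [L (map N w)]"
    unfolding EMain_def w using t o parse dec(2) bt bo bp by (simp add: w del: length_concat map_append)
qed

section \<open>Well-typedness of the programs\<close>

lemma typeof_bool [simp]:
  "typeof a \<Gamma> = Some TN \<Longrightarrow> typeof (ENot a) \<Gamma> = Some TN"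
  "typeof a \<Gamma> = Some TN \<Longrightarrow> typeof b \<Gamma> = Some TN \<Longrightarrow> typeof (EAnd a b) \<Gamma> = Some TN"
  "typeof a \<Gamma> = Some TN \<Longrightarrow> typeof b \<Gamma> = Some TN \<Longrightarrow> typeof (EOr a b) \<Gamma> = Some TN"
  "typeof a \<Gamma> = Some TN \<Longrightarrow> typeof b \<Gamma> = Some TN \<Longrightarrow> typeof (ELess a b) \<Gamma> = Some TN"
  by (simp_all add: ENot_def EAnd_def EOr_def ELess_def)

lemma typeof_eq [simp]:
  "typeof a \<Gamma> = Some TN \<Longrightarrow> typeof b \<Gamma> = Some TN \<Longrightarrow> typeof (EEqN a b) \<Gamma> = Some TN"
  "typeof a \<Gamma> = Some TE \<Longrightarrow> typeof b \<Gamma> = Some TE \<Longrightarrow> typeof (EEqE a b) \<Gamma> = Some TN"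
  by (simp_all add: EEqN_def EEqE_def)

lemma typeof_loop:
  assumes "typeof l \<Gamma> = Some (TL t)" "typeof c (t # \<Gamma>) = Some TN"
  shows "typeof (EAny l c) \<Gamma> = Some TN" "typeof (EAll l c) \<Gamma> = Some TN" "typeof (ECount l c) \<Gamma> = Some TN"
    "typeof (EFilter t l c) \<Gamma> = Some (TL t)"
  using assms by (simp_all add: EAny_def EAll_def ECount_def EFilter_def)

lemma typeof_EMem [simp]:
  "typeof a \<Gamma> = Some TE \<Longrightarrow> typeof l \<Gamma> = Some TS \<Longrightarrow> typeof (EMem a l) \<Gamma> = Some TN"
  by (simp add: EMem_def typeof_loop[where t = TE])

lemma typeof_sets [simp]:
  "typeof s \<Gamma> = Some TS \<Longrightarrow> typeof t \<Gamma> = Some TS \<Longrightarrow> typeof (EDisj s t) \<Gamma> = Some TN"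
  "typeof s \<Gamma> = Some TS \<Longrightarrow> typeof t \<Gamma> = Some TS \<Longrightarrow> typeof (ESubs s t) \<Gamma> = Some TN"
  "typeof s \<Gamma> = Some TS \<Longrightarrow> typeof (ELen s) \<Gamma> = Some TN"
  "typeof i \<Gamma> = Some TN \<Longrightarrow> typeof s \<Gamma> = Some TS \<Longrightarrow> typeof (ECnt i s) \<Gamma> = Some TN"
  "typeof s \<Gamma> = Some TS \<Longrightarrow> typeof (EInt s) \<Gamma> = Some TN"
  by (simp_all add: EDisj_def ESubs_def ELen_def ECnt_def EInt_def typeof_loop[where t = TE])

lemma typeof_EAppR:
  "typeof s \<Gamma> = Some (TL u) \<Longrightarrow> typeof t \<Gamma> = Some (TL u) \<Longrightarrow> typeof (EAppR s t) \<Gamma> = Some (TL u)"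
  by (simp add: EAppR_def)

lemma typeof_EFlat [simp]: "typeof X \<Gamma> = Some TF \<Longrightarrow> typeof (EFlat X) \<Gamma> = Some TS"
  by (simp add: EFlat_def typeof_EAppR[where u = TE])

lemma typeof_EMul [simp]:
  "typeof a \<Gamma> = Some TN \<Longrightarrow> typeof b \<Gamma> = Some TN \<Longrightarrow> typeof (EMul a b) \<Gamma> = Some TN"
  by (simp add: EMul_def)

lemma typeof_EPats [simp]:
  "typeof b \<Gamma> = Some TN \<Longrightarrow> typeof s \<Gamma> = Some TS \<Longrightarrow> typeof (EPats b s) \<Gamma> = Some (TL TPat)"
  by (simp add: EPats_def numeral_3_eq_3)

lemma typeof_ESame [simp]:
  "typeof T \<Gamma> = Some TS \<Longrightarrow> typeof s \<Gamma> = Some TS \<Longrightarrow> typeof t \<Gamma> = Some TS \<Longrightarrow>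
   typeof (ESame T s t) \<Gamma> = Some TN"
  by (simp add: ESame_def typeof_loop[where t = TE])

lemma typeof_EAdm [simp]:
  "typeof T \<Gamma> = Some TS \<Longrightarrow> typeof b \<Gamma> = Some TN \<Longrightarrow> typeof K \<Gamma> = Some TF \<Longrightarrow> typeof s \<Gamma> = Some TS \<Longrightarrow>
   typeof (EAdm T b K s) \<Gamma> = Some TN"
  by (simp add: EAdm_def typeof_loop(2)[where t = TPat] typeof_loop(3)[where t = TS])

lemma typeof_EKern [simp]:
  "typeof T \<Gamma> = Some TS \<Longrightarrow> typeof b \<Gamma> = Some TN \<Longrightarrow> typeof F \<Gamma> = Some TF \<Longrightarrow> typeof (EKern T b F) \<Gamma> = Some TF"
  by (simp add: EKern_def)

lemma typeof_EGreedy [simp]: "typeof F \<Gamma> = Some TF \<Longrightarrow> typeof (EGreedy F) \<Gamma> = Some TS"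
  by (simp add: EGreedy_def typeof_EAppR[where u = TE])

lemma typeof_EExt [simp]:
  "typeof K \<Gamma> = Some TF \<Longrightarrow> typeof Xs \<Gamma> = Some (TL TF) \<Longrightarrow> typeof (EExt K Xs) \<Gamma> = Some (TL TF)"
  by (simp add: EExt_def typeof_loop[where t = TS] numeral_3_eq_3 numeral_2_eq_2)

lemma typeof_EPacks [simp]:
  "typeof K \<Gamma> = Some TF \<Longrightarrow> typeof q \<Gamma> = Some TN \<Longrightarrow> typeof (EPacks K q) \<Gamma> = Some (TL TF)"
  by (simp add: EPacks_def)

lemma typeof_ERej [simp]:
  assumes "typeof X \<Gamma> = Some TF" "typeof R \<Gamma> = Some TF"
  shows "typeof (ERej X R) \<Gamma> = Some TN"
  unfolding ERej_def
proof (rule typeof_loop(1)[where t = TE])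
  have "typeof (EAll (EVar 0) (EEqN (ESnd (EVar 0)) (ESnd (EVar 2)))) (TS # TE # \<Gamma>) = Some TN"
    by (rule typeof_loop(2)[where t = TE]) (simp_all add: numeral_2_eq_2)
  moreover have "typeof (EAny (EWeak (EWeak X)) (EAnd (ESubs (EVar 1) (EVar 0)) (ESubs (EVar 0) (EVar 1)))) (TS # TE # \<Gamma>) = Some TN"
    by (rule typeof_loop(1)[where t = TS]) (use assms in simp_all)
  ultimately have "typeof (EAll (EWeak R) (EOr (EAny (EWeak (EWeak X)) (EAnd (ESubs (EVar 1) (EVar 0)) (ESubs (EVar 0) (EVar 1))))
         (EAll (EVar 0) (EEqN (ESnd (EVar 0)) (ESnd (EVar 2)))))) (TE # \<Gamma>) = Some TN"
    by (intro typeof_loop(2)[where t = TS, OF _ typeof_bool(3)]) (use assms in simp_all)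
  then show "typeof (EAnd (ELess (ECnt (ESnd (EVar 0)) (EFlat (EWeak X))) (ECnt (ESnd (EVar 0)) (EFlat (EWeak R))))
       (EAll (EWeak R) (EOr (EAny (EWeak (EWeak X)) (EAnd (ESubs (EVar 1) (EVar 0)) (ESubs (EVar 0) (EVar 1))))
         (EAll (EVar 0) (EEqN (ESnd (EVar 0)) (ESnd (EVar 2))))))) (TE # \<Gamma>) = Some TN"
    by (intro typeof_bool) (use assms in simp_all)
qed (use assms in simp)

lemma typeof_EBrute [simp]:
  assumes "typeof Ps \<Gamma> = Some (TL TF)" "typeof k \<Gamma> = Some TN"
  shows "typeof (EBrute Ps k) \<Gamma> = Some TN"
proof -
  have "typeof (EAny (EWeak Ps) (ERej (EVar 1) (EVar 0))) (TF # \<Gamma>) = Some TN"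
    by (rule typeof_loop(1)[where t = TF]) (use assms in simp_all)
  then show ?thesis unfolding EBrute_def
    by (intro typeof_loop(1)[where t = TF] typeof_bool) (use assms in simp_all)
qed

lemma typeof_ETake [simp]:
  "typeof n \<Gamma> = Some TN \<Longrightarrow> typeof l \<Gamma> = Some (TL TN) \<Longrightarrow> typeof (ETake n l) \<Gamma> = Some (TP (TL TN) (TL TN))"
  by (simp add: ETake_def numeral_2_eq_2)

lemma typeof_ENth [simp]:
  "typeof j \<Gamma> = Some TN \<Longrightarrow> typeof l \<Gamma> = Some (TL TN) \<Longrightarrow> typeof (ENth j l) \<Gamma> = Some TN"
  by (simp add: ENth_def)

lemma typeof_EElts [simp]:
  "typeof s \<Gamma> = Some (TL TN) \<Longrightarrow> typeof l \<Gamma> = Some (TL TN) \<Longrightarrow> typeof (EElts s l) \<Gamma> = Some TS"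
  by (simp add: EElts_def)

lemma typeof_EParseStep [simp]:
  "typeof EParseStep (TP TF (TL TN) # TL TN # \<Gamma>) = Some (TP TF (TL TN))"
  by (simp add: EParseStep_def numeral_eq_Suc)

lemma typeof_EKernelSearch [simp]:
  "typeof (EKernelSearch d) (TS # TN # TF # TF # TN # \<Gamma>) = Some TN"
  by (simp add: EKernelSearch_def numeral_eq_Suc typeof_loop(4)[where t = TS] typeof_EAppR[where u = TS])

lemma typeof_EDecide [simp]: "typeof (EDecide d) (TF # TN # \<Gamma>) = Some TN"
  by (simp add: EDecide_def numeral_eq_Suc typeof_loop(4)[where t = TS])

lemma typeof_EMain: "typeof (EMain d) [TL TN] = Some TN"
  by (simp add: EMain_def numeral_eq_Suc typeof_EAppR[where u = TN])

section \<open>Running time\<close>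

text \<open>The base \<open>k + 2\<close> is at least 2 for every \<open>k\<close>, so constants and
  constant factors disappear into the exponent, also for small \<open>k\<close>.\<close>

definition poly_bounded :: "(nat \<Rightarrow> nat) \<Rightarrow> bool" where
  "poly_bounded f \<longleftrightarrow> (\<exists>a. \<forall>k. f k \<le> (k + 2) ^ a)"

text \<open>The growth class of \<open>2 ^ O(k log k)\<close> over the natural numbers. The exponent
  \<open>a * (k + 1)\<close> can absorb constants even at \<open>k = 0\<close>.\<close>

definition slightly_superexp :: "(nat \<Rightarrow> nat) \<Rightarrow> bool" where
  "slightly_superexp f \<longleftrightarrow> (\<exists>a. \<forall>k. f k \<le> (k + 2) ^ (a * (k + 1)))"

lemma const_le_power: "2 \<le> x \<Longrightarrow> c \<le> (x::nat) ^ c"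
  by (meson le_trans less_imp_le_nat less_exp power_mono zero_le)

lemma poly_bounded_const: "poly_bounded (\<lambda>k. c)"
  unfolding poly_bounded_def by (intro exI[of _ c] allI const_le_power) simp

lemma poly_bounded_id: "poly_bounded (\<lambda>k. k)"
  unfolding poly_bounded_def by (intro exI[of _ 1] allI) simp

lemma power_sum_le:
  assumes "2 \<le> (x::nat)" "u \<le> x ^ a" "v \<le> x ^ b"
  shows "u + v \<le> x ^ (a + b + 1)"
proof -
  have "x ^ a \<le> x ^ (a + b)" "x ^ b \<le> x ^ (a + b)" using assms(1) by (simp_all add: power_increasing)
  then have "u + v \<le> 2 * x ^ (a + b)" using assms(2,3) by linarith
  also have "\<dots> \<le> x * x ^ (a + b)" using assms(1) by (rule mult_le_mono1)
  finally show ?thesis by simp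
qed

lemma poly_bounded_add: "poly_bounded f \<Longrightarrow> poly_bounded g \<Longrightarrow> poly_bounded (\<lambda>k. f k + g k)"
proof -
  assume "poly_bounded f" "poly_bounded g"
  then obtain a b where "\<And>k. f k \<le> (k + 2) ^ a" "\<And>k. g k \<le> (k + 2) ^ b" by (auto simp: poly_bounded_def)
  then show ?thesis unfolding poly_bounded_def
    by (intro exI[of _ "a + b + 1"] allI power_sum_le) simp_all
qed

lemma poly_bounded_mult: "poly_bounded f \<Longrightarrow> poly_bounded g \<Longrightarrow> poly_bounded (\<lambda>k. f k * g k)"
proof -
  assume "poly_bounded f" "poly_bounded g"
  then obtain a b where "\<And>k. f k \<le> (k + 2) ^ a" "\<And>k. g k \<le> (k + 2) ^ b" by (auto simp: poly_bounded_def)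
  then have "f k * g k \<le> (k + 2) ^ (a + b)" for k unfolding power_add by (intro mult_le_mono)
  then show ?thesis unfolding poly_bounded_def by blast
qed

lemma poly_bounded_power: "poly_bounded f \<Longrightarrow> poly_bounded (\<lambda>k. f k ^ n)"
proof (induction n)
  case (Suc n)
  then show ?case using poly_bounded_mult[of f "\<lambda>k. f k ^ n"] by simp
qed (simp add: poly_bounded_const)

lemma slightly_superexp_poly: "poly_bounded f \<Longrightarrow> slightly_superexp f"
proof -
  assume "poly_bounded f"
  then obtain a where a: "\<And>k. f k \<le> (k + 2) ^ a" by (auto simp: poly_bounded_def)
  have "(k + 2) ^ a \<le> (k + 2) ^ (a * (k + 1))" for k by (rule power_increasing) simp_all
  then have "f k \<le> (k + 2) ^ (a * (k + 1))" for k using a le_trans by blast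
  then show ?thesis unfolding slightly_superexp_def by blast
qed

lemma slightly_superexp_add:
  "slightly_superexp f \<Longrightarrow> slightly_superexp g \<Longrightarrow> slightly_superexp (\<lambda>k. f k + g k)"
proof -
  assume "slightly_superexp f" "slightly_superexp g"
  then obtain a b where ab: "\<And>k. f k \<le> (k + 2) ^ (a * (k + 1))" "\<And>k. g k \<le> (k + 2) ^ (b * (k + 1))"
    by (auto simp: slightly_superexp_def)
  have "f k + g k \<le> (k + 2) ^ ((a + b + 1) * (k + 1))" for k
  proof -
    have "f k + g k \<le> (k + 2) ^ (a * (k + 1) + b * (k + 1) + 1)"
      by (rule power_sum_le[OF _ ab]) simp
    also have "\<dots> \<le> (k + 2) ^ ((a + b + 1) * (k + 1))"
      by (rule power_increasing) (simp_all add: algebra_simps)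
    finally show ?thesis .
  qed
  then show ?thesis unfolding slightly_superexp_def by blast
qed

lemma slightly_superexp_mult:
  "slightly_superexp f \<Longrightarrow> slightly_superexp g \<Longrightarrow> slightly_superexp (\<lambda>k. f k * g k)"
proof -
  assume "slightly_superexp f" "slightly_superexp g"
  then obtain a b where ab: "\<And>k. f k \<le> (k + 2) ^ (a * (k + 1))" "\<And>k. g k \<le> (k + 2) ^ (b * (k + 1))"
    by (auto simp: slightly_superexp_def)
  have "f k * g k \<le> (k + 2) ^ ((a + b) * (k + 1))" for k
    unfolding add_mult_distrib power_add by (rule mult_le_mono[OF ab])
  then show ?thesis unfolding slightly_superexp_def by blast
qed

lemma slightly_superexp_power_const: "slightly_superexp f \<Longrightarrow> slightly_superexp (\<lambda>k. f k ^ n)"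
proof (induction n)
  case 0
  show ?case using slightly_superexp_poly[OF poly_bounded_const, of 1] by simp
next
  case (Suc n)
  then show ?case using slightly_superexp_mult[of f "\<lambda>k. f k ^ n"] by simp
qed

text \<open>The source of \<open>k log k\<close>: choosing \<open>O(k)\<close> sets from
  polynomially many.\<close>

lemma slightly_superexp_power:
  assumes "poly_bounded f"
  shows "slightly_superexp (\<lambda>k. f k ^ (c * k))"
proof -
  from assms obtain a where a: "\<And>k. f k \<le> (k + 2) ^ a" by (auto simp: poly_bounded_def)
  have "f k ^ (c * k) \<le> (k + 2) ^ (a * c * (k + 1))" for k
  proof -
    have "f k ^ (c * k) \<le> ((k + 2) ^ a) ^ (c * k)" by (rule power_mono[OF a]) simp
    also have "\<dots> = (k + 2) ^ (a * (c * k))" by (simp add: power_mult)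
    also have "\<dots> \<le> (k + 2) ^ (a * c * (k + 1))" by (rule power_increasing) (simp_all add: algebra_simps)
    finally show ?thesis .
  qed
  then show ?thesis unfolding slightly_superexp_def by blast
qed

lemma slightly_superexp_search_bound: "slightly_superexp (search_bound d)"
proof -
  note pb = poly_bounded_add poly_bounded_mult poly_bounded_power poly_bounded_id poly_bounded_const
  have "poly_bounded (\<lambda>k. kernel_bound d ((d + 1) * k) + 1)"
    unfolding kernel_bound_def by (intro pb)
  moreover have "poly_bounded (\<lambda>k. 2 ^ d + d + 1 + ((d + 1) * k + d * ((d + 1) * k) + 1))"
    by (intro pb)
  ultimately show ?thesis unfolding search_bound_def
    by (intro slightly_superexp_add slightly_superexp_power slightly_superexp_poly)
qed

text \<open>For \<open>k \<ge> 2\<close> one has \<open>k + 1 \<le> 2 * k\<close>, and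
  \<open>k + 2 \<le> k ^ 2\<close> gives another factor 2 for the logarithm; hence the constant
  4.\<close>

lemma k_log_k_bigo: "(\<lambda>k. real a * (real k + 1) * log 2 (real k + 2)) \<in> O(\<lambda>k. real k * log 2 (real k))"
proof (rule bigoI[where c = "4 * real a"])
  show "\<forall>\<^sub>F k in at_top. norm (real a * (real k + 1) * log 2 (real k + 2)) \<le> 4 * real a * norm (real k * log 2 (real k))"
    unfolding eventually_at_top_linorder
  proof (intro exI[of _ 2] allI impI)
    fix k :: nat assume k: "2 \<le> k"
    have "real k + 2 \<le> real k ^ 2"
    proof -
      have "2 * real k \<le> real k * real k" using k by (intro mult_right_mono) auto
      then show ?thesis using k unfolding power2_eq_square by linarith
    qed
    then have "log 2 (real k + 2) \<le> log 2 (real k ^ 2)" using k by (subst log_le_cancel_iff) auto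
    also have "\<dots> = 2 * log 2 (real k)" using k by (simp add: log_nat_power)
    finally have l: "log 2 (real k + 2) \<le> 2 * log 2 (real k)" .
    have nn: "0 \<le> log 2 (real k + 2)" "0 \<le> log 2 (real k)" using k by (simp_all add: zero_le_log_cancel_iff)
    have "(real k + 1) * log 2 (real k + 2) \<le> (2 * real k) * (2 * log 2 (real k))"
      by (rule mult_mono) (use k l nn in auto)
    then have "real a * ((real k + 1) * log 2 (real k + 2)) \<le> real a * ((2 * real k) * (2 * log 2 (real k)))"
      by (rule mult_left_mono) simp
    then show "norm (real a * (real k + 1) * log 2 (real k + 2)) \<le> 4 * real a * norm (real k * log 2 (real k))"
      using nn by (simp add: abs_mult mult.assoc mult.left_commute)
  qed
qed

text \<open>Separates the input size from the search bound by
  \<open>(u + v) ^ e \<le> (2 * u) ^ e + (2 * v) ^ e\<close>, the larger summand being at least half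
  the sum. The target allows no constant factor in front of the power of \<open>x\<close>, so the
  factor \<open>g\<close> is turned into \<open>x ^ g\<close>. Taking \<open>e = c + 1\<close> makes
  the exponent positive, so that linear terms are absorbed too.\<close>

lemma polynomial_split:
  fixes x S :: nat
  assumes t: "t \<le> C * (4 + (d + 1) * x + S) ^ c + 16 * (4 + (d + 1) * x) + 20"
  defines "e \<equiv> c + 1"
  defines "g \<equiv> (C + 36) * 2 ^ e * (d + 5) ^ e"
  shows "t \<le> x ^ (g + e) + ((C + 36) * 2 ^ e * S ^ e + g)"
proof -
  let ?N = "4 + (d + 1) * x"
  let ?y = "?N + S"
  have y: "?y ^ e \<le> (2 * ?N) ^ e + (2 * S) ^ e"
  proof (cases "?N \<le> S")
    case True
    then have "?y ^ e \<le> (2 * S) ^ e" by (intro power_mono) simp_all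
    then show ?thesis by simp
  next
    case False
    then have "?y ^ e \<le> (2 * ?N) ^ e" by (intro power_mono) simp_all
    then show ?thesis by simp
  qed
  have "?y ^ c \<le> ?y ^ e" unfolding e_def by (rule power_increasing) simp_all
  then have "C * ?y ^ c \<le> C * ?y ^ e" by (rule mult_le_mono2)
  moreover have "16 * ?N + 20 \<le> 36 * ?y" by simp
  moreover have "?y \<le> ?y ^ e" unfolding e_def by (rule self_le_power) simp_all
  then have "36 * ?y \<le> 36 * ?y ^ e" by (rule mult_le_mono2)
  ultimately have "t \<le> (C + 36) * ?y ^ e" using t unfolding add_mult_distrib by linarith
  also have "\<dots> \<le> (C + 36) * ((2 * ?N) ^ e + (2 * S) ^ e)" using y by (rule mult_le_mono2)
  finally have 1: "t \<le> (C + 36) * 2 ^ e * ?N ^ e + (C + 36) * 2 ^ e * S ^ e"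
    by (simp only: power_mult_distrib[of 2] distrib_left[of "C + 36"] mult.assoc)
  have "(C + 36) * 2 ^ e * ?N ^ e \<le> x ^ (g + e) + g"
  proof (cases "2 \<le> x")
    case True
    then have "?N \<le> (d + 5) * x" by (simp add: algebra_simps)
    then have "?N ^ e \<le> ((d + 5) * x) ^ e" by (rule power_mono) simp
    then have "(C + 36) * 2 ^ e * ?N ^ e \<le> (C + 36) * 2 ^ e * ((d + 5) ^ e * x ^ e)"
      unfolding power_mult_distrib by (rule mult_le_mono2)
    also have "\<dots> = g * x ^ e" by (simp only: g_def mult.assoc)
    also have "\<dots> \<le> x ^ g * x ^ e" using const_le_power[OF True] by (rule mult_le_mono1)
    finally show ?thesis by (simp add: power_add)
  next
    \<comment> \<open>For \<open>x \<le> 1\<close> a power of \<open>x\<close> cannot absorb a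
      constant; the whole term is then at most \<open>g\<close>, which is charged to the other
      part.\<close>
    case False
    then have "(d + 1) * x \<le> (d + 1) * 1" by (intro mult_le_mono2) simp
    then have "?N \<le> d + 5" by simp
    then have "?N ^ e \<le> (d + 5) ^ e" by (rule power_mono) simp
    then have "(C + 36) * 2 ^ e * ?N ^ e \<le> g" unfolding g_def by (rule mult_le_mono2)
    then show ?thesis by simp
  qed
  then show ?thesis using 1 by linarith
qed

section \<open>Encoded instances and the final time bound\<close>

lemma encoded_instance:
  assumes I: "rp_d_sp_instance d I" and w: "encodes w I"
  obtains os Ss where "w = [length os, agents I, length Ss, target I] @ os @ blocks Ss"
    "\<forall>s\<in>set Ss. distinct s \<and> length s \<le> d \<and> (\<forall>j\<in>set s. j < length os)"
    "length os = card (universe I)" "length Ss = card (family I)"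
    "yes_instance I \<longleftrightarrow> solvable snd (set ` set (rev (map (annotate os) Ss))) (target I)"
proof -
  from w obtain us os Ss where us: "distinct us" "set us = universe I" and os: "length os = length us"
    "\<forall>j<length us. os ! j \<in> {1..agents I} \<and> us ! j \<in> part I (os ! j)"
    and Ss: "\<forall>s\<in>set Ss. distinct s \<and> set s \<subseteq> {..<length us}"
    "distinct (map (\<lambda>s. (!) us ` set s) Ss)" "set (map (\<lambda>s. (!) us ` set s) Ss) = family I"
    and weq: "w = [length us, agents I, length Ss, target I] @ os @ blocks Ss"
    unfolding encodes_def by blast
  have inj: "inj_on ((!) us) {..<length us}" using us(1) by (simp add: inj_on_nth)
  have small: "\<forall>S\<in>family I. card S \<le> d" using I unfolding rp_d_sp_instance_def by (elim conjE)
  have disj: "disjoint_family_on (part I) {1..agents I}" using I unfolding rp_d_sp_instance_def by (elim conjE)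
  have len: "length s \<le> d" if s: "s \<in> set Ss" for s
  proof -
    have "card ((!) us ` set s) = card (set s)"
      by (rule card_image) (rule inj_on_subset[OF inj], use Ss(1) s in blast)
    moreover have "(!) us ` set s \<in> family I" using Ss(3) s by auto
    moreover have "length s = card (set s)" using Ss(1) s by (simp add: distinct_card)
    ultimately show ?thesis using small by force
  qed
  \<comment> \<open>Disjointness of the parts makes the owner unique; no value is specified for
    elements outside all parts.\<close>
  define own where "own x = (THE i. i \<in> {1..agents I} \<and> x \<in> part I i)" for x
  have own_eq: "own x = i" if "i \<in> {1..agents I}" "x \<in> part I i" for x i
    unfolding own_def
  proof (rule the_equality)
    show "j = i" if "j \<in> {1..agents I} \<and> x \<in> part I j" for j
      using disj that \<open>i \<in> {1..agents I}\<close> \<open>x \<in> part I i\<close> unfolding disjoint_family_on_def by blast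
  qed (use that in blast)
  have own_us: "own (us ! j) = os ! j" "us ! j \<in> part I (os ! j)" "os ! j \<in> {1..agents I}" if "j < length us" for j
    using own_eq os(2) that by blast+
  have own: "x \<in> part I i \<longleftrightarrow> own x = i" if x: "x \<in> universe I" and i: "i \<in> {1..agents I}" for x i
  proof
    assume "own x = i"
    moreover obtain j where "j < length us" "x = us ! j" using x us(2) by (metis in_set_conv_nth)
    ultimately show "x \<in> part I i" using own_us by auto
  qed (rule own_eq[OF i])
  let ?F = "set ` set (rev (map (annotate os) Ss))"
  \<comment> \<open>Takes an annotated position back to its element. It is injective on the pairs
    that occur, because the position determines the owner and \<open>us\<close> has no
    repetition.\<close>
  let ?g = "\<lambda>e :: elt. us ! fst e"
  have U: "\<exists>j<length us. e = (j, os ! j)" if e: "e \<in> \<Union>?F" for e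
  proof -
    from e obtain s j where "s \<in> set Ss" "j \<in> set s" "e = (j, os ! j)" by auto
    then show ?thesis using Ss(1) by blast
  qed
  have "?g ` set (annotate os s) = (!) us ` set s" for s by (simp add: image_image)
  then have "(`) ?g ` ?F = (\<lambda>s. (!) us ` set s) ` set Ss" by (simp add: image_image)
  then have img: "(`) ?g ` ?F = family I" using Ss(3) by simp
  have "inj_on ?g (\<Union>?F)"
  proof (rule inj_onI)
    fix e e' assume *: "e \<in> \<Union>?F" "e' \<in> \<Union>?F" "us ! fst e = us ! fst e'"
    from U[OF *(1)] U[OF *(2)] obtain j j' where j: "j < length us" "e = (j, os ! j)" "j' < length us" "e' = (j', os ! j')"
      by blast
    then have "j = j'" using *(3) us(1) by (simp add: nth_eq_iff_index_eq)
    then show "e = e'" using j by simp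
  qed
  moreover have "own (?g e) = snd e" if "e \<in> \<Union>?F" for e
    using U[OF that] own_us(1) by auto
  ultimately have "solvable own ((`) ?g ` ?F) (target I) \<longleftrightarrow> solvable snd ?F (target I)"
    by (rule solvable_image_iff[where g = ?g and own' = own and own = snd and F = ?F])
  then have yes: "yes_instance I \<longleftrightarrow> solvable snd ?F (target I)"
    using yes_instance_iff_solvable[OF I own] img by simp
  have U': "length os = card (universe I)" using distinct_card[OF us(1)] us(2) os(1) by simp
  have S': "length Ss = card (family I)" using distinct_card[OF Ss(2)] unfolding Ss(3) by simp
  have all: "\<forall>s\<in>set Ss. distinct s \<and> length s \<le> d \<and> (\<forall>j\<in>set s. j < length os)"
    using Ss(1) len os(1) by (simp add: subset_iff)
  show thesis by (rule that[OF weq[folded os(1)] all U' S' yes])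
qed

theorem theorem13:
  fixes d :: nat
  shows "\<exists>(P :: instr list) (f :: nat \<Rightarrow> real) (c :: nat).
    f \<in> O(\<lambda>k. real k * log 2 (real k)) \<and>
    (\<forall>(I :: 'a rp_instance) w. rp_d_sp_instance d I \<and> encodes w I \<longrightarrow>
      (\<exists>t. halts_within P w t (if yes_instance I then 1 else 0) \<and>
           real t \<le> 2 powr f (target I) + real (card (universe I) + card (family I)) ^ c))"
proof -
  obtain C c where tb: "\<And>M. 1 \<le> M \<Longrightarrow> time_bound M (EMain d) \<le> C * M ^ c"
    using time_bound_poly[of "EMain d"] by blast
  define e where "e = c + 1"
  define g where "g = (C + 36) * 2 ^ e * (d + 5) ^ e"
  have "slightly_superexp (\<lambda>k. (C + 36) * 2 ^ e * search_bound d k ^ e + g)"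
    by (intro slightly_superexp_add slightly_superexp_mult slightly_superexp_power_const
      slightly_superexp_search_bound slightly_superexp_poly[OF poly_bounded_const])
  then obtain a where a: "\<And>k. (C + 36) * 2 ^ e * search_bound d k ^ e + g \<le> (k + 2) ^ (a * (k + 1))"
    unfolding slightly_superexp_def by blast
  \<comment> \<open>Chosen so that \<open>2 powr f k\<close> is exactly
    \<open>(k + 2) ^ (a * (k + 1))\<close>.\<close>
  define f where "f k = real a * (real k + 1) * log 2 (real k + 2)" for k
  have f: "2 powr f k = real ((k + 2) ^ (a * (k + 1)))" for k
  proof -
    have "2 powr f k = 2 powr (log 2 (real k + 2) * (real a * (real k + 1)))"
      by (simp only: f_def mult_ac)
    also have "\<dots> = (2 powr log 2 (real k + 2)) powr (real a * (real k + 1))" by (simp only: powr_powr)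
    also have "\<dots> = (real k + 2) powr real (a * (k + 1))" by (simp add: algebra_simps)
    also have "\<dots> = (real k + 2) ^ (a * (k + 1))" by (rule powr_realpow) simp
    finally show ?thesis by (simp add: add.commute)
  qed
  have "\<exists>t. halts_within (ccomp 0 (run_on_input (EMain d))) w t (if yes_instance I then 1 else 0) \<and>
      real t \<le> 2 powr f (target I) + real (card (universe I) + card (family I)) ^ (g + e)"
    if I: "rp_d_sp_instance d I" and w: "encodes w I" for I :: "'a rp_instance" and w
  proof -
    obtain os Ss where enc: "w = [length os, agents I, length Ss, target I] @ os @ blocks Ss"
      "\<forall>s\<in>set Ss. distinct s \<and> length s \<le> d \<and> (\<forall>j\<in>set s. j < length os)"
      "length os = card (universe I)" "length Ss = card (family I)"
      "yes_instance I \<longleftrightarrow> solvable snd (set ` set (rev (map (annotate os) Ss))) (target I)"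
      by (rule encoded_instance[OF I w])
    let ?k = "target I" and ?x = "card (universe I) + card (family I)"
    \<comment> \<open>One iteration bound for all loops: those over input data are covered by
      \<open>length w\<close>, those of the search by \<open>search_bound\<close>.\<close>
    let ?M = "length w + search_bound d ?k"
    note main = EMain_correct[OF enc(1,2) order_refl]
    have "\<forall>s\<in>set (rev (map (annotate os) Ss)). distinct s" "\<forall>s\<in>set (rev (map (annotate os) Ss)). length s \<le> d"
      using enc(2) by (auto simp: distinct_map inj_on_def)
    then have out: "num (eval (EMain d) [L (map N w)]) = (if yes_instance I then 1 else 0)"
      unfolding main(1) enc(5) using decide_correct[of "rev (map (annotate os) Ss)" d ?k] by (simp add: vb_def)
    obtain t where t: "halts_within (ccomp 0 (run_on_input (EMain d))) w t (if yes_instance I then 1 else 0)"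
      "t \<le> time_bound ?M (EMain d) + 16 * length w + 20"
      using run_on_input_correct[OF typeof_EMain main(2) enc(1)] unfolding out by blast
    \<comment> \<open>A set of at most \<open>d\<close> elements occupies at most
      \<open>d + 1\<close> entries, so for fixed \<open>d\<close> the input length is linear in the
      numbers of elements and sets.\<close>
    have "length (blocks Ss) \<le> (d + 1) * length (map (\<lambda>s. length s # s) Ss)"
      by (rule length_concat_le) (use enc(2) in auto)
    then have lw: "length w \<le> 4 + (d + 1) * ?x"
      using enc(1,3,4) by (simp add: algebra_simps)
    have "time_bound ?M (EMain d) \<le> C * ?M ^ c" by (rule tb) (simp add: search_bound_def)
    also have "\<dots> \<le> C * (4 + (d + 1) * ?x + search_bound d ?k) ^ c"
      using lw by (intro mult_le_mono2 power_mono) simp_all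
    finally have time: "time_bound ?M (EMain d) \<le> C * (4 + (d + 1) * ?x + search_bound d ?k) ^ c" .
    have "t \<le> C * (4 + (d + 1) * ?x + search_bound d ?k) ^ c + 16 * (4 + (d + 1) * ?x) + 20"
      by (rule le_trans[OF t(2) add_mono[OF add_mono[OF time mult_le_mono2[OF lw]] order_refl]])
    from polynomial_split[OF this] have "t \<le> ?x ^ (g + e) + ((C + 36) * 2 ^ e * search_bound d ?k ^ e + g)"
      by (simp only: e_def g_def)
    also have "\<dots> \<le> ?x ^ (g + e) + (?k + 2) ^ (a * (?k + 1))" using a by simp
    finally have "real t \<le> real (?x ^ (g + e) + (?k + 2) ^ (a * (?k + 1)))" by (rule of_nat_mono)
    also have "\<dots> = 2 powr f ?k + real ?x ^ (g + e)" unfolding f by simp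
    finally show ?thesis using t(1) by (intro exI[of _ t] conjI)
  qed
  moreover have "f \<in> O(\<lambda>k. real k * log 2 (real k))" unfolding f_def by (rule k_log_k_bigo)
  ultimately show ?thesis
    by (intro exI[of _ "ccomp 0 (run_on_input (EMain d))"] exI[of _ f] exI[of _ "g + e"]) simp
qed

end
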